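(* In the bounded-domain setup assume (E1) and $\Delta_6:=\sup_D(|V|+|\nabla V|+|\nabla^2V|)<\infty$, $\Delta_7:=\sup_{\Gamma\times[0,\infty)}|g|<\infty$. Let $\sigma$ be the classical solution of (Σ) and define the phase velocities $\mathbf v_2=A(\nabla\sigma-\sigma b)+Ac$ and $\mathbf v_1=V-\mathbf v_2$. Then for any open $U'$ with $\overline{U'}\subset U$ there is $\tilde M>0$ such that for $i=1,2$ and all $t>0$, $$\sup_{x\in U'}|\mathbf v_i(x,t)|\le\tilde M\Big(1+\frac1{\sqrt t}\Big)\Big[e^{-\eta_1t}\sup_U|\sigma_0|+\Delta_6+\sqrt{\Delta_6}+\Delta_7\Big],$$ with $\eta_1=\ln(1+\eta_0)/(qR^2)$. Consequently, if $\lim_{t\to\infty}\{\sup_{x\in U}(|V|+|\nabla V|+|\nabla^2V|)(x,t)+\sup_{x\in\Gamma}|g(x,t)|\}=0$, then $\lim_{t\to\infty}\mathbf v_1(x,t)=\lim_{t\to\infty}\mathbf v_2(x,t)=0$ for every $x\in U$.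
   Context: Setup. Fix $n\ge2$. For $i=1,2$: $g_i(s)=a^{(i)}_0+\sum_{j=1}^{N_i}a^{(i)}_js^{\alpha^{(i)}_j}$ ($s\ge0$), $a^{(i)}_0>0$, $a^{(i)}_j\ge0$, real $0<\alpha^{(i)}_1<\dots$; $G_i(u)=g_i(|u|)u$ ($u\in\mathbb R$). $f_1,f_2\in C([0,1])\cap C^1((0,1))$, $f_1(0)=0=f_2(1)$, $f_1'>0>f_2'$ on $(0,1)$; $p_c'\in C^1((0,1))$, $p_c'>0$; $F_i=1/(p_c'f_i)$. Fix $r_0>0$, $c_1,c_2$ with $c_1^2+c_2^2>0$, $s_0\in(0,1)$, and let $\hat S$ be the $C^1$ solution of $\hat S'=G_2(c_2r^{1-n})F_2(\hat S)-G_1(c_1r^{1-n})F_1(\hat S)$, $\hat S(r_0)=s_0$, $0<\hat S<1$, on its maximal interval $[r_0,R_{\max})$. For $r_0\le|x|<R_{\max}$: $S_*(x)=\hat S(|x|)$, $u_i^*(x)=c_i|x|^{-n}x$. For $u\in\mathbb R^n$: $\mathbf G_i(u)=g_i(|u|)u$, Jacobian $\mathbf G_i'(u)=g_i(|u|)I_n+g_i'(|u|)uu^T/|u|$ ($=g_i(0)I_n$ at $u=0$). $B(x)=F_1(S_* )\mathbf G_1'(u_1^* )+F_2(S_* )\mathbf G_2'(u_2^* )$ (symmetric positive definite), $A=B^{-1}$, $b(x)=F_2'(S_* )\mathbf G_2(u_2^* )-F_1'(S_* )\mathbf G_1(u_1^* )$. $C^m_x$: continuous with continuous $x$-derivatives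 up to order $m$. Bounded-domain setup: fix $R\in(r_0,R_{\max})$ with $0<\underline s\le\hat S(r)\le\bar s<1$ on $[r_0,R]$; $U$ open bounded, $U\subset B_R\setminus\overline{B_{r_0}}$, $\Gamma=\partial U$, $D=U\times(0,\infty)$. Constants: $d_0=\min\{g_1(0),g_2(0)\}$, $d_1=\sum_i g_i(|c_i|r_0^{1-n})$, $d_2=\sum_i g_i(|c_i|r_0^{1-n})|c_i|r_0^{1-n}$, $d_3=\sum_i g_i'(|c_i|r_0^{1-n})|c_i|r_0^{1-n}$ (terms with $c_i=0$ read as $0$), $d_4=d_1+d_3$; $\mu_1=\sum_i\max_{[\underline s,\bar s]}F_i$, $\mu_2=\sum_i\min_{[\underline s,\bar s]}F_i$, $\mu_3=\sum_i\max_{[\underline s,\bar s]}|F_i'|$; $C_0=d_4\mu_1$, $C_1=d_0\mu_2$, $C_2=d_2\mu_3$; $\kappa_0=C_0/(2C_1)$, $s_R=\kappa_0(n+C_2R)$, $q=\kappa_0C_0/(2s_R)$, $\eta_0=(r_0/R)^{2s_R}$. Given $V:\overline D\to\mathbb R^n$, $c(x,t)=F_1(S_*(x))\mathbf G_1'(u_1^*(x))V(x,t)$. IBVP (Σ): $\sigma_t=\nabla\cdot[A(\nabla\sigma-\sigma b)]+\nabla\cdot(Ac)$ in $D$, $\sigma=g$ on $\Gamma\times(0,\infty)$, $\sigma(x,0)=\sigma_0(x)$ in $U$, where $\sigma_0\in C(\overline U)$, $g\in C(\Gamma\times[0,\infty))$, $\sigma_0=g(\cdot,0)$ on $\Gamma$.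 Condition (E1): $F_1,F_2\in C^7((0,1))$, $V\in C^6_x(\overline D)$, $V_t\in C^3_x(\overline D)$; under (E1), (Σ) has a unique solution in $C(\overline D)\cap C^{2,1}_{x,t}(D)$. *)

theory Defs
  imports "HOL-Analysis.Analysis"
begin

definition gfun :: "(nat \<Rightarrow> real) \<Rightarrow> (nat \<Rightarrow> real) \<Rightarrow> nat \<Rightarrow> real \<Rightarrow> real" where
  "gfun a \<alpha> N s = a 0 + (\<Sum>j=1..N. a j * s powr \<alpha> j)"

text \<open>Derivative of gfun for s > 0 (only ever used at s > 0).\<close>
definition gder :: "(nat \<Rightarrow> real) \<Rightarrow> (nat \<Rightarrow> real) \<Rightarrow> nat \<Rightarrow> real \<Rightarrow> real" where
  "gder a \<alpha> N s = (\<Sum>j=1..N. a j * \<alpha> j * s powr (\<alpha> j - 1))"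

definition gcoef :: "(nat \<Rightarrow> real) \<Rightarrow> (nat \<Rightarrow> real) \<Rightarrow> nat \<Rightarrow> bool" where
  "gcoef a \<alpha> N \<longleftrightarrow> a 0 > 0 \<and> (\<forall>j\<in>{1..N}. a j \<ge> 0)
     \<and> (N \<ge> 1 \<longrightarrow> 0 < \<alpha> 1) \<and> (\<forall>j\<in>{1..<N}. \<alpha> j < \<alpha> (Suc j))"

definition Gsc :: "(real \<Rightarrow> real) \<Rightarrow> real \<Rightarrow> real" where
  "Gsc g u = g \<bar>u\<bar> * u"

definition Gvec :: "(real \<Rightarrow> real) \<Rightarrow> real^'n \<Rightarrow> real^'n" where
  "Gvec g u = g (norm u) *\<^sub>R u"

definition Gjac :: "(real \<Rightarrow> real) \<Rightarrow> (real \<Rightarrow> real) \<Rightarrow> real^'n \<Rightarrow> real^'n^'n" where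
  "Gjac g g' u = (if u = 0 then g 0 *\<^sub>R mat 1
      else g (norm u) *\<^sub>R mat 1 + (g' (norm u) / norm u) *\<^sub>R (\<chi> i j. u $ i * u $ j))"

text \<open>C^k on a set of reals (used for open intervals).\<close>
definition C_k_on :: "nat \<Rightarrow> real set \<Rightarrow> (real \<Rightarrow> real) \<Rightarrow> bool" where
  "C_k_on k S f \<longleftrightarrow> (\<forall>j\<le>k. continuous_on S ((deriv ^^ j) f))
      \<and> (\<forall>j<k. \<forall>x\<in>S. ((deriv ^^ j) f) differentiable (at x))"

definition pd :: "'n::finite \<Rightarrow> (real^'n \<Rightarrow> real) \<Rightarrow> real^'n \<Rightarrow> real" where
  "pd i f x = deriv (\<lambda>h. f (x + h *\<^sub>R axis i 1)) 0"

definition has_pd :: "'n::finite \<Rightarrow> (real^'n \<Rightarrow> real) \<Rightarrow> real^'n \<Rightarrow> bool" where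
  "has_pd i f x \<longleftrightarrow> (\<lambda>h. f (x + h *\<^sub>R axis i 1)) differentiable (at 0)"

fun ipd :: "'n::finite list \<Rightarrow> (real^'n \<Rightarrow> real) \<Rightarrow> real^'n \<Rightarrow> real" where
  "ipd [] f = f"
| "ipd (i # is) f = pd i (ipd is f)"

text \<open>Continuous with continuous x-derivatives up to order m on X \<times> T (X open).\<close>
definition Cx_on :: "nat \<Rightarrow> (real^'n::finite) set \<Rightarrow> real set \<Rightarrow> (real^'n \<Rightarrow> real \<Rightarrow> real) \<Rightarrow> bool" where
  "Cx_on m X T f \<longleftrightarrow> (\<forall>js::'n list. length js \<le> m \<longrightarrow>
      (length js < m \<longrightarrow> (\<forall>i. \<forall>x\<in>X. \<forall>t\<in>T. has_pd i (ipd js (\<lambda>y. f y t)) x))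
      \<and> continuous_on (X \<times> T) (\<lambda>(x,t). ipd js (\<lambda>y. f y t) x))"

definition Cx_bar :: "nat \<Rightarrow> (real^'n::finite) set \<Rightarrow> real set \<Rightarrow> (real^'n \<Rightarrow> real \<Rightarrow> real) \<Rightarrow> bool" where
  "Cx_bar m U T f \<longleftrightarrow> continuous_on (closure U \<times> T) (\<lambda>(x,t). f x t) \<and>
    (\<forall>js::'n list. length js \<le> m \<longrightarrow>
      (length js < m \<longrightarrow> (\<forall>i. \<forall>x\<in>U. \<forall>t\<in>T. has_pd i (ipd js (\<lambda>y. f y t)) x))
      \<and> (\<exists>w. continuous_on (closure U \<times> T) w
              \<and> (\<forall>x\<in>U. \<forall>t\<in>T. w (x,t) = ipd js (\<lambda>y. f y t) x)))"

definition C21 :: "(real^'n::finite) set \<Rightarrow> (real^'n \<Rightarrow> real \<Rightarrow> real) \<Rightarrow> bool" where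
  "C21 U f \<longleftrightarrow> Cx_on 2 U {0<..} f
     \<and> (\<forall>x\<in>U. \<forall>t>0. (\<lambda>s. f x s) differentiable (at t))
     \<and> continuous_on (U \<times> {0<..}) (\<lambda>(x,t). deriv (\<lambda>s. f x s) t)"

definition gradnorm :: "(real^'n::finite \<Rightarrow> real \<Rightarrow> real^'n) \<Rightarrow> real^'n \<Rightarrow> real \<Rightarrow> real" where
  "gradnorm V x t = sqrt (\<Sum>k\<in>UNIV. \<Sum>i\<in>UNIV. (pd i (\<lambda>y. V y t $ k) x)\<^sup>2)"

definition hessnorm :: "(real^'n::finite \<Rightarrow> real \<Rightarrow> real^'n) \<Rightarrow> real^'n \<Rightarrow> real \<Rightarrow> real" where
  "hessnorm V x t = sqrt (\<Sum>k\<in>UNIV. \<Sum>i\<in>UNIV. \<Sum>j\<in>UNIV. (pd i (pd j (\<lambda>y. V y t $ k)) x)\<^sup>2)"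

definition Vsize :: "(real^'n::finite \<Rightarrow> real \<Rightarrow> real^'n) \<Rightarrow> real^'n \<Rightarrow> real \<Rightarrow> real" where
  "Vsize V x t = norm (V x t) + gradnorm V x t + hessnorm V x t"

end

theory Submission
  imports Defs "HOL-Real_Asymp.Real_Asymp"
begin

text \<open>
  In the annulus all coefficients are radial: \<open>B = p I + m x x\<^sup>T\<close> with \<open>p\<close> and \<open>e = p + m \<bar>x\<bar>\<^sup>2\<close> between
  \<open>C1\<close> and \<open>C0\<close>, and \<open>b = bb(\<bar>x\<bar>) x\<close> is a gradient, \<open>b = \<nabla>\<Lambda>\<close>. The decay of \<open>\<sigma>\<close> follows from comparison with
  \<open>\<Psi>(x) (K1 exp (- \<eta>1 t) + K2)\<close>, where \<open>\<Psi> = exp \<Lambda> * \<psi>\<close> is an explicit radial strict supersolution. At a first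
  touching point the difference and its gradient vanish, so the zeroth-order term, which has no sign, is harmless.

  The interior gradient bound is obtained by doubling the variables (Ishii and Lions): at a positive maximum of
  \<open>\<sigma>(x,t) - \<sigma>(y,t) - K \<phi>(\<bar>x - y\<bar>) - L1 \<bar>x - x0\<bar>\<^sup>2 - \<theta> (t0 - t)\<close> with \<open>\<phi>\<close> increasing and strictly concave, the second
  derivatives along reflected directions contradict the equation once \<open>K\<close> is of order \<open>1 / sqrt \<tau>\<close>. Unlike
  Bernstein's method this uses no third derivatives of \<open>\<sigma>\<close>, and bounds on the lower-order terms suffice. So the velocities
  at time \<open>t\<close> are controlled by \<open>\<sigma>\<close> and \<open>V\<close> on \<open>[t - min (t/2) 1, t]\<close>.
\<close>

section \<open>Second-order tests along lines\<close>

text \<open>The scales of the gradient bound come from a balance. Excluding the initial time forces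
  \<open>\<theta>\<close> of order \<open>S / \<tau>\<close>, excluding the distance
  \<open>h\<close> forces \<open>K\<close> of order \<open>S / h\<close>, and the concavity of
  \<open>\<phi>\<close> pays \<open>2 * \<nu> * K / h\<close> for all error terms. So
  \<open>h\<close> is of order \<open>sqrt \<tau>\<close>. The reflection needs a Lipschitz square
  root of \<open>A - \<nu> I\<close>. For a radial matrix it is explicit: its eigenvalues are
  \<open>sqrt (1 / p - \<nu>)\<close> and \<open>sqrt (1 / e - \<nu>)\<close>, continuously
  differentiable in the radius because \<open>\<nu> = 1 / (2 * C0)\<close> lies strictly below the
  spectrum of \<open>A\<close>. With \<open>k = C2 * R\<close> the barrier reaches every positive
  rate below \<open>n * r0 powr k * (k + 2) / (C0 * R powr (k + 2))\<close>, and
  \<open>decay_rate_inequality\<close> places \<open>\<eta>1\<close> in that range. The constants in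
  the bounds of the solution and of its gradient do not depend on the starting time, so the limit
  statement follows by restarting at a late time after which the data are small.\<close>

lemma second_order_test:
  fixes h :: "real \<Rightarrow> real"
  assumes e: "e > 0" and d1: "\<And>r. \<bar>r\<bar> < e \<Longrightarrow> (h has_real_derivative h' r) (at r)"
    and d2: "(h' has_real_derivative d) (at 0)"
    and mx: "\<And>r. \<bar>r\<bar> < e \<Longrightarrow> h r \<le> h 0"
  shows "h' 0 = 0" "d \<le> 0"
proof -
  show 0: "h' 0 = 0"
    using DERIV_local_max[OF d1[of 0] e] mx e by auto
  show "d \<le> 0"
  proof (rule ccontr)
    \<comment> \<open>Differentiability of \<open>h'\<close> at the single point 0 suffices:
      \<open>d > 0\<close> makes \<open>h'\<close> positive just to the right of the critical point,
      so \<open>h\<close> would increase there.\<close>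
    assume "\<not> d \<le> 0"
    then obtain \<delta> where \<delta>: "\<delta> > 0" "\<And>k. k > 0 \<Longrightarrow> k < \<delta> \<Longrightarrow> h' 0 < h' (0 + k)"
      using DERIV_pos_inc_right[OF d2] by auto
    define k where "k = min \<delta> e / 2"
    have k: "0 < k" "k < \<delta>" "k < e" using \<delta>(1) e by (auto simp: k_def)
    have "h 0 < h k"
    proof (rule DERIV_pos_imp_increasing_open[OF k(1)])
      show "\<exists>y. (h has_real_derivative y) (at x) \<and> 0 < y" if "0 < x" "x < k" for x
        using d1[of x] \<delta>(2)[of x] that k 0 by auto
      show "continuous_on {0..k} h"
        by (rule DERIV_continuous_on[where D = h'])
          (use d1 k in \<open>auto intro: has_field_derivative_at_within\<close>)
    qed
    then show False using mx[of k] k by auto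
  qed
qed

text \<open>The Hessian is the total derivative of the gradient field. Its symmetry is not part of
  the notion, since only traces and quadratic forms of \<open>H\<close> are tested.\<close>

definition twice_diff_on ::
    "(real^'n::finite) set \<Rightarrow> (real^'n \<Rightarrow> real) \<Rightarrow> (real^'n \<Rightarrow> real^'n) \<Rightarrow> (real^'n \<Rightarrow> real^'n^'n) \<Rightarrow> bool" where
  "twice_diff_on U s G H \<longleftrightarrow> (\<forall>x\<in>U. (s has_derivative (\<lambda>h. G x \<bullet> h)) (at x)
      \<and> (G has_derivative (\<lambda>h. H x *v h)) (at x))"

lemma twice_diff_onD:
  assumes "twice_diff_on U s G H" "x \<in> U"
  shows "(s has_derivative (\<lambda>h. G x \<bullet> h)) (at x)" "(G has_derivative (\<lambda>h. H x *v h)) (at x)"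
  using assms by (auto simp: twice_diff_on_def)

lemma twice_diff_on_line:
  assumes "twice_diff_on U s G H"
  shows "x + r *\<^sub>R \<xi> \<in> U \<Longrightarrow> ((\<lambda>r. s (x + r *\<^sub>R \<xi>)) has_real_derivative G (x + r *\<^sub>R \<xi>) \<bullet> \<xi>) (at r)"
    and "x \<in> U \<Longrightarrow> ((\<lambda>r. G (x + r *\<^sub>R \<xi>) \<bullet> \<xi>) has_real_derivative \<xi> \<bullet> (H x *v \<xi>)) (at 0)"
proof -
  have l: "((\<lambda>r. x + r *\<^sub>R \<xi>) has_derivative (\<lambda>h. h *\<^sub>R \<xi>)) (at r)" for r
    by (auto intro!: derivative_eq_intros)
  show "((\<lambda>r. s (x + r *\<^sub>R \<xi>)) has_real_derivative G (x + r *\<^sub>R \<xi>) \<bullet> \<xi>) (at r)"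
    if "x + r *\<^sub>R \<xi> \<in> U"
    by (rule has_derivative_imp_has_field_derivative[OF has_derivative_compose[OF l twice_diff_onD(1)[OF assms that]]])
      simp
  assume "x \<in> U"
  then have "((\<lambda>r. G (x + r *\<^sub>R \<xi>)) has_derivative (\<lambda>h. H x *v (h *\<^sub>R \<xi>))) (at 0)"
    using has_derivative_compose[OF l[of 0], of G "\<lambda>h. H x *v h"] twice_diff_onD(2)[OF assms] by simp
  then have "((\<lambda>r. G (x + r *\<^sub>R \<xi>) \<bullet> \<xi>) has_derivative (\<lambda>h. (H x *v (h *\<^sub>R \<xi>)) \<bullet> \<xi>)) (at 0)"
    by (rule has_derivative_inner_left)
  then show "((\<lambda>r. G (x + r *\<^sub>R \<xi>) \<bullet> \<xi>) has_real_derivative \<xi> \<bullet> (H x *v \<xi>)) (at 0)"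
    by (rule has_derivative_imp_has_field_derivative) (simp add: matrix_vector_mult_scaleR inner_commute)
qed

lemma eventually_line_in_open:
  fixes x :: "'a::real_normed_vector"
  assumes "open U" "x \<in> U"
  obtains e where "e > 0" "\<And>r. \<bar>r\<bar> < e \<Longrightarrow> x + r *\<^sub>R \<xi> \<in> U"
proof -
  have "((\<lambda>r. x + r *\<^sub>R \<xi>) \<longlongrightarrow> x + 0 *\<^sub>R \<xi>) (at 0)"
    by (intro tendsto_intros)
  then have "\<forall>\<^sub>F r in at 0. x + r *\<^sub>R \<xi> \<in> U"
    using assms topological_tendstoD by fastforce
  then obtain e where "e > 0" "\<And>r. r \<noteq> 0 \<Longrightarrow> \<bar>r\<bar> < e \<Longrightarrow> x + r *\<^sub>R \<xi> \<in> U"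
    unfolding eventually_at by (auto simp: dist_real_def)
  then show thesis using assms(2) by (metis add.right_neutral scale_zero_left that)
qed

text \<open>The quadratic \<open>p1 * r + p2 * r\<^sup>2\<close> stands for a majorant of the test
  function along the motion. The doubling argument takes one function at two points with different
  directions, the barrier argument two functions at one point with the same direction.\<close>

lemma twice_diff_on_pair_test:
  assumes tw: "twice_diff_on U s G H" "twice_diff_on U s' G' H'" "open U" "x \<in> U" "y \<in> U"
    and e: "e > 0" and mx: "\<And>r. \<bar>r\<bar> < e \<Longrightarrow>
      s (x + r *\<^sub>R \<xi>) - s' (y + r *\<^sub>R \<zeta>) - (p1 * r + p2 * r\<^sup>2) \<le> s x - s' y"
  shows "G x \<bullet> \<xi> - G' y \<bullet> \<zeta> = p1" "\<xi> \<bullet> (H x *v \<xi>) - \<zeta> \<bullet> (H' y *v \<zeta>) \<le> 2 * p2"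
proof -
  obtain e1 where e1: "e1 > 0" "\<And>r. \<bar>r\<bar> < e1 \<Longrightarrow> x + r *\<^sub>R \<xi> \<in> U"
    using eventually_line_in_open tw by blast
  obtain e2 where e2: "e2 > 0" "\<And>r. \<bar>r\<bar> < e2 \<Longrightarrow> y + r *\<^sub>R \<zeta> \<in> U"
    using eventually_line_in_open tw by blast
  let ?e = "min e (min e1 e2)"
  let ?h = "\<lambda>r. s (x + r *\<^sub>R \<xi>) - s' (y + r *\<^sub>R \<zeta>) - (p1 * r + p2 * r\<^sup>2)"
  let ?h' = "\<lambda>r. G (x + r *\<^sub>R \<xi>) \<bullet> \<xi> - G' (y + r *\<^sub>R \<zeta>) \<bullet> \<zeta> - (p1 + 2 * p2 * r)"
  have 1: "(?h has_real_derivative ?h' r) (at r)" if "\<bar>r\<bar> < ?e" for r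
    by (rule derivative_eq_intros refl twice_diff_on_line(1)[OF tw(1)] twice_diff_on_line(1)[OF tw(2)]
        | use that e1 e2 in force)+
  have 2: "(?h' has_real_derivative
      \<xi> \<bullet> (H x *v \<xi>) - \<zeta> \<bullet> (H' y *v \<zeta>) - 2 * p2) (at 0)"
    by (rule derivative_eq_intros refl twice_diff_on_line(2)[OF tw(1)] twice_diff_on_line(2)[OF tw(2)] tw(4,5)
        | simp)+
  have pos: "?e > 0" using e e1 e2 by simp
  have mx': "?h r \<le> ?h 0" if "\<bar>r\<bar> < ?e" for r using mx[of r] that by simp
  show "G x \<bullet> \<xi> - G' y \<bullet> \<zeta> = p1" "\<xi> \<bullet> (H x *v \<xi>) - \<zeta> \<bullet> (H' y *v \<zeta>) \<le> 2 * p2"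
    using second_order_test[OF pos 1 2 mx'] by auto
qed

text \<open>The induction in \<open>key\<close> is over the set of coordinates already moved. Each
  new coordinate is handled by the mean value theorem, and continuity compares the partial
  derivative at the intermediate point with that at \<open>x\<close>.\<close>

lemma has_derivative_of_continuous_partials:
  fixes f :: "real^'n::finite \<Rightarrow> real"
  assumes U: "open U" and pds: "\<And>i x. x \<in> U \<Longrightarrow> has_pd i f x"
    and cont: "\<And>i. continuous_on U (pd i f)" and x: "x \<in> U"
  shows "(f has_derivative (\<lambda>h. (\<chi> i. pd i f x) \<bullet> h)) (at x)"
proof -
  have der: "((\<lambda>h. f (y + h *\<^sub>R axis i 1)) has_real_derivative pd i f (y + h *\<^sub>R axis i 1)) (at h)"
    if "y + h *\<^sub>R axis i 1 \<in> U" for y i h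
  proof -
    have "((\<lambda>k. f ((y + h *\<^sub>R axis i 1) + k *\<^sub>R axis i 1)) has_real_derivative pd i f (y + h *\<^sub>R axis i 1)) (at 0)"
      using pds[OF that, of i] unfolding has_pd_def pd_def
      by (metis DERIV_deriv_iff_real_differentiable)
    then have "((\<lambda>k. f (y + (h + k) *\<^sub>R axis i 1)) has_real_derivative pd i f (y + h *\<^sub>R axis i 1)) (at 0)"
      by (simp add: algebra_simps)
    then show ?thesis using DERIV_shift[of "\<lambda>k. f (y + k *\<^sub>R axis i 1)" _ 0 h]
      by (simp add: add.commute)
  qed
  have key: "\<exists>d>0. \<forall>h. norm h < d \<longrightarrow>
      \<bar>f (x + (\<Sum>i\<in>S. h$i *\<^sub>R axis i 1)) - f x - (\<Sum>i\<in>S. pd i f x * h$i)\<bar> \<le> e * norm h"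
    if "finite S" "e > 0" for S :: "'n set" and e :: real
    using that
  proof (induction S arbitrary: e rule: finite_induct)
    case empty
    then show ?case by (auto intro!: exI[of _ 1])
  next
    case (insert j S)
    obtain d1 where d1: "d1 > 0" "\<And>h. norm h < d1 \<Longrightarrow>
      \<bar>f (x + (\<Sum>i\<in>S. h$i *\<^sub>R axis i 1)) - f x - (\<Sum>i\<in>S. pd i f x * h$i)\<bar> \<le> e/2 * norm h"
      using insert.IH[of "e/2"] insert.prems by auto
    have "\<exists>d>0. \<forall>y. dist y x < d \<longrightarrow> y \<in> U \<and> \<bar>pd j f y - pd j f x\<bar> < e/2"
    proof -
      have "isCont (pd j f) x" using cont U x continuous_on_eq_continuous_at by blast
      then obtain d where "d>0" "\<And>y. dist y x < d \<Longrightarrow> \<bar>pd j f y - pd j f x\<bar> < e/2"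
        unfolding continuous_at_eps_delta dist_real_def using insert.prems by (meson half_gt_zero)
      moreover obtain d' where "d'>0" "\<And>y. dist y x < d' \<Longrightarrow> y \<in> U"
        using U x open_dist by blast
      ultimately show ?thesis by (intro exI[of _ "min d d'"]) auto
    qed
    then obtain d2 where d2: "d2 > 0" "\<And>y. dist y x < d2 \<Longrightarrow> y \<in> U"
       "\<And>y. dist y x < d2 \<Longrightarrow> \<bar>pd j f y - pd j f x\<bar> < e/2" by blast
    \<comment> \<open>An intermediate point differs from \<open>x\<close> in the coordinates of
      \<open>S\<close> and in one more, each by at most \<open>norm h\<close>.\<close>
    define N where "N = real CARD('n) + 1"
    have N: "N \<ge> 1" by (simp add: N_def)
    show ?case
    proof (intro exI[of _ "min d1 (d2/N)"] conjI allI impI)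
      show "0 < min d1 (d2/N)" using d1 d2 N by auto
      fix h :: "real^'n" assume h: "norm h < min d1 (d2/N)"
      let ?y = "x + (\<Sum>i\<in>S. h$i *\<^sub>R axis i 1)"
      have near: "dist (?y + (\<theta> * h$j) *\<^sub>R axis j 1) x < d2" if "\<bar>\<theta>\<bar> \<le> 1" for \<theta>
      proof -
        have a: "norm (\<Sum>i\<in>S. h$i *\<^sub>R axis i (1::real)) \<le> (\<Sum>i\<in>S. norm h)"
          by (rule sum_norm_le) (simp add: component_le_norm_cart)
        have "norm ((\<theta> * h$j) *\<^sub>R axis j (1::real)) \<le> norm h"
          using that component_le_norm_cart[of h j] mult_mono[of "\<bar>\<theta>\<bar>" 1 "\<bar>h$j\<bar>" "norm h"]
          by (simp add: abs_mult)
        moreover have "(\<Sum>i\<in>S. norm h) \<le> real CARD('n) * norm h"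
          by (simp add: card_mono mult_right_mono)
        ultimately have "dist (?y + (\<theta> * h$j) *\<^sub>R axis j 1) x \<le> N * norm h"
          using a norm_triangle_ineq[of "\<Sum>i\<in>S. h$i *\<^sub>R axis i (1::real)" "(\<theta> * h$j) *\<^sub>R axis j (1::real)"]
          by (simp add: dist_norm N_def algebra_simps)
        also have "\<dots> < d2" using h N by (simp add: field_simps)
        finally show ?thesis .
      qed
      have mv: "\<bar>f (?y + h$j *\<^sub>R axis j 1) - f ?y - pd j f x * h$j\<bar> \<le> e/2 * norm h"
      proof -
        let ?g = "\<lambda>\<theta>. f (?y + (\<theta> * h$j) *\<^sub>R axis j 1)"
        have dg: "(?g has_real_derivative pd j f (?y + (\<theta> * h$j) *\<^sub>R axis j 1) * h$j) (at \<theta>)" if "\<bar>\<theta>\<bar> \<le> 1" for \<theta>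
          by (rule DERIV_chain2[where g = "\<lambda>\<theta>. \<theta> * h$j" and x = \<theta> and s = UNIV and Db = "h$j", OF der[OF d2(2)[OF near[OF that]]]])
            (auto intro!: derivative_eq_intros)
        obtain \<theta> where \<theta>: "0 < \<theta>" "\<theta> < 1" "?g 1 - ?g 0 = (1 - 0) * (pd j f (?y + (\<theta> * h$j) *\<^sub>R axis j 1) * h$j)"
          using MVT2[of 0 1 ?g "\<lambda>\<theta>. pd j f (?y + (\<theta> * h$j) *\<^sub>R axis j 1) * h$j"] dg by force
        have "\<bar>?g 1 - ?g 0 - pd j f x * h$j\<bar> = \<bar>pd j f (?y + (\<theta> * h$j) *\<^sub>R axis j 1) - pd j f x\<bar> * \<bar>h$j\<bar>"
          unfolding \<theta>(3) by (simp add: abs_mult[symmetric] algebra_simps)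
        also have "\<dots> \<le> e/2 * norm h"
          using d2(3)[OF near, of \<theta>] \<theta> insert.prems component_le_norm_cart[of h j]
          by (intro mult_mono) auto
        finally show ?thesis by simp
      qed
      have e1: "?y + h$j *\<^sub>R axis j 1 = x + (\<Sum>i\<in>insert j S. h$i *\<^sub>R axis i 1)"
        using insert.hyps by (simp add: algebra_simps)
      have e2: "(\<Sum>i\<in>insert j S. pd i f x * h$i) = pd j f x * h$j + (\<Sum>i\<in>S. pd i f x * h$i)"
        using insert.hyps by simp
      show "\<bar>f (x + (\<Sum>i\<in>insert j S. h$i *\<^sub>R axis i 1)) - f x - (\<Sum>i\<in>insert j S. pd i f x * h$i)\<bar> \<le> e * norm h"
        using mv d1(2)[of h] h unfolding e1[symmetric] e2 by linarith
    qed
  qed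
  show ?thesis
    unfolding has_derivative_at_alt
  proof (intro conjI allI impI)
    show "bounded_linear (\<lambda>h. (\<chi> i. pd i f x) \<bullet> h)" by (rule bounded_linear_inner_right)
    fix e :: real assume "e > 0"
    obtain d where d: "d > 0" "\<And>h. norm h < d \<Longrightarrow>
      \<bar>f (x + (\<Sum>i\<in>UNIV. h$i *\<^sub>R axis i 1)) - f x - (\<Sum>i\<in>UNIV. pd i f x * h$i)\<bar> \<le> e * norm h"
      using key[OF finite_class.finite_UNIV \<open>e > 0\<close>] by blast
    have b: "(\<Sum>i\<in>UNIV. h$i *\<^sub>R axis i 1) = h" for h :: "real^'n"
      by (simp add: vec_eq_iff axis_def if_distrib cong: if_cong)
    show "\<exists>d>0. \<forall>y. norm (y - x) < d \<longrightarrow> norm (f y - f x - (\<chi> i. pd i f x) \<bullet> (y - x)) \<le> e * norm (y - x)"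
    proof (intro exI[of _ d] conjI allI impI)
      fix y assume "norm (y - x) < d"
      then show "norm (f y - f x - (\<chi> i. pd i f x) \<bullet> (y - x)) \<le> e * norm (y - x)"
        using d(2)[of "y - x"] unfolding b by (simp add: inner_vec_def)
    qed (fact d(1))
  qed
qed

text \<open>\<open>C21\<close> speaks of iterated partial derivatives only; their continuity makes
  \<open>u\<close> and each first partial derivative totally differentiable. Row \<open>j\<close> of
  the Hessian is the gradient of the \<open>j\<close>-th partial derivative.\<close>

lemma C21_twice_diff_on:
  assumes "open U" "C21 U u" "t > 0"
  shows "twice_diff_on U (\<lambda>y. u y t) (\<lambda>x. \<chi> j. pd j (\<lambda>y. u y t) x)
           (\<lambda>x. \<chi> j i. pd i (pd j (\<lambda>y. u y t)) x)"
proof -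
  let ?s = "\<lambda>y. u y t"
  have C: "Cx_on 2 U {0<..} u" using assms by (simp add: C21_def)
  have hp: "has_pd i (ipd js ?s) x" if "length js < 2" "x \<in> U" for i js x
    using C that assms(3) unfolding Cx_on_def by auto
  have co: "continuous_on U (ipd js ?s)" if "length js \<le> 2" for js
  proof -
    have "continuous_on (U \<times> {0<..}) (\<lambda>(x,t). ipd js (\<lambda>y. u y t) x)"
      using C that unfolding Cx_on_def by auto
    then have "continuous_on U ((\<lambda>(x,t). ipd js (\<lambda>y. u y t) x) \<circ> (\<lambda>x. (x,t)))"
      by (intro continuous_on_compose continuous_intros) (auto intro: continuous_on_subset simp: assms(3) image_subset_iff elim!: continuous_on_subset)
    then show ?thesis by (simp add: o_def)
  qed
  show ?thesis unfolding twice_diff_on_def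
  proof (intro ballI conjI)
    fix x assume x: "x \<in> U"
    show "(?s has_derivative (\<lambda>h. (\<chi> j. pd j ?s x) \<bullet> h)) (at x)"
      using has_derivative_of_continuous_partials[OF assms(1) _ _ x, of ?s] hp[of "[]"] co[of "[_]"]
      by simp
    have "(pd j ?s has_derivative (\<lambda>h. (\<chi> i. pd i (pd j ?s) x) \<bullet> h)) (at x)" for j
      using has_derivative_of_continuous_partials[OF assms(1) _ _ x, of "pd j ?s"] hp[of "[j]"] co[of "[_,j]"]
      by simp
    then have "((\<lambda>x. \<chi> j. pd j ?s x) has_derivative (\<lambda>h. \<chi> j. (\<chi> i. pd i (pd j ?s) x) \<bullet> h)) (at x)"
      by (subst has_derivative_componentwise_within)
         (auto simp: Basis_vec_def inner_axis)
    then show "((\<lambda>x. \<chi> j. pd j ?s x) has_derivative (\<lambda>h. (\<chi> j i. pd i (pd j ?s) x) *v h)) (at x)"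
      by (simp add: matrix_vector_mult_def inner_vec_def)
  qed
qed

section \<open>First touching times\<close>

text \<open>The set where \<open>z \<ge> 0\<close> up to time \<open>t\<close> is compact and so has
  a point of least time. No point can be positive at that time, since by the intermediate value
  theorem it would have vanished strictly earlier.\<close>

lemma neg_before_first_touch:
  fixes z :: "'a::heine_borel \<Rightarrow> real \<Rightarrow> real"
  assumes K: "compact K" and cont: "continuous_on (K \<times> {T..}) (\<lambda>(x,t). z x t)"
    and init: "\<And>x. x \<in> K \<Longrightarrow> z x T < 0"
    and touch: "\<And>x t. x \<in> K \<Longrightarrow> t > T \<Longrightarrow> z x t = 0 \<Longrightarrow>
        (\<And>y. y \<in> K \<Longrightarrow> z y t \<le> 0) \<Longrightarrow> (\<And>s. T \<le> s \<Longrightarrow> s < t \<Longrightarrow> z x s < 0) \<Longrightarrow> False"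
    and x: "x \<in> K" and t: "t \<ge> T"
  shows "z x t < 0"
proof (rule ccontr)
  assume "\<not> z x t < 0"
  define W where "W = K \<times> {T..t} \<inter> (\<lambda>(x,t). z x t) -` {0..}"
  have co: "continuous_on (K \<times> {T..t}) (\<lambda>(x,t). z x t)"
    by (rule continuous_on_subset[OF cont]) auto
  have "compact (K \<times> {T..t})" using K by (intro compact_Times) auto
  then have "compact W"
  proof -
    have "closedin (top_of_set (K \<times> {T..t})) W"
      unfolding W_def by (rule continuous_closedin_preimage[OF co closed_atLeast])
    then show ?thesis using \<open>compact (K \<times> {T..t})\<close> closedin_compact by blast
  qed
  have "(x,t) \<in> W" using x t \<open>\<not> z x t < 0\<close> by (auto simp: W_def)
  then have "W \<noteq> {}" by blast
  have "\<exists>p\<in>W. \<forall>q\<in>W. snd p \<le> snd q"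
    by (rule continuous_attains_inf[OF \<open>compact W\<close> \<open>W \<noteq> {}\<close>]) (intro continuous_intros)
  then obtain p where p: "p \<in> W" "\<And>q. q \<in> W \<Longrightarrow> snd p \<le> snd q" by blast
  obtain y s where ys: "p = (y, s)" by (cases p)
  have y: "y \<in> K" "T \<le> s" "s \<le> t" "z y s \<ge> 0" using p(1) by (auto simp: W_def ys)
  have lt: "z y' s' < 0" if "y' \<in> K" "T \<le> s'" "s' < s" for y' s'
    using p(2)[of "(y',s')"] that y unfolding W_def ys by force
  have Ts: "T < s" using init y by (metis leD order_le_imp_less_or_eq)
  have le: "z y' s \<le> 0" if "y' \<in> K" for y'
  proof (rule ccontr)
    assume a: "\<not> z y' s \<le> 0"
    have "continuous_on {T..s} ((\<lambda>(x,t). z x t) \<circ> (\<lambda>r. (y', r)))"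
      by (intro continuous_on_compose continuous_intros continuous_on_subset[OF cont]) (auto simp: that)
    then have "continuous_on {T..s} (z y')" by (simp add: o_def)
    moreover have "z y' T \<le> 0" using init that by (simp add: less_imp_le)
    ultimately obtain r where "T \<le> r" "r \<le> s" "z y' r = 0"
      using IVT'[of "z y'" T 0 s] a Ts by auto
    then show False using lt[OF that, of r] a by (cases "r = s") auto
  qed
  show False
    using touch[of y s] y Ts le lt by (metis antisym)
qed

text \<open>Only earlier times are compared: the maximum in the doubling argument may lie at the
  final time, and a first touch says nothing about later times.\<close>

lemma left_derivative_nonneg:
  fixes h :: "real \<Rightarrow> real"
  assumes d: "(h has_real_derivative d) (at t)" and "T < t" "\<And>s. T \<le> s \<Longrightarrow> s < t \<Longrightarrow> h s \<le> h t"
  shows "d \<ge> 0"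
proof (rule ccontr)
  assume "\<not> d \<ge> 0"
  then obtain \<delta> where \<delta>: "\<delta> > 0" "\<And>k. k > 0 \<Longrightarrow> k < \<delta> \<Longrightarrow> h t < h (t - k)"
    using DERIV_neg_dec_left[OF d] by auto
  define k where "k = min \<delta> (t - T) / 2"
  have "0 < k" "k < \<delta>" "k < t - T" using \<delta>(1) assms(2) by (auto simp: k_def)
  then show False using \<delta>(2)[of k] assms(3)[of "t - k"] by force
qed

text \<open>The vectors \<open>(I - e e\<^sup>T) axis k\<close>: they replace an orthonormal basis of the complement of \<open>e\<close>.\<close>

definition sphere_proj :: "real^'n::finite \<Rightarrow> 'n \<Rightarrow> real^'n" where
  "sphere_proj e k = axis k 1 - (e $ k) *\<^sub>R e"

text \<open>The vectors are the columns of the projection \<open>P = I - e e\<^sup>T\<close>, so the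
  sum is the trace of \<open>P H P\<close>, which is the trace of \<open>H P\<close>.\<close>

lemma sum_sphere_proj:
  fixes e :: "real^'n::finite"
  assumes "norm e = 1"
  shows "(\<Sum>k\<in>UNIV. sphere_proj e k \<bullet> (H *v sphere_proj e k)) = (\<Sum>k\<in>UNIV. H $ k $ k) - e \<bullet> (H *v e)"
proof -
  have a: "axis k 1 \<bullet> (H *v axis k 1) = H $ k $ k" for k
    by (simp add: matrix_vector_mul_component inner_axis' inner_axis)
  have b: "(\<Sum>k\<in>UNIV. e$k * (axis k 1 \<bullet> (H *v e))) = e \<bullet> (H *v e)"
    unfolding inner_axis' by (simp add: inner_vec_def)
  have c: "(\<Sum>k\<in>UNIV. e$k * (e \<bullet> (H *v axis k 1))) = e \<bullet> (H *v e)"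
  proof -
    have "(\<Sum>k\<in>UNIV. e$k *\<^sub>R (H *v axis k 1)) = H *v e"
      by (simp add: matrix_vector_mult_basis matrix_mult_sum[of H e] scalar_mult_eq_scaleR)
    then show ?thesis by (metis (no_types, lifting) inner_scaleR_right inner_sum_right sum.cong)
  qed
  have d: "(\<Sum>k\<in>UNIV. e$k * e$k) = 1"
    using assms by (simp add: norm_eq_1 inner_vec_def)
  have "sphere_proj e k \<bullet> (H *v sphere_proj e k) =
     H $ k $ k - e$k * (axis k 1 \<bullet> (H *v e)) - e$k * (e \<bullet> (H *v axis k 1)) + (e$k * e$k) * (e \<bullet> (H *v e))" for k
    unfolding sphere_proj_def a[symmetric]
    by (simp add: matrix_vector_mult_diff_distrib matrix_vector_mult_scaleR algebra_simps)
  then show ?thesis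
    by (simp add: sum.distrib sum_subtractf b c sum_distrib_right[symmetric] d)
qed

lemma norm_sphere_proj_le:
  assumes "norm e = 1"
  shows "(norm (sphere_proj e k))\<^sup>2 \<le> 1"
proof -
  have "(norm (sphere_proj e k))\<^sup>2 = 1 - (e$k)\<^sup>2"
    using assms unfolding power2_norm_eq_inner sphere_proj_def
    by (simp add: algebra_simps inner_axis inner_axis' norm_eq_1 power2_eq_square)
  then show ?thesis by simp
qed

text \<open>The operator \<open>A : D\<^sup>2\<close>, for \<open>A = \<nu> I + \<Sum>\<^sub>k M\<^sub>k M\<^sub>k\<^sup>T\<close>. The doubling argument couples the two copies of the
  equation by reflection in the part \<open>\<nu> I\<close> and synchronously in the vector fields \<open>M\<^sub>k\<close>, which must be Lipschitz.\<close>

definition ellop :: "real \<Rightarrow> ('n \<Rightarrow> real^'n \<Rightarrow> real^'n) \<Rightarrow> real^'n^'n \<Rightarrow> real^'n::finite \<Rightarrow> real" where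
  "ellop \<nu> Mc H x = \<nu> * (\<Sum>k\<in>UNIV. H $ k $ k) + (\<Sum>k\<in>UNIV. Mc k x \<bullet> (H *v Mc k x))"

text \<open>This is \<open>(norm (z + r *\<^sub>R \<delta>) - l)\<^sup>2 \<ge> 0\<close> rearranged.
  It gives a quadratic majorant of the norm with equality at \<open>r = 0\<close>, which replaces
  second derivatives of the norm.\<close>

lemma norm_bound_along_line:
  fixes z \<delta> :: "'a::real_inner"
  assumes "norm z = l" "l > 0"
  shows "norm (z + r *\<^sub>R \<delta>) \<le> l + (2 * r * (z \<bullet> \<delta>) + r\<^sup>2 * (norm \<delta>)\<^sup>2) / (2 * l)"
proof -
  have "(norm (z + r *\<^sub>R \<delta>))\<^sup>2 = l\<^sup>2 + 2 * r * (z \<bullet> \<delta>) + r\<^sup>2 * (norm \<delta>)\<^sup>2"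
    unfolding assms(1)[symmetric] power2_norm_eq_inner
    by (simp add: inner_add_left inner_add_right inner_commute[of \<delta> z] power2_eq_square algebra_simps)
  moreover have "0 \<le> (norm (z + r *\<^sub>R \<delta>) - l)\<^sup>2" by simp
  ultimately have "2 * l * norm (z + r *\<^sub>R \<delta>) \<le> 2 * l * l + (2 * r * (z \<bullet> \<delta>) + r\<^sup>2 * (norm \<delta>)\<^sup>2)"
    by (simp add: power2_diff power2_eq_square[of l] algebra_simps)
  then show ?thesis using assms(2) by (simp add: field_simps)
qed

section \<open>Interior gradient bound by doubling the variables\<close>

text \<open>Testing with \<open>y = x - r *\<^sub>R g\<close> is enough, because \<open>f\<close>
  falls there at the rate \<open>g \<bullet> g\<close>. The hypothesis is one-sided and anchored at
  \<open>x\<close>, which is exactly what doubling yields at the centre.\<close>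

lemma norm_gradient_le_of_lower_lipschitz:
  fixes f :: "'a::real_inner \<Rightarrow> real"
  assumes f: "(f has_derivative (\<lambda>h. g \<bullet> h)) (at x)" and l: "l > 0" and K: "K \<ge> 0"
    and lip: "\<And>y. y \<in> cball x l \<Longrightarrow> f x - f y \<le> K * dist x y"
  shows "norm g \<le> K"
proof (rule ccontr)
  assume "\<not> norm g \<le> K"
  then have g: "norm g > K" "norm g > 0" using K by auto
  have "((\<lambda>r. x - r *\<^sub>R g) has_derivative (\<lambda>h. - (h *\<^sub>R g))) (at 0)"
    by (auto intro!: derivative_eq_intros)
  from has_derivative_compose[OF this, of f "\<lambda>h. g \<bullet> h"]
  have "((\<lambda>r. f (x - r *\<^sub>R g)) has_real_derivative - (g \<bullet> g)) (at 0)"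
    using f by (intro has_derivative_imp_has_field_derivative) auto
  then have D: "((\<lambda>r. f (x - r *\<^sub>R g) + K * norm g * r) has_real_derivative - (g \<bullet> g) + K * norm g) (at 0)"
    by (auto intro!: derivative_eq_intros)
  have N: "- (g \<bullet> g) + K * norm g < 0"
    using g by (simp add: dot_square_norm power2_eq_square)
  have "\<exists>d>0. \<forall>r>0. r < d \<longrightarrow> f (x - r *\<^sub>R g) + K * norm g * r < f x"
    using DERIV_neg_dec_right[OF D N] by simp
  then obtain d where d: "d > 0" "\<And>r. r > 0 \<Longrightarrow> r < d \<Longrightarrow> f (x - r *\<^sub>R g) + K * norm g * r < f x"
    by blast
  define r where "r = min (d/2) (l / norm g)"
  have r: "r > 0" "r < d" "r * norm g \<le> l" using d(1) g l by (auto simp: r_def min_def field_simps)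
  then have "x - r *\<^sub>R g \<in> cball x l" by (simp add: dist_norm)
  from lip[OF this] d(2)[OF r(1,2)] r(1) show False by (simp add: dist_norm algebra_simps)
qed

text \<open>The points compared over a time span \<open>\<tau>\<close> are at distance at most \<open>doubling_scale\<close> times \<open>sqrt \<tau>\<close>.\<close>

definition doubling_scale :: "real \<Rightarrow> real \<Rightarrow> real \<Rightarrow> real \<Rightarrow> real \<Rightarrow> real \<Rightarrow> real" where
  "doubling_scale n \<nu> \<delta> Bd L K1 =
    min 1 (min \<delta> (\<nu> / (4 + 2 * (2 * \<nu> + 2 * \<nu> * n + 2 * n * Bd\<^sup>2 + 2 * K1 * \<delta>) / \<delta>\<^sup>2
      + 3 * n * L\<^sup>2 + 6 * K1)))"

lemma doubling_scale_pos:
  assumes "\<nu> > 0" "\<delta> > 0" "K1 \<ge> 0" "n \<ge> 0"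
  shows "doubling_scale n \<nu> \<delta> Bd L K1 > 0"
proof -
  have "4 + 2 * (2 * \<nu> + 2 * \<nu> * n + 2 * n * Bd\<^sup>2 + 2 * K1 * \<delta>) / \<delta>\<^sup>2 + 3 * n * L\<^sup>2 + 6 * K1 > 0"
    using assms by (intro add_pos_nonneg) auto
  then show ?thesis using assms by (simp add: doubling_scale_def)
qed

text \<open>The equation holds up to an error \<open>\<Phi>\<close> that absorbs the zeroth-order
  term and the source. The radius is \<open>2 * \<delta>\<close> because the first point stays
  within \<open>\<delta>\<close> of \<open>x0\<close> and the second within a further
  \<open>h \<le> \<delta>\<close> of the first.\<close>

locale parabolic_cylinder =
  fixes U :: "(real^'n::finite) set" and x0 :: "real^'n" and \<delta> T t0 :: real
    and u :: "real^'n \<Rightarrow> real \<Rightarrow> real" and G H st \<nu> Mc \<beta> and \<Phi> m Bd L K1 :: real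
  assumes U: "open U" "cball x0 (2 * \<delta>) \<subseteq> U"
    and tw: "\<And>t. T \<le> t \<Longrightarrow> t \<le> t0 \<Longrightarrow> twice_diff_on U (\<lambda>y. u y t) (\<lambda>y. G y t) (\<lambda>y. H y t)"
    and td: "\<And>x t. x \<in> cball x0 (2 * \<delta>) \<Longrightarrow> T \<le> t \<Longrightarrow> t \<le> t0 \<Longrightarrow> ((\<lambda>s. u x s) has_real_derivative st x t) (at t)"
    and pde: "\<And>x t. x \<in> cball x0 (2 * \<delta>) \<Longrightarrow> T \<le> t \<Longrightarrow> t \<le> t0 \<Longrightarrow>
        \<bar>st x t - (ellop \<nu> Mc (H x t) x + \<beta> x \<bullet> G x t)\<bar> \<le> \<Phi>"
    and cont: "continuous_on (cball x0 (2 * \<delta>) \<times> {T..t0}) (\<lambda>(x,t). u x t)"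
    and bnd: "\<And>x t. x \<in> cball x0 (2 * \<delta>) \<Longrightarrow> T \<le> t \<Longrightarrow> t \<le> t0 \<Longrightarrow> \<bar>u x t\<bar> \<le> m"
    and \<nu>: "\<nu> > 0"
    and Mb: "\<And>k x. x \<in> cball x0 (2 * \<delta>) \<Longrightarrow> norm (Mc k x) \<le> Bd"
    and Mlip: "\<And>k x y. x \<in> cball x0 (2 * \<delta>) \<Longrightarrow> y \<in> cball x0 (2 * \<delta>) \<Longrightarrow> norm (Mc k x - Mc k y) \<le> L * dist x y"
    and \<beta>b: "\<And>x. x \<in> cball x0 (2 * \<delta>) \<Longrightarrow> norm (\<beta> x) \<le> K1"
    and \<delta>: "\<delta> > 0" and K1: "K1 \<ge> 0" and T: "T < t0"
begin

text \<open>Conditions \<open>a\<close>, \<open>b\<close> and \<open>c\<close> keep a positive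
  maximum away from distance \<open>h\<close>, from the sphere of radius \<open>\<delta>\<close> and
  from the initial time, since there a single penalty already exceeds the oscillation
  \<open>2 * m\<close>. At the remaining interior maximum, \<open>d\<close> says that the gain
  \<open>2 * \<nu> * K / h\<close> from concavity beats all other terms.\<close>

lemma doubling_estimate:
  fixes K L1 \<theta> h :: real
  assumes h: "0 < h" "h \<le> \<delta>" and pos: "K > 0" "L1 \<ge> 0" "\<theta> \<ge> 0"
    and a: "2 * m \<le> K * (3/4 * h)" and b: "2 * m \<le> L1 * \<delta>\<^sup>2" and c: "2 * m \<le> \<theta> * (t0 - T)"
    and d: "\<theta> + 2 * \<Phi> + L1 * (2 * \<nu> + 2 * \<nu> * real CARD('n) + 2 * real CARD('n) * Bd\<^sup>2 + 2 * K1 * \<delta>)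
        + 2 * K1 * K + K * real CARD('n) * L\<^sup>2 * h < 2 * \<nu> * K / h"
    and y: "y \<in> cball x0 h"
  shows "u x0 t0 - u y t0 \<le> K * dist x0 y"
proof -
  \<comment> \<open>On \<open>{0..h}\<close> this has slope between 1/2 and 1 and second derivative
    \<open>- 1 / (2 * h)\<close>. The value \<open>3/4 * h\<close> at \<open>h\<close> is the factor
    in \<open>a\<close>.\<close>
  define \<phi> where "\<phi> s = s - s\<^sup>2 / (4 * h)" for s
  \<comment> \<open>The second point is \<open>x - z\<close>, so that the domain of \<open>w\<close> is a product of compact sets.\<close>
  define w where "w x z t = u x t - u (x - z) t - K * \<phi> (norm z) - L1 * (norm (x - x0))\<^sup>2 - \<theta> * (t0 - t)" for x z t
  let ?W = "cball x0 \<delta> \<times> cball (0::real^'n) h \<times> {T..t0}"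
  have inb: "x \<in> cball x0 (2 * \<delta>)" "x - z \<in> cball x0 (2 * \<delta>)" if "x \<in> cball x0 \<delta>" "z \<in> cball 0 h" for x z
  proof -
    show "x \<in> cball x0 (2 * \<delta>)" using that(1) h by simp
    have "norm (x0 - x + z) \<le> norm (x0 - x) + norm z" by (rule norm_triangle_ineq)
    then show "x - z \<in> cball x0 (2 * \<delta>)" using that h by (auto simp: dist_norm algebra_simps)
  qed
  have \<phi>0: "\<phi> s \<ge> 0" if "0 \<le> s" "s \<le> h" for s
  proof -
    have "s * s \<le> s * (4 * h)" using that h by (intro mult_left_mono) auto
    then show ?thesis using h by (simp add: \<phi>_def power2_eq_square field_simps)
  qed
  have "w xa za ta \<le> 0" if "(xa, za, ta) \<in> ?W" for xa za ta
  proof (rule ccontr)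
    assume "\<not> w xa za ta \<le> 0"
    have cW: "compact ?W" by (intro compact_Times compact_cball compact_Icc)
    have c1: "continuous_on ?W ((\<lambda>(x,t). u x t) \<circ> (\<lambda>(x,z,t). (x, t)))"
      by (rule continuous_on_compose, simp add: split_beta, intro continuous_intros,
          rule continuous_on_subset[OF cont], use inb(1) h in force)
    have c2: "continuous_on ?W ((\<lambda>(x,t). u x t) \<circ> (\<lambda>(x,z,t). (x - z, t)))"
      by (rule continuous_on_compose, simp add: split_beta, intro continuous_intros,
          rule continuous_on_subset[OF cont], use inb(2) in \<open>fastforce simp del: mem_cball mem_cball_0\<close>)
    have "continuous_on ?W (\<lambda>(x,z,t). w x z t)"
      using c1 c2 h unfolding w_def \<phi>_def o_def split_beta
      by (intro continuous_intros) auto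
    moreover have "?W \<noteq> {}" using that by blast
    ultimately have "\<exists>p\<in>?W. \<forall>q\<in>?W. (\<lambda>(x,z,t). w x z t) q \<le> (\<lambda>(x,z,t). w x z t) p"
      by (intro continuous_attains_sup[OF cW])
    then obtain p where p: "p \<in> ?W" "\<And>q. q \<in> ?W \<Longrightarrow> (\<lambda>(x,z,t). w x z t) q \<le> (\<lambda>(x,z,t). w x z t) p"
      by blast
    obtain x z t where p': "p = (x, z, t)" by (cases p)
    have xzt: "x \<in> cball x0 \<delta>" "z \<in> cball 0 h" "T \<le> t" "t \<le> t0"
      using p(1) by (auto simp: p')
    have mx: "w x' z' t' \<le> w x z t"
      if "x' \<in> cball x0 \<delta>" "z' \<in> cball 0 h" "T \<le> t'" "t' \<le> t0" for x' z' t'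
      using p(2)[of "(x', z', t')"] that by (simp add: p')
    have wp: "w x z t > 0"
      using p(2)[OF that] \<open>\<not> w xa za ta \<le> 0\<close> by (simp add: p')
    define y where "y = x - z"
    define l where "l = norm z"
    have xb: "x \<in> cball x0 (2 * \<delta>)" and yb: "y \<in> cball x0 (2 * \<delta>)" using inb xzt by (auto simp: y_def)
    have xU: "x \<in> U" and yU: "y \<in> U" using xb yb U by auto
    have sd: "u x t - u y t \<le> 2 * m" using bnd[OF xb] bnd[OF yb] xzt by (smt (verit))
    have lle: "0 \<le> l" "l \<le> h" using xzt by (auto simp: l_def)
    have t1: "K * \<phi> l \<ge> 0" "L1 * (norm (x - x0))\<^sup>2 \<ge> 0" "\<theta> * (t0 - t) \<ge> 0"
      using \<phi>0[OF lle] pos xzt by auto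
    have wpos: "u x t - u y t > K * \<phi> l + L1 * (norm (x - x0))\<^sup>2 + \<theta> * (t0 - t)"
      using wp by (simp add: w_def y_def l_def)
    \<comment> \<open>For \<open>z = 0\<close> the two values of \<open>u\<close> cancel and the
      positive quantity \<open>w\<close> would be a sum of penalties with negative sign. Hence the
      norm is smooth near \<open>z\<close>.\<close>
    have "z \<noteq> 0" using wpos t1 by (auto simp: y_def)
    then have lpos: "l > 0" by (simp add: l_def)
    have "l \<noteq> h"
    proof
      assume "l = h"
      then have "\<phi> l = 3/4 * h" using h by (simp add: \<phi>_def power2_eq_square field_simps)
      then have "K * \<phi> l = K * (3/4 * h)" by (rule arg_cong)
      then show False using wpos t1 a sd by linarith
    qed
    then have llt: "l < h" using lle by simp
    have "norm (x - x0) \<noteq> \<delta>" using wpos t1 b sd by auto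
    then have xlt: "norm (x - x0) < \<delta>" using xzt by (simp add: dist_norm norm_minus_commute)
    have "t \<noteq> T" using wpos t1 c sd by auto
    then have tT: "T < t" using xzt by simp
    define \<phi>' where "\<phi>' = 1 - l / (2 * h)"
    have \<phi>': "0 < \<phi>'" "\<phi>' \<le> 1" using llt lpos h by (auto simp: \<phi>'_def field_simps)
    \<comment> \<open>Exact expansion at \<open>l\<close>. Only the reflected direction keeps its
      negative quadratic term; the other directions use \<open>conc'\<close>, which drops
      it.\<close>
    have conc: "\<phi> s = \<phi> l + \<phi>' * (s - l) - (s - l)\<^sup>2 / (4 * h)" for s
      using h by (simp add: \<phi>_def \<phi>'_def power2_eq_square field_simps)
    have conc': "\<phi> s \<le> \<phi> l + \<phi>' * (s - l)" for s
      using h by (simp add: conc[of s])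
    have nx: "(norm (x + r *\<^sub>R \<xi> - x0))\<^sup>2 = (norm (x - x0))\<^sup>2 + 2 * r * ((x - x0) \<bullet> \<xi>) + r\<^sup>2 * (norm \<xi>)\<^sup>2" for r \<xi>
      unfolding power2_norm_eq_inner by (simp add: algebra_simps inner_commute power2_eq_square)
    note twt = tw[OF xzt(3,4)]
    have stay: "\<exists>e>0. \<forall>r. \<bar>r\<bar> < e \<longrightarrow> u (x + r *\<^sub>R \<xi>) t - u (y + r *\<^sub>R \<zeta>) t
        \<le> u x t - u y t + K * (\<phi> (norm (z + r *\<^sub>R (\<xi> - \<zeta>))) - \<phi> l) + L1 * (2 * r * ((x - x0) \<bullet> \<xi>) + r\<^sup>2 * (norm \<xi>)\<^sup>2)" for \<xi> \<zeta>
    proof -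
      have "x \<in> ball x0 \<delta>" "z \<in> ball 0 h" using xlt llt by (auto simp: dist_norm norm_minus_commute l_def)
      then obtain e1 e2 where e: "e1 > 0" "\<And>r. \<bar>r\<bar> < e1 \<Longrightarrow> x + r *\<^sub>R \<xi> \<in> ball x0 \<delta>"
        "e2 > 0" "\<And>r. \<bar>r\<bar> < e2 \<Longrightarrow> z + r *\<^sub>R (\<xi> - \<zeta>) \<in> ball 0 h"
        using eventually_line_in_open[OF open_ball] by metis
      have "u (x + r *\<^sub>R \<xi>) t - u (y + r *\<^sub>R \<zeta>) t
        \<le> u x t - u y t + K * (\<phi> (norm (z + r *\<^sub>R (\<xi> - \<zeta>))) - \<phi> l) + L1 * (2 * r * ((x - x0) \<bullet> \<xi>) + r\<^sup>2 * (norm \<xi>)\<^sup>2)"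
        if r: "\<bar>r\<bar> < min e1 e2" for r
      proof -
        have eq: "x + r *\<^sub>R \<xi> - (z + r *\<^sub>R (\<xi> - \<zeta>)) = y + r *\<^sub>R \<zeta>" by (simp add: y_def algebra_simps)
        have "x + r *\<^sub>R \<xi> \<in> cball x0 \<delta>" "z + r *\<^sub>R (\<xi> - \<zeta>) \<in> cball 0 h"
          using e(2,4)[of r] r ball_subset_cball by auto
        then show ?thesis
          using mx[of "x + r *\<^sub>R \<xi>" "z + r *\<^sub>R (\<xi> - \<zeta>)" t] xzt unfolding w_def eq nx
          by (simp add: y_def[symmetric] l_def[symmetric] algebra_simps)
      qed
      then show ?thesis using e(1,3) by (intro exI[of _ "min e1 e2"]) auto
    qed
    have test: "G x t \<bullet> \<xi> - G y t \<bullet> \<zeta> = K * \<phi>' * (z \<bullet> (\<xi> - \<zeta>)) / l + 2 * L1 * ((x - x0) \<bullet> \<xi>)"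
      "\<xi> \<bullet> (H x t *v \<xi>) - \<zeta> \<bullet> (H y t *v \<zeta>) \<le> K * \<phi>' * (norm (\<xi> - \<zeta>))\<^sup>2 / l + 2 * L1 * (norm \<xi>)\<^sup>2" for \<xi> \<zeta>
    proof -
      obtain e where e: "e > 0" "\<And>r. \<bar>r\<bar> < e \<Longrightarrow> u (x + r *\<^sub>R \<xi>) t - u (y + r *\<^sub>R \<zeta>) t
        \<le> u x t - u y t + K * (\<phi> (norm (z + r *\<^sub>R (\<xi> - \<zeta>))) - \<phi> l) + L1 * (2 * r * ((x - x0) \<bullet> \<xi>) + r\<^sup>2 * (norm \<xi>)\<^sup>2)"
        using stay by blast
      let ?p1 = "K * \<phi>' * (z \<bullet> (\<xi> - \<zeta>)) / l + 2 * L1 * ((x - x0) \<bullet> \<xi>)"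
      let ?p2 = "K * \<phi>' * (norm (\<xi> - \<zeta>))\<^sup>2 / (2 * l) + L1 * (norm \<xi>)\<^sup>2"
      have "u (x + r *\<^sub>R \<xi>) t - u (y + r *\<^sub>R \<zeta>) t - (?p1 * r + ?p2 * r\<^sup>2) \<le> u x t - u y t" if "\<bar>r\<bar> < e" for r
      proof -
        let ?X = "(2 * r * (z \<bullet> (\<xi> - \<zeta>)) + r\<^sup>2 * (norm (\<xi> - \<zeta>))\<^sup>2) / (2 * l)"
        have "\<phi>' * (norm (z + r *\<^sub>R (\<xi> - \<zeta>)) - l) \<le> \<phi>' * ?X"
          using norm_bound_along_line[of z l r "\<xi> - \<zeta>"] lpos \<phi>' by (intro mult_left_mono) (auto simp: l_def)
        then have "\<phi> (norm (z + r *\<^sub>R (\<xi> - \<zeta>))) - \<phi> l \<le> \<phi>' * ?X"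
          using conc'[of "norm (z + r *\<^sub>R (\<xi> - \<zeta>))"] by linarith
        then have "K * (\<phi> (norm (z + r *\<^sub>R (\<xi> - \<zeta>))) - \<phi> l) \<le> K * (\<phi>' * ?X)"
          using pos by (intro mult_left_mono) auto
        moreover have "K * (\<phi>' * ?X) + L1 * (2 * r * ((x - x0) \<bullet> \<xi>) + r\<^sup>2 * (norm \<xi>)\<^sup>2) = ?p1 * r + ?p2 * r\<^sup>2"
          using lpos by (simp add: field_simps)
        ultimately show ?thesis using e(2)[OF that] by linarith
      qed
      from twice_diff_on_pair_test[OF twt twt U(1) xU yU e(1) this]
      show "G x t \<bullet> \<xi> - G y t \<bullet> \<zeta> = ?p1"
        "\<xi> \<bullet> (H x t *v \<xi>) - \<zeta> \<bullet> (H y t *v \<zeta>) \<le> K * \<phi>' * (norm (\<xi> - \<zeta>))\<^sup>2 / l + 2 * L1 * (norm \<xi>)\<^sup>2"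
        by (auto simp: field_simps)
    qed
    define e where "e = (1 / l) *\<^sub>R z"
    have e1: "norm e = 1" using lpos by (simp add: e_def l_def)
    \<comment> \<open>Moving the points by \<open>e\<close> and \<open>- e\<close> changes the
      difference only in length, from \<open>l\<close> to exactly \<open>l + 2 * r\<close>. The
      quadratic term of \<open>\<phi>\<close> then contributes \<open>- K / h * r\<^sup>2\<close>,
      the decisive negative term.\<close>
    have refl: "e \<bullet> (H x t *v e) - e \<bullet> (H y t *v e) \<le> - 2 * K / h + 2 * L1"
    proof -
      obtain d where d: "d > 0" "\<And>r. \<bar>r\<bar> < d \<Longrightarrow> u (x + r *\<^sub>R e) t - u (y + r *\<^sub>R (- e)) t
        \<le> u x t - u y t + K * (\<phi> (norm (z + r *\<^sub>R (e - - e))) - \<phi> l) + L1 * (2 * r * ((x - x0) \<bullet> e) + r\<^sup>2 * (norm e)\<^sup>2)"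
        using stay[of e "- e"] by blast
      have bound: "u (x + r *\<^sub>R e) t - u (y + r *\<^sub>R (- e)) t
        - ((2 * K * \<phi>' + 2 * L1 * ((x - x0) \<bullet> e)) * r + (- K / h + L1) * r\<^sup>2) \<le> u x t - u y t" if "\<bar>r\<bar> < min d (l/2)" for r
      proof -
        have "z + r *\<^sub>R (e - - e) = (1 + 2 * r / l) *\<^sub>R z"
          by (simp add: e_def algebra_simps scaleR_2[symmetric])
        moreover have "1 + 2 * r / l \<ge> 0" using that lpos by (auto simp: field_simps)
        ultimately have n: "norm (z + r *\<^sub>R (e - - e)) = l + 2 * r"
          using lpos by (simp add: l_def[symmetric] field_simps)
        have "K * (\<phi> (norm (z + r *\<^sub>R (e - - e))) - \<phi> l) = K * (\<phi>' * (2 * r) - (2 * r)\<^sup>2 / (4 * h))"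
          unfolding n conc[of "l + 2 * r"] by simp
        also have "\<dots> = 2 * K * \<phi>' * r - K / h * r\<^sup>2"
          using h by (simp add: power2_eq_square field_simps)
        finally show ?thesis using d(2)[of r] that by (simp add: e1 algebra_simps)
      qed
      have "e \<bullet> (H x t *v e) - (- e) \<bullet> (H y t *v (- e)) \<le> 2 * (- K / h + L1)"
        by (rule twice_diff_on_pair_test(2)[where e = "min d (l/2)", OF twt twt U(1) xU yU _ bound]) (use d(1) lpos in auto)
      moreover have "H y t *v (- e) = - (H y t *v e)"
        by (metis matrix_vector_mult_scaleR scaleR_minus1_left)
      ultimately show ?thesis by simp
    qed
    \<comment> \<open>Both points move by the same vector, so their difference is unchanged and only
      the localising term in \<open>L1\<close> contributes.\<close>
    have proj: "(\<Sum>k\<in>UNIV. sphere_proj e k \<bullet> (H x t *v sphere_proj e k)) - (\<Sum>k\<in>UNIV. sphere_proj e k \<bullet> (H y t *v sphere_proj e k))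
        \<le> real CARD('n) * (2 * L1)"
    proof -
      have "sphere_proj e k \<bullet> (H x t *v sphere_proj e k) - sphere_proj e k \<bullet> (H y t *v sphere_proj e k) \<le> 2 * L1" for k
        using test(2)[of "sphere_proj e k" "sphere_proj e k"] norm_sphere_proj_le[OF e1, of k] pos
          mult_left_mono[of "(norm (sphere_proj e k))\<^sup>2" 1 "2 * L1"] by simp
      then show ?thesis
        unfolding sum_subtractf[symmetric] by (rule sum_bounded_above)
    qed
    \<comment> \<open>The points follow the fields at their own positions. The squared difference of
      the fields is at most \<open>L\<^sup>2 * l\<^sup>2\<close>, which cancels the singular factor
      \<open>1 / l\<close> from the norm.\<close>
    have diffus: "(\<Sum>k\<in>UNIV. Mc k x \<bullet> (H x t *v Mc k x)) - (\<Sum>k\<in>UNIV. Mc k y \<bullet> (H y t *v Mc k y))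
        \<le> real CARD('n) * (K * L\<^sup>2 * h + 2 * L1 * Bd\<^sup>2)"
    proof -
      have "Mc k x \<bullet> (H x t *v Mc k x) - Mc k y \<bullet> (H y t *v Mc k y) \<le> K * L\<^sup>2 * h + 2 * L1 * Bd\<^sup>2" for k
      proof -
        have "norm (Mc k x - Mc k y) \<le> L * l" using Mlip[OF xb yb, of k] by (simp add: dist_norm y_def l_def)
        then have "(norm (Mc k x - Mc k y))\<^sup>2 \<le> L\<^sup>2 * l\<^sup>2"
          unfolding power_mult_distrib[symmetric] by (intro power_mono) auto
        then have "(norm (Mc k x - Mc k y))\<^sup>2 / l \<le> L\<^sup>2 * l"
          using lpos by (simp add: field_simps power2_eq_square[of l])
        also have "\<dots> \<le> L\<^sup>2 * h" using lle by (simp add: mult_left_mono)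
        finally have "(K * \<phi>') * ((norm (Mc k x - Mc k y))\<^sup>2 / l) \<le> (K * 1) * (L\<^sup>2 * h)"
          using pos \<phi>' lpos by (intro mult_mono) auto
        moreover have "(2 * L1) * (norm (Mc k x))\<^sup>2 \<le> (2 * L1) * Bd\<^sup>2"
          using Mb[OF xb, of k] pos by (intro mult_left_mono power_mono) auto
        ultimately show ?thesis using test(2)[of "Mc k x" "Mc k y"] by simp
      qed
      then show ?thesis
        unfolding sum_subtractf[symmetric] by (rule sum_bounded_above)
    qed
    have zi: "\<bar>K * \<phi>' * (z \<bullet> v) / l\<bar> \<le> K * norm v" for v
    proof -
      have "\<bar>z \<bullet> v\<bar> / l \<le> norm v"
        using Cauchy_Schwarz_ineq2[of z v] lpos by (simp add: l_def[symmetric] field_simps)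
      then have "(K * \<phi>') * (\<bar>z \<bullet> v\<bar> / l) \<le> (K * 1) * norm v"
        using pos \<phi>' lpos by (intro mult_mono) auto
      then show ?thesis using pos \<phi>' lpos by (simp add: abs_mult)
    qed
    \<comment> \<open>Moving only one of the two points in the first-order test reads off the
      gradient at that point.\<close>
    have g1: "\<beta> x \<bullet> G x t \<le> K * K1 + 2 * L1 * (\<delta> * K1)"
    proof -
      have "(x - x0) \<bullet> \<beta> x \<le> norm (x - x0) * norm (\<beta> x)" by (rule norm_cauchy_schwarz)
      also have "\<dots> \<le> \<delta> * K1" using xlt h \<beta>b[OF xb] by (intro mult_mono) auto
      finally have "2 * L1 * ((x - x0) \<bullet> \<beta> x) \<le> 2 * L1 * (\<delta> * K1)" using pos by (intro mult_left_mono) auto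
      moreover have "K * \<phi>' * (z \<bullet> \<beta> x) / l \<le> K * K1"
        using zi[of "\<beta> x"] \<beta>b[OF xb] pos mult_left_mono[of "norm (\<beta> x)" K1 K] by linarith
      ultimately show ?thesis using test(1)[of "\<beta> x" 0] by (simp add: inner_commute)
    qed
    have g2: "- (\<beta> y \<bullet> G y t) \<le> K * K1"
    proof -
      have "G y t \<bullet> \<beta> y = K * \<phi>' * (z \<bullet> \<beta> y) / l" using test(1)[of 0 "\<beta> y"] by simp
      then show ?thesis
        using zi[of "\<beta> y"] \<beta>b[OF yb] pos mult_left_mono[of "norm (\<beta> y)" K1 K]
        unfolding inner_commute[of "\<beta> y"] by linarith
    qed
    have tder: "0 \<le> st x t - st y t + \<theta>"
    proof (rule left_derivative_nonneg[OF _ tT])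
      show "((\<lambda>s. w x z s) has_real_derivative st x t - st y t + \<theta>) (at t)"
        unfolding w_def y_def[symmetric]
        by (rule derivative_eq_intros refl td[OF xb] td[OF yb] xzt | simp)+
      show "w x z s \<le> w x z t" if "T \<le> s" "s < t" for s
        using mx[of x z s] xzt that by auto
    qed
    \<comment> \<open>The reflected direction and the projected directions together give the
      difference of the traces by \<open>sum_sphere_proj\<close>; this is the part with factor
      \<open>\<nu>\<close>.\<close>
    have "ellop \<nu> Mc (H x t) x - ellop \<nu> Mc (H y t) y
      \<le> \<nu> * (real CARD('n) * (2 * L1) + (- 2 * K / h + 2 * L1)) + real CARD('n) * (K * L\<^sup>2 * h + 2 * L1 * Bd\<^sup>2)"
    proof -
      have "(\<Sum>k\<in>UNIV. H x t $ k $ k) - (\<Sum>k\<in>UNIV. H y t $ k $ k) \<le> real CARD('n) * (2 * L1) + (- 2 * K / h + 2 * L1)"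
        using proj refl sum_sphere_proj[OF e1, of "H x t"] sum_sphere_proj[OF e1, of "H y t"] by linarith
      then have "\<nu> * ((\<Sum>k\<in>UNIV. H x t $ k $ k) - (\<Sum>k\<in>UNIV. H y t $ k $ k)) \<le> \<nu> * (real CARD('n) * (2 * L1) + (- 2 * K / h + 2 * L1))"
        using \<nu> by (intro mult_left_mono) auto
      then show ?thesis using diffus by (simp add: ellop_def right_diff_distrib)
    qed
    moreover have "\<nu> * (real CARD('n) * (2 * L1) + (- 2 * K / h + 2 * L1)) = L1 * (2 * \<nu> + 2 * \<nu> * real CARD('n)) - 2 * \<nu> * K / h"
      by (simp add: algebra_simps)
    moreover have "real CARD('n) * (K * L\<^sup>2 * h + 2 * L1 * Bd\<^sup>2)
        = K * real CARD('n) * L\<^sup>2 * h + L1 * (2 * real CARD('n) * Bd\<^sup>2)"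
      by (simp add: algebra_simps)
    moreover have "\<theta> + 2 * \<Phi> + (L1 * (2 * \<nu> + 2 * \<nu> * real CARD('n)) + L1 * (2 * real CARD('n) * Bd\<^sup>2) + 2 * L1 * (\<delta> * K1))
        + 2 * (K * K1) + K * real CARD('n) * L\<^sup>2 * h < 2 * \<nu> * K / h"
      using d by (simp add: algebra_simps)
    ultimately show False
      using tder pde[OF xb xzt(3,4)] pde[OF yb xzt(3,4)] g1 g2 unfolding abs_le_iff by linarith
  qed
  \<comment> \<open>At \<open>x = x0\<close> and time \<open>t0\<close> the localising terms vanish,
    and \<open>\<phi> s \<le> s\<close> leaves the Lipschitz bound.\<close>
  from this[of x0 "x0 - y" t0] have "u x0 t0 - u y t0 \<le> K * \<phi> (norm (x0 - y))"
    using y h T by (simp add: w_def dist_norm norm_minus_commute)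
  also have "\<dots> \<le> K * norm (x0 - y)" using pos h by (intro mult_left_mono) (auto simp: \<phi>_def)
  finally show ?thesis by (simp add: dist_norm)
qed

text \<open>With \<open>r = sqrt \<tau>\<close> the parameters are \<open>h = c * r\<close>,
  \<open>K = 3 * S / (c * r)\<close>, \<open>L1 = 2 * S / \<delta>\<^sup>2\<close> and
  \<open>\<theta> = 2 * S / r\<^sup>2\<close>, chosen so that each penalty reaches
  \<open>2 * S\<close>. Division by \<open>Q = S / r\<^sup>2\<close> turns the remaining condition
  into \<open>inner\<close>, free of \<open>S\<close> and \<open>\<tau>\<close>; here
  \<open>\<tau> \<le> 1\<close> gives \<open>S \<le> Q\<close>.\<close>

lemma interior_gradient_bound:
  assumes S: "S > 0" "\<Phi> \<le> S" "m \<le> S" and short: "t0 - T \<le> 1"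
  shows "norm (G x0 t0) \<le> 3 / doubling_scale (real CARD('n)) \<nu> \<delta> Bd L K1 * S / sqrt (t0 - T)"
proof -
  define \<tau> where "\<tau> = t0 - T"
  have \<tau>: "0 < \<tau>" "\<tau> \<le> 1" using T short by (auto simp: \<tau>_def)
  define n where "n = real CARD('n)"
  define E where "E = 2 * \<nu> + 2 * \<nu> * n + 2 * n * Bd\<^sup>2 + 2 * K1 * \<delta>"
  \<comment> \<open>The summand 4 collects \<open>\<theta>\<close> and the error
    \<open>2 * \<Phi>\<close>, the next comes from the localisation, the last from the Lipschitz
    fields. The first-order term adds \<open>6 * K1\<close>, and \<open>X\<close> is the denominator
    in \<open>doubling_scale\<close>.\<close>
  define Y where "Y = 4 + 2 * E / \<delta>\<^sup>2 + 3 * n * L\<^sup>2"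
  define X where "X = Y + 6 * K1"
  define c where "c = doubling_scale n \<nu> \<delta> Bd L K1"
  have n: "n \<ge> 0" by (simp add: n_def)
  have E: "E \<ge> 0" using \<nu> \<delta> K1 n by (simp add: E_def)
  have Y: "Y > 0" using E n unfolding Y_def by (intro add_pos_nonneg) auto
  then have X: "X > 0" using K1 by (simp add: X_def)
  have c: "c > 0" "c \<le> 1" "c \<le> \<delta>" "c \<le> \<nu> / X"
    using doubling_scale_pos[OF \<nu> \<delta> K1 n] by (auto simp: c_def doubling_scale_def X_def Y_def E_def)
  have cX: "c * X \<le> \<nu>" using c(4) X by (simp add: field_simps)
  have inner: "Y + 6 * K1 / c < 6 * \<nu> / c\<^sup>2"
  proof -
    have "c * (c * Y) \<le> 1 * (c * Y)" using c Y by (intro mult_right_mono) auto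
    then have "c\<^sup>2 * Y + 6 * K1 * c < 6 * \<nu>" using cX \<nu> by (simp add: X_def power2_eq_square algebra_simps)
    then have "(c\<^sup>2 * Y + 6 * K1 * c) / c\<^sup>2 < 6 * \<nu> / c\<^sup>2" using c by (intro divide_strict_right_mono) auto
    moreover have "(c\<^sup>2 * Y + 6 * K1 * c) / c\<^sup>2 = Y + 6 * K1 / c"
      using c by (simp add: power2_eq_square add_divide_distrib)
    ultimately show ?thesis by simp
  qed
  define r where "r = sqrt \<tau>"
  have r: "r > 0" "r \<le> 1" "r\<^sup>2 = \<tau>" using \<tau> by (auto simp: r_def)
  define Q where "Q = S / r\<^sup>2"
  have Q: "Q > 0" "S = Q * r\<^sup>2" using S r by (auto simp: Q_def)
  have SQ: "S \<le> Q"
    unfolding Q(2) using Q(1) r(1,2) mult_left_mono[of "r\<^sup>2" 1 Q] by (simp add: power_le_one)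
  define K where "K = 3 * S / (c * r)"
  have K: "K > 0" using S c r by (simp add: K_def)
  have x0U: "x0 \<in> U" using U(2) \<delta> by (simp add: subset_iff)
  have "norm (G x0 t0) \<le> K"
  proof (rule norm_gradient_le_of_lower_lipschitz)
    show "((\<lambda>y. u y t0) has_derivative (\<lambda>h. G x0 t0 \<bullet> h)) (at x0)"
      using twice_diff_onD(1)[OF tw[of t0] x0U] T by simp
    show "c * r > 0" "K \<ge> 0" using c r K by auto
    fix y assume y: "y \<in> cball x0 (c * r)"
    have cr: "c * r \<le> \<delta>" using c r mult_mono[of c \<delta> r 1] by simp
    have d: "2 * S / r\<^sup>2 + 2 * S + (2 * S / \<delta>\<^sup>2) * E + 2 * K1 * K + K * n * L\<^sup>2 * (c * r) < 2 * \<nu> * K / (c * r)"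
    proof -
      have 1: "(2 * S / \<delta>\<^sup>2) * E \<le> Q * (2 * E / \<delta>\<^sup>2)"
        using mult_right_mono[OF SQ, of "2 * E / \<delta>\<^sup>2"] E by (simp add: mult_ac)
      have "2 * K1 * K = (6 * K1 / c) * (Q * r)"
        unfolding K_def Q(2) using r(1) c by (simp add: power2_eq_square)
      also have "\<dots> \<le> (6 * K1 / c) * (Q * 1)"
        using K1 c Q r by (intro mult_left_mono) auto
      finally have 2: "2 * K1 * K \<le> Q * (6 * K1 / c)" by (simp add: mult.commute)
      have "K * n * L\<^sup>2 * (c * r) = S * (3 * n * L\<^sup>2)" using c r by (simp add: K_def)
      also have "\<dots> \<le> Q * (3 * n * L\<^sup>2)" using SQ n by (intro mult_right_mono) auto
      finally have 3: "K * n * L\<^sup>2 * (c * r) \<le> Q * (3 * n * L\<^sup>2)" .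
      have "2 * S / r\<^sup>2 = Q * 2" by (simp add: Q_def)
      then have "2 * S / r\<^sup>2 + 2 * S + (2 * S / \<delta>\<^sup>2) * E + 2 * K1 * K + K * n * L\<^sup>2 * (c * r)
        \<le> Q * (Y + 6 * K1 / c)"
        using 1 2 3 SQ unfolding Y_def distrib_left by linarith
      also have "\<dots> < Q * (6 * \<nu> / c\<^sup>2)" using inner Q by (intro mult_strict_left_mono)
      also have "\<dots> = 2 * \<nu> * K / (c * r)"
        using c r(1) by (simp add: K_def Q_def power2_eq_square mult_ac)
      finally show ?thesis .
    qed
    show "u x0 t0 - u y t0 \<le> K * dist x0 y"
    proof (rule doubling_estimate[where h = "c * r" and ?L1.0 = "2 * S / \<delta>\<^sup>2" and \<theta> = "2 * S / r\<^sup>2", OF _ cr K])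
      have "K * (3 / 4 * (c * r)) = 9 / 4 * S" using c r by (simp add: K_def)
      then show "2 * m \<le> K * (3 / 4 * (c * r))" using S by linarith
      show "2 * S / r\<^sup>2 + 2 * \<Phi> + 2 * S / \<delta>\<^sup>2 * (2 * \<nu> + 2 * \<nu> * real CARD('n) + 2 * real CARD('n) * Bd\<^sup>2 + 2 * K1 * \<delta>) +
        2 * K1 * K + K * real CARD('n) * L\<^sup>2 * (c * r) < 2 * \<nu> * K / (c * r)"
        using d S(2) unfolding E_def n_def by linarith
      show "2 * m \<le> 2 * S / \<delta>\<^sup>2 * \<delta>\<^sup>2" using \<delta> S by simp
      show "2 * m \<le> 2 * S / r\<^sup>2 * (t0 - T)" using r \<tau> S by (simp add: \<tau>_def[symmetric])
      show "0 < c * r" using c r by simp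
      show "0 \<le> 2 * S / \<delta>\<^sup>2" "0 \<le> 2 * S / r\<^sup>2" using S by simp_all
    qed (fact y)
  qed
  then show ?thesis by (simp add: K_def r_def \<tau>_def c_def n_def)
qed

end

section \<open>Comparison with a barrier\<close>

lemma twice_diff_on_uminus:
  assumes "twice_diff_on U s G H"
  shows "twice_diff_on U (\<lambda>x. - s x) (\<lambda>x. - G x) (\<lambda>x. - H x)"
  unfolding twice_diff_on_def
proof (intro ballI conjI)
  fix x assume "x \<in> U"
  from twice_diff_onD[OF assms this]
  have "((\<lambda>x. - s x) has_derivative (\<lambda>h. - (G x \<bullet> h))) (at x)"
    "((\<lambda>x. - G x) has_derivative (\<lambda>h. - (H x *v h))) (at x)"
    by (auto intro: has_derivative_minus)
  moreover have "(- H x) *v h = - (H x *v h)" for h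
    by (simp add: vec_eq_iff matrix_vector_mult_def sum_negf)
  ultimately show "((\<lambda>x. - s x) has_derivative (\<lambda>h. (- G x) \<bullet> h)) (at x)"
    "((\<lambda>x. - G x) has_derivative (\<lambda>h. (- H x) *v h)) (at x)"
    by auto
qed

lemma ellop_uminus: "ellop \<nu> Mc (- H) x = - ellop \<nu> Mc H x"
proof -
  have "(- H) *v h = - (H *v h)" for h
    by (simp add: vec_eq_iff matrix_vector_mult_def sum_negf)
  then show ?thesis by (simp add: ellop_def sum_negf)
qed

text \<open>\<open>Psup\<close> makes \<open>exp (- \<eta> * t) * \<Psi> x\<close> a supersolution
  of the homogeneous equation, so \<open>\<eta>\<close> is the decay rate.\<close>

locale barrier =
  fixes U :: "(real^'n::finite) set" and \<nu> Mc \<beta> \<gamma> \<Psi> GP HP and \<psi>0 \<psi>1 \<eta> :: real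
  assumes U: "open U" "bounded U" and \<nu>: "\<nu> > 0"
    and twP: "twice_diff_on U \<Psi> GP HP" and Pcont: "continuous_on (closure U) \<Psi>"
    and Pbnd: "\<And>x. x \<in> closure U \<Longrightarrow> \<psi>0 \<le> \<Psi> x" "\<And>x. x \<in> closure U \<Longrightarrow> \<Psi> x \<le> \<psi>1" and \<psi>0: "\<psi>0 > 0"
    and Psup: "\<And>x. x \<in> U \<Longrightarrow> ellop \<nu> Mc (HP x) x + \<beta> x \<bullet> GP x + \<gamma> x * \<Psi> x \<le> - \<eta> * \<Psi> x" and \<eta>: "\<eta> > 0"
begin

text \<open>The comparison function is \<open>k t * \<Psi> x\<close>, whose constant part
  \<open>K2\<close> carries the source and the lateral data. A slack \<open>\<kappa> > 0\<close>
  makes all inequalities strict, as the first-touch argument requires, and is sent to 0 at the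
  end.\<close>

lemma decay_upper_bound:
  fixes u f :: "real^'n \<Rightarrow> real \<Rightarrow> real"
  assumes tw: "\<And>t. T < t \<Longrightarrow> twice_diff_on U (\<lambda>y. u y t) (\<lambda>y. G y t) (\<lambda>y. H y t)"
    and td: "\<And>x t. x \<in> U \<Longrightarrow> T < t \<Longrightarrow> ((\<lambda>s. u x s) has_real_derivative st x t) (at t)"
    and pde: "\<And>x t. x \<in> U \<Longrightarrow> T < t \<Longrightarrow>
        st x t = ellop \<nu> Mc (H x t) x + \<beta> x \<bullet> G x t + \<gamma> x * u x t + f x t"
    and cont: "continuous_on (closure U \<times> {T..}) (\<lambda>(x,t). u x t)"
    and f: "\<And>x t. x \<in> U \<Longrightarrow> T < t \<Longrightarrow> f x t \<le> \<epsilon>"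
    and bd: "\<And>x t. x \<in> frontier U \<Longrightarrow> T < t \<Longrightarrow> u x t \<le> \<epsilon>"
    and init: "\<And>x. x \<in> closure U \<Longrightarrow> u x T \<le> \<mu>"
    and \<epsilon>: "\<epsilon> \<ge> 0" "\<mu> \<ge> 0" and x: "x \<in> closure U" and t: "T \<le> t"
  shows "u x t \<le> \<psi>1 / \<psi>0 * (\<mu> * exp (- \<eta> * (t - T)) + \<epsilon> * (1 + 1/\<eta>))"
proof -
  have key: "u x t \<le> \<psi>1 / \<psi>0 * (\<mu> * exp (- \<eta> * (t - T)) + (\<epsilon> * (1 + 1/\<eta>) + \<kappa>))" if \<kappa>: "\<kappa> > 0" for \<kappa>
  proof -
    \<comment> \<open>The 1 serves the lateral boundary (\<open>K2 > \<epsilon>\<close>), the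
      \<open>1/\<eta>\<close> serves the source (\<open>\<eta> * K2 > \<epsilon>\<close>).\<close>
    define K2 where "K2 = \<epsilon> * (1 + 1/\<eta>) + \<kappa>"
    have K2: "K2 > 0" "K2 > \<epsilon>" "\<eta> * K2 > \<epsilon>"
    proof -
      show "K2 > 0" using \<epsilon> \<eta> \<kappa> by (simp add: K2_def add_nonneg_pos)
      have "\<epsilon> * (1/\<eta>) \<ge> 0" using \<epsilon> \<eta> by simp
      then show "K2 > \<epsilon>" using \<kappa> by (simp add: K2_def algebra_simps)
      have "\<eta> * K2 = \<eta> * \<epsilon> + \<epsilon> + \<eta> * \<kappa>" using \<eta> by (simp add: K2_def field_simps)
      moreover have "\<eta> * \<epsilon> \<ge> 0" "\<eta> * \<kappa> > 0" using \<epsilon> \<eta> \<kappa> by auto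
      ultimately show "\<eta> * K2 > \<epsilon>" by linarith
    qed
    define k where "k s = (\<mu> * exp (- \<eta> * (s - T)) + K2) / \<psi>0" for s
    have kpos: "k s > 0" for s using K2 \<epsilon> \<psi>0 by (simp add: k_def add_nonneg_pos)
    have kK2: "k s \<ge> K2 / \<psi>0" for s using \<epsilon> \<psi>0 by (simp add: k_def divide_right_mono)
    have kP: "k s * \<Psi> y \<ge> K2" if "y \<in> closure U" for s y
    proof -
      have "K2 = K2 / \<psi>0 * \<psi>0" using \<psi>0 by simp
      also have "\<dots> \<le> k s * \<Psi> y" using kK2[of s] Pbnd(1)[OF that] K2 \<psi>0 kpos[of s] by (intro mult_mono) auto
      finally show ?thesis .
    qed
    define k' where "k' s = - \<eta> * \<mu> * exp (- \<eta> * (s - T)) / \<psi>0" for s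
    have dk: "(k has_real_derivative k' s) (at s)" for s
      unfolding k_def k'_def using \<psi>0 by (auto intro!: derivative_eq_intros)
    have "u x t - k t * \<Psi> x < 0"
    proof (rule neg_before_first_touch[where K = "closure U" and T = T and z = "\<lambda>x t. u x t - k t * \<Psi> x"])
      show "compact (closure U)" using U by (simp add: compact_closure)
      have "continuous_on (closure U \<times> {T..}) (\<Psi> \<circ> fst)"
        by (intro continuous_on_compose continuous_intros continuous_on_subset[OF Pcont]) auto
      then show "continuous_on (closure U \<times> {T..}) (\<lambda>(x, t). u x t - k t * \<Psi> x)"
        using cont \<psi>0 unfolding k_def split_beta o_def by (intro continuous_intros) auto
      show "u y T - k T * \<Psi> y < 0" if "y \<in> closure U" for y
      proof -
        have "\<mu> < \<mu> + K2" using K2 by simp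
        also have "\<dots> = (\<mu> + K2) / \<psi>0 * \<psi>0" using \<psi>0 by simp
        also have "\<dots> \<le> (\<mu> + K2) / \<psi>0 * \<Psi> y" using Pbnd(1)[OF that] \<psi>0 K2 \<epsilon> by (intro mult_left_mono) auto
        finally show ?thesis using init[OF that] by (simp add: k_def)
      qed
      show "x \<in> closure U" "T \<le> t" by fact+
      fix y s assume y: "y \<in> closure U" and s: "T < s" and z0: "u y s - k s * \<Psi> y = 0"
        and le: "\<And>y. y \<in> closure U \<Longrightarrow> u y s - k s * \<Psi> y \<le> 0"
        and before: "\<And>r. T \<le> r \<Longrightarrow> r < s \<Longrightarrow> u y r - k r * \<Psi> y < 0"
      have yU: "y \<in> U"
      proof (rule ccontr)
        assume "y \<notin> U"
        then have "y \<in> frontier U" using y U by (simp add: frontier_def interior_open)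
        then show False using bd[OF _ s] kP[OF y, of s] z0 K2 by force
      qed
      have tests: "G y s \<bullet> \<xi> = k s * (GP y \<bullet> \<xi>)" "\<xi> \<bullet> (H y s *v \<xi>) \<le> k s * (\<xi> \<bullet> (HP y *v \<xi>))" for \<xi>
      proof -
        have twk: "twice_diff_on U (\<lambda>x. k s * \<Psi> x) (\<lambda>x. k s *\<^sub>R GP x) (\<lambda>x. k s *\<^sub>R HP x)"
          unfolding twice_diff_on_def
        proof (intro ballI conjI)
          fix x assume "x \<in> U"
          note d = twice_diff_onD[OF twP this]
          show "((\<lambda>x. k s * \<Psi> x) has_derivative (\<lambda>h. (k s *\<^sub>R GP x) \<bullet> h)) (at x)"
            using has_derivative_mult_right[OF d(1), of "k s"] by simp
          show "((\<lambda>x. k s *\<^sub>R GP x) has_derivative (\<lambda>h. (k s *\<^sub>R HP x) *v h)) (at x)"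
            using has_derivative_scaleR_right[OF d(2), of "k s"] by (simp add: scaleR_matrix_vector_assoc)
        qed
        obtain e where e: "e > 0" "\<And>r. \<bar>r\<bar> < e \<Longrightarrow> y + r *\<^sub>R \<xi> \<in> U"
          using eventually_line_in_open[OF U(1) yU] by metis
        have "u (y + r *\<^sub>R \<xi>) s - k s * \<Psi> (y + r *\<^sub>R \<xi>) - (0 * r + 0 * r\<^sup>2) \<le> u y s - k s * \<Psi> y" if "\<bar>r\<bar> < e" for r
          using le[of "y + r *\<^sub>R \<xi>"] e(2)[OF that] z0 closure_subset[of U] by auto
        from twice_diff_on_pair_test[OF tw[OF s] twk U(1) yU yU e(1) this]
        show "G y s \<bullet> \<xi> = k s * (GP y \<bullet> \<xi>)" "\<xi> \<bullet> (H y s *v \<xi>) \<le> k s * (\<xi> \<bullet> (HP y *v \<xi>))"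
          by (auto simp: scaleR_matrix_vector_assoc[symmetric])
      qed
      have "ellop \<nu> Mc (H y s) y \<le> k s * ellop \<nu> Mc (HP y) y"
      proof -
        have "(\<Sum>i\<in>UNIV. H y s $ i $ i) \<le> (\<Sum>i\<in>UNIV. k s * HP y $ i $ i)"
        proof (rule sum_mono)
          fix i
          have "axis i 1 \<bullet> (M *v axis i 1) = M $ i $ i" for M :: "real^'n^'n"
            by (simp add: matrix_vector_mul_component inner_axis' inner_axis)
          then show "H y s $ i $ i \<le> k s * HP y $ i $ i" using tests(2)[of "axis i 1"] by simp
        qed
        then have "\<nu> * (\<Sum>i\<in>UNIV. H y s $ i $ i) \<le> \<nu> * (\<Sum>i\<in>UNIV. k s * HP y $ i $ i)"
          using \<nu> by (intro mult_left_mono) auto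
        moreover have "(\<Sum>i\<in>UNIV. Mc i y \<bullet> (H y s *v Mc i y)) \<le> (\<Sum>i\<in>UNIV. k s * (Mc i y \<bullet> (HP y *v Mc i y)))"
          by (rule sum_mono) (rule tests(2))
        ultimately show ?thesis
          by (simp add: ellop_def sum_distrib_left[symmetric] algebra_simps)
      qed
      moreover have "\<beta> y \<bullet> G y s = k s * (\<beta> y \<bullet> GP y)"
        using tests(1)[of "\<beta> y"] by (simp add: inner_commute)
      moreover have "\<gamma> y * u y s = k s * (\<gamma> y * \<Psi> y)" using z0 by (simp add: algebra_simps)
      ultimately have "st y s \<le> k s * (ellop \<nu> Mc (HP y) y + \<beta> y \<bullet> GP y + \<gamma> y * \<Psi> y) + \<epsilon>"
        using pde[OF yU s] f[OF yU s] unfolding distrib_left by linarith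
      also have "\<dots> \<le> k s * (- \<eta> * \<Psi> y) + \<epsilon>"
        using Psup[OF yU] kpos[of s] by (intro add_right_mono mult_left_mono) auto
      also have "\<dots> = k' s * \<Psi> y - \<eta> * (K2 / \<psi>0 * \<Psi> y) + \<epsilon>"
        using \<psi>0 by (simp add: k_def k'_def field_simps)
      also have "\<dots> < k' s * \<Psi> y"
      proof -
        have "K2 / \<psi>0 * \<Psi> y \<ge> K2 / \<psi>0 * \<psi>0" using Pbnd(1)[OF y] K2 \<psi>0 by (intro mult_left_mono) auto
        then have "K2 / \<psi>0 * \<Psi> y \<ge> K2" using \<psi>0 by simp
        then have "\<eta> * (K2 / \<psi>0 * \<Psi> y) \<ge> \<eta> * K2" using \<eta> by (intro mult_left_mono) auto
        then show ?thesis using K2(3) by linarith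
      qed
      finally have "st y s - k' s * \<Psi> y < 0" by simp
      moreover have "((\<lambda>r. u y r - k r * \<Psi> y) has_real_derivative st y s - k' s * \<Psi> y) (at s)"
        by (intro DERIV_diff td[OF yU s] DERIV_cmult_right dk)
      then have "0 \<le> st y s - k' s * \<Psi> y"
        by (rule left_derivative_nonneg[OF _ s]) (use before z0 in force)
      ultimately show False by simp
    qed
    then have "u x t \<le> k t * \<Psi> x" by simp
    also have "k t * \<Psi> x \<le> k t * \<psi>1" using Pbnd(2)[OF x] kpos[of t] by (simp add: mult_left_mono)
    also have "k t * \<psi>1 = \<psi>1 / \<psi>0 * (\<mu> * exp (- \<eta> * (t - T)) + (\<epsilon> * (1 + 1/\<eta>) + \<kappa>))"
      by (simp add: k_def K2_def mult.commute)
    finally show ?thesis .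
  qed
  have "((\<lambda>\<kappa>. \<psi>1 / \<psi>0 * (\<mu> * exp (- \<eta> * (t - T)) + (\<epsilon> * (1 + 1/\<eta>) + \<kappa>))) \<longlongrightarrow>
      \<psi>1 / \<psi>0 * (\<mu> * exp (- \<eta> * (t - T)) + (\<epsilon> * (1 + 1/\<eta>) + 0))) (at_right 0)"
    by (intro tendsto_intros)
  moreover have "\<forall>\<^sub>F \<kappa> in at_right 0. u x t \<le> \<psi>1 / \<psi>0 * (\<mu> * exp (- \<eta> * (t - T)) + (\<epsilon> * (1 + 1/\<eta>) + \<kappa>))"
    by (rule eventually_mono[OF eventually_at_right_less key])
  ultimately have "u x t \<le> \<psi>1 / \<psi>0 * (\<mu> * exp (- \<eta> * (t - T)) + (\<epsilon> * (1 + 1/\<eta>) + 0))"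
    by (rule tendsto_lowerbound) simp
  then show ?thesis by simp
qed

lemma decay_bound:
  fixes u f :: "real^'n \<Rightarrow> real \<Rightarrow> real"
  assumes tw: "\<And>t. T < t \<Longrightarrow> twice_diff_on U (\<lambda>y. u y t) (\<lambda>y. G y t) (\<lambda>y. H y t)"
    and td: "\<And>x t. x \<in> U \<Longrightarrow> T < t \<Longrightarrow> ((\<lambda>s. u x s) has_real_derivative st x t) (at t)"
    and pde: "\<And>x t. x \<in> U \<Longrightarrow> T < t \<Longrightarrow>
        st x t = ellop \<nu> Mc (H x t) x + \<beta> x \<bullet> G x t + \<gamma> x * u x t + f x t"
    and cont: "continuous_on (closure U \<times> {T..}) (\<lambda>(x,t). u x t)"
    and f: "\<And>x t. x \<in> U \<Longrightarrow> T < t \<Longrightarrow> \<bar>f x t\<bar> \<le> \<epsilon>"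
    and bd: "\<And>x t. x \<in> frontier U \<Longrightarrow> T < t \<Longrightarrow> \<bar>u x t\<bar> \<le> \<epsilon>"
    and init: "\<And>x. x \<in> closure U \<Longrightarrow> \<bar>u x T\<bar> \<le> \<mu>"
    and \<epsilon>: "\<epsilon> \<ge> 0" "\<mu> \<ge> 0" and x: "x \<in> closure U" and t: "T \<le> t"
  shows "\<bar>u x t\<bar> \<le> \<psi>1 / \<psi>0 * (\<mu> * exp (- \<eta> * (t - T)) + \<epsilon> * (1 + 1/\<eta>))"
proof (rule abs_leI)
  show "u x t \<le> \<psi>1 / \<psi>0 * (\<mu> * exp (- \<eta> * (t - T)) + \<epsilon> * (1 + 1/\<eta>))"
  proof (rule decay_upper_bound[where G = G and H = H and st = st and f = f, OF _ _ _ _ _ _ _ \<epsilon> x t])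
    show "f x t \<le> \<epsilon>" if "x \<in> U" "T < t" for x t using f[OF that] by simp
    show "u x t \<le> \<epsilon>" if "x \<in> frontier U" "T < t" for x t using bd[OF that] by simp
    show "u x T \<le> \<mu>" if "x \<in> closure U" for x using init[OF that] by simp
  qed (rule tw td pde cont; assumption)+
  show "- u x t \<le> \<psi>1 / \<psi>0 * (\<mu> * exp (- \<eta> * (t - T)) + \<epsilon> * (1 + 1/\<eta>))"
  proof (rule decay_upper_bound[where u = "\<lambda>x t. - u x t" and G = "\<lambda>x t. - G x t" and H = "\<lambda>x t. - H x t"
        and st = "\<lambda>x t. - st x t" and f = "\<lambda>x t. - f x t", OF _ _ _ _ _ _ _ \<epsilon> x t])
    show "twice_diff_on U (\<lambda>y. - u y t) (\<lambda>y. - G y t) (\<lambda>y. - H y t)" if "T < t" for t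
      by (rule twice_diff_on_uminus[OF tw[OF that]])
    show "((\<lambda>s. - u x s) has_real_derivative - st x t) (at t)" if "x \<in> U" "T < t" for x t
      by (rule DERIV_minus[OF td[OF that]])
    show "- st x t = ellop \<nu> Mc (- H x t) x + \<beta> x \<bullet> - G x t + \<gamma> x * - u x t + - f x t" if "x \<in> U" "T < t" for x t
      by (simp add: pde[OF that] ellop_uminus)
    show "continuous_on (closure U \<times> {T..}) (\<lambda>(x, t). - u x t)"
      using continuous_on_minus[OF cont] by (simp add: split_beta)
    show "- f x t \<le> \<epsilon>" if "x \<in> U" "T < t" for x t using f[OF that] by simp
    show "- u x t \<le> \<epsilon>" if "x \<in> frontier U" "T < t" for x t using bd[OF that] by simp
    show "- u x T \<le> \<mu>" if "x \<in> closure U" for x using init[OF that] by simp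
  qed
qed

end

section \<open>Functions with bounded gradient and divergence-form operators\<close>

text \<open>The gradient is asked to be bounded, not continuous: the class serves to bound the
  coefficients of the expanded operator and to make the fields \<open>Mc\<close> Lipschitz on
  balls.\<close>

definition C1_bounds :: "(real^'n::finite) set \<Rightarrow> (real^'n \<Rightarrow> real) \<Rightarrow> (real^'n \<Rightarrow> real^'n) \<Rightarrow> real \<Rightarrow> bool" where
  "C1_bounds U k v C \<longleftrightarrow> C \<ge> 0 \<and>
    (\<forall>x\<in>U. \<bar>k x\<bar> \<le> C \<and> (k has_derivative (\<lambda>h. v x \<bullet> h)) (at x) \<and> norm (v x) \<le> C)"

definition bC1_on :: "(real^'n::finite) set \<Rightarrow> (real^'n \<Rightarrow> real) \<Rightarrow> bool" where
  "bC1_on U k \<longleftrightarrow> (\<exists>v C. C1_bounds U k v C)"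

lemma C1_boundsD:
  assumes "C1_bounds U k v C"
  shows "C \<ge> 0" "x \<in> U \<Longrightarrow> \<bar>k x\<bar> \<le> C" "x \<in> U \<Longrightarrow> (k has_derivative (\<lambda>h. v x \<bullet> h)) (at x)"
    "x \<in> U \<Longrightarrow> norm (v x) \<le> C"
  using assms by (auto simp: C1_bounds_def)

lemma bC1_onE:
  assumes "bC1_on U k"
  obtains v C where "C1_bounds U k v C"
  using assms unfolding bC1_on_def by blast

lemma bC1_onI:
  assumes "\<And>x. x \<in> U \<Longrightarrow> \<bar>k x\<bar> \<le> C"
    "\<And>x. x \<in> U \<Longrightarrow> (k has_derivative (\<lambda>h. v x \<bullet> h)) (at x)" "\<And>x. x \<in> U \<Longrightarrow> norm (v x) \<le> C'"
  shows "bC1_on U k"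
proof -
  have "C1_bounds U k v (max 0 (max C C'))"
    unfolding C1_bounds_def using assms by (auto simp: le_max_iff_disj)
  then show ?thesis unfolding bC1_on_def by blast
qed

lemma bC1_on_const: "bC1_on U (\<lambda>x. a)"
  by (rule bC1_onI[where C = "\<bar>a\<bar>" and C' = 0 and v = "\<lambda>_. 0"]) auto

lemma bC1_on_nth:
  fixes U :: "(real^'n::finite) set"
  assumes "bounded U"
  shows "bC1_on U (\<lambda>x. x $ i)"
proof -
  obtain C where C: "\<And>x. x \<in> U \<Longrightarrow> norm x \<le> C" using assms unfolding bounded_iff by blast
  have "((\<lambda>x. x $ i) has_derivative (\<lambda>h. axis i 1 \<bullet> h)) (at x)" for x :: "real^'n"
    by (simp add: inner_axis' bounded_linear_vec_nth bounded_linear_imp_has_derivative)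
  moreover have "\<bar>x $ i\<bar> \<le> C" if "x \<in> U" for x
    using component_le_norm_cart[of x i] C[OF that] by simp
  ultimately show ?thesis
    by (intro bC1_onI[where C = C and C' = 1 and v = "\<lambda>_. axis i 1"]) auto
qed

lemma bC1_on_add:
  assumes "bC1_on U f" "bC1_on U g"
  shows "bC1_on U (\<lambda>x. f x + g x)"
proof -
  obtain v C where C: "C1_bounds U f v C" using assms(1) by (rule bC1_onE)
  note C = C1_boundsD[OF C]
  obtain v' C' where C': "C1_bounds U g v' C'" using assms(2) by (rule bC1_onE)
  note C' = C1_boundsD[OF C']
  show ?thesis
  proof (rule bC1_onI)
    fix x assume x: "x \<in> U"
    show "\<bar>f x + g x\<bar> \<le> C + C'" using C(2)[OF x] C'(2)[OF x] by linarith
    show "((\<lambda>x. f x + g x) has_derivative (\<lambda>h. (v x + v' x) \<bullet> h)) (at x)"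
      using has_derivative_add[OF C(3)[OF x] C'(3)[OF x]] by (simp add: inner_add_left)
    show "norm (v x + v' x) \<le> C + C'" using C(4)[OF x] C'(4)[OF x] norm_triangle_le add_mono by blast
  qed
qed

lemma bC1_on_mult:
  assumes "bC1_on U f" "bC1_on U g"
  shows "bC1_on U (\<lambda>x. f x * g x)"
proof -
  obtain v C where C: "C1_bounds U f v C" using assms(1) by (rule bC1_onE)
  note C = C1_boundsD[OF C]
  obtain v' C' where C': "C1_bounds U g v' C'" using assms(2) by (rule bC1_onE)
  note C' = C1_boundsD[OF C']
  show ?thesis
  proof (rule bC1_onI)
    fix x assume x: "x \<in> U"
    show "\<bar>f x * g x\<bar> \<le> C * C'"
      unfolding abs_mult using C(2)[OF x] C'(2)[OF x] C(1) by (intro mult_mono) auto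
    show "((\<lambda>x. f x * g x) has_derivative (\<lambda>h. (f x *\<^sub>R v' x + g x *\<^sub>R v x) \<bullet> h)) (at x)"
      using has_derivative_mult[OF C(3)[OF x] C'(3)[OF x]] by (simp add: inner_add_left mult.commute)
    have "norm (f x *\<^sub>R v' x) \<le> C * C'" "norm (g x *\<^sub>R v x) \<le> C' * C"
      unfolding norm_scaleR using C(2)[OF x] C'(2)[OF x] C'(4)[OF x] C(4)[OF x] C(1) C'(1) by (intro mult_mono; simp)+
    then show "norm (f x *\<^sub>R v' x + g x *\<^sub>R v x) \<le> C * C' + C' * C" using norm_triangle_le add_mono by blast
  qed
qed

lemma bC1_on_sum:
  assumes "\<And>i. i \<in> I \<Longrightarrow> bC1_on U (f i)"
  shows "bC1_on U (\<lambda>x. \<Sum>i\<in>I. f i x)"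
  using assms
  by (induction I rule: infinite_finite_induct) (auto intro: bC1_on_const bC1_on_add)

lemma bC1_on_cong:
  assumes "bC1_on U f" "open U" "\<And>x. x \<in> U \<Longrightarrow> f x = g x"
  shows "bC1_on U g"
proof -
  obtain v C where C: "C1_bounds U f v C" using assms(1) by (rule bC1_onE)
  note C = C1_boundsD[OF C]
  show ?thesis
  proof (rule bC1_onI)
    fix x assume x: "x \<in> U"
    show "(g has_derivative (\<lambda>h. v x \<bullet> h)) (at x)"
      by (rule has_derivative_transform_within_open[OF C(3)[OF x] assms(2) x assms(3)])
    show "\<bar>g x\<bar> \<le> C" "norm (v x) \<le> C" using C(2,4)[OF x] assms(3)[OF x] by auto
  qed
qed

text \<open>\<open>U\<close> need not be convex, so a gradient bound gives a Lipschitz bound only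
  inside convex subsets, later closed balls. One constant serves all of them.\<close>

lemma bC1_on_lipschitz:
  assumes "bC1_on U f"
  obtains L where "L \<ge> 0" "\<And>K x y. convex K \<Longrightarrow> K \<subseteq> U \<Longrightarrow> x \<in> K \<Longrightarrow> y \<in> K \<Longrightarrow> \<bar>f x - f y\<bar> \<le> L * dist x y"
proof -
  obtain v C where C: "C1_bounds U f v C" using assms(1) by (rule bC1_onE)
  note C = C1_boundsD[OF C]
  show thesis
  proof (rule that[OF C(1)])
    fix K x y assume K: "convex K" "K \<subseteq> U" "x \<in> K" "y \<in> K"
    have "norm (f x - f y) \<le> C * norm (x - y)"
    proof (rule differentiable_bound[OF K(1) _ _ K(3,4)])
      fix z assume "z \<in> K"
      then show "(f has_derivative (\<lambda>h. v z \<bullet> h)) (at z within K)"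
        using C(3) K(2) has_derivative_at_withinI by blast
      show "onorm (\<lambda>h. v z \<bullet> h) \<le> C"
      proof (rule onorm_bound[OF C(1)])
        fix h
        have "norm (v z \<bullet> h) \<le> norm (v z) * norm h" by (simp add: Cauchy_Schwarz_ineq2)
        also have "\<dots> \<le> C * norm h" using C(4)[of z] \<open>z \<in> K\<close> K(2) by (intro mult_right_mono) auto
        finally show "norm (v z \<bullet> h) \<le> C * norm h" .
      qed
    qed
    then show "\<bar>f x - f y\<bar> \<le> C * dist x y" by (simp add: dist_norm)
  qed
qed

section \<open>Partial derivatives and expansion of the divergence\<close>

lemma has_derivative_axis:
  assumes "(f has_derivative (\<lambda>h. v \<bullet> h)) (at x)"
  shows "((\<lambda>h. f (x + h *\<^sub>R axis i 1)) has_real_derivative v $ i) (at 0)"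
proof -
  have "((\<lambda>h. x + h *\<^sub>R axis i 1) has_derivative (\<lambda>h. h *\<^sub>R axis i 1)) (at 0)"
    by (auto intro!: derivative_eq_intros)
  from has_derivative_compose[OF this, of f "\<lambda>h. v \<bullet> h"]
  show ?thesis using assms
    by (intro has_derivative_imp_has_field_derivative) (auto simp: inner_axis)
qed

lemma has_derivative_pd: "(f has_derivative (\<lambda>h. v \<bullet> h)) (at x) \<Longrightarrow> pd i f x = v $ i"
  unfolding pd_def by (rule DERIV_imp_deriv[OF has_derivative_axis])

lemma has_pd_iff_deriv:
  "has_pd i f x \<longleftrightarrow> ((\<lambda>h. f (x + h *\<^sub>R axis i 1)) has_real_derivative pd i f x) (at 0)"
  unfolding has_pd_def pd_def by (simp add: DERIV_deriv_iff_real_differentiable)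

lemma bC1_on_pd:
  assumes "bC1_on U k"
  shows "x \<in> U \<Longrightarrow> has_pd i k x" "\<exists>C\<ge>0. \<forall>x\<in>U. \<bar>k x\<bar> \<le> C \<and> (\<forall>i. \<bar>pd i k x\<bar> \<le> C)"
proof -
  obtain v C where C: "C1_bounds U k v C" using assms(1) by (rule bC1_onE)
  note C = C1_boundsD[OF C]
  show "has_pd i k x" if "x \<in> U"
    using has_derivative_axis[OF C(3)[OF that]] unfolding has_pd_def real_differentiable_def by blast
  show "\<exists>C\<ge>0. \<forall>x\<in>U. \<bar>k x\<bar> \<le> C \<and> (\<forall>i. \<bar>pd i k x\<bar> \<le> C)"
  proof (intro exI[of _ C] conjI ballI allI)
    fix x i assume x: "x \<in> U"
    show "\<bar>k x\<bar> \<le> C" by (rule C(2)[OF x])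
    show "\<bar>pd i k x\<bar> \<le> C"
      using has_derivative_pd[OF C(3)[OF x], of i] component_le_norm_cart[of "v x" i] C(4)[OF x] by simp
  qed (fact C(1))
qed

lemma bC1_on_pd_uniform:
  fixes k :: "'a::finite \<Rightarrow> real^'n::finite \<Rightarrow> real"
  assumes "\<And>a. bC1_on U (k a)"
  obtains C where "C \<ge> 0" "\<And>a x. x \<in> U \<Longrightarrow> \<bar>k a x\<bar> \<le> C" "\<And>a x i. x \<in> U \<Longrightarrow> \<bar>pd i (k a) x\<bar> \<le> C"
proof -
  have "\<forall>a. \<exists>C\<ge>0. \<forall>x\<in>U. \<bar>k a x\<bar> \<le> C \<and> (\<forall>i. \<bar>pd i (k a) x\<bar> \<le> C)"
    using bC1_on_pd(2)[OF assms] by blast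
  then obtain C where C: "\<And>a. C a \<ge> 0" "\<And>a x. x \<in> U \<Longrightarrow> \<bar>k a x\<bar> \<le> C a" "\<And>a x i. x \<in> U \<Longrightarrow> \<bar>pd i (k a) x\<bar> \<le> C a"
    by metis
  have le: "C a \<le> (\<Sum>a\<in>UNIV. C a)" for a by (rule member_le_sum) (auto simp: C)
  show thesis
    by (rule that[of "\<Sum>a\<in>UNIV. C a"]) (auto intro: sum_nonneg C order_trans[OF _ le])
qed

lemma pd_cong:
  assumes "open U" "x \<in> U" "\<And>y. y \<in> U \<Longrightarrow> f y = g y"
  shows "pd i f x = pd i g x"
proof -
  obtain e where e: "e > 0" "\<And>r. \<bar>r\<bar> < e \<Longrightarrow> x + r *\<^sub>R axis i 1 \<in> U"
    using eventually_line_in_open[OF assms(1,2)] by metis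
  have "\<forall>\<^sub>F r in nhds 0. \<bar>r\<bar> < e" using e(1) by (auto simp: eventually_nhds_metric dist_real_def)
  then show ?thesis
    unfolding pd_def by (intro deriv_cong_ev) (auto elim!: eventually_mono simp: assms(3) e(2))
qed

lemma pd_sum_mult:
  assumes "\<And>j. has_pd i (f j) x" "\<And>j. has_pd i (g j) x"
  shows "pd i (\<lambda>y. \<Sum>j\<in>(UNIV::'a::finite set). f j y * g j y) x
    = (\<Sum>j\<in>UNIV. pd i (f j) x * g j x + f j x * pd i (g j) x)"
  unfolding pd_def[of i "\<lambda>y. \<Sum>j\<in>UNIV. f j y * g j y"]
proof (rule DERIV_imp_deriv)
  show "((\<lambda>h. \<Sum>j\<in>(UNIV::'a set). f j (x + h *\<^sub>R axis i 1) * g j (x + h *\<^sub>R axis i 1)) has_real_derivative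
      (\<Sum>j\<in>UNIV. pd i (f j) x * g j x + f j x * pd i (g j) x)) (at 0)"
  proof (rule DERIV_sum)
    fix j
    show "((\<lambda>h. f j (x + h *\<^sub>R axis i 1) * g j (x + h *\<^sub>R axis i 1)) has_real_derivative
      pd i (f j) x * g j x + f j x * pd i (g j) x) (at 0)"
      using DERIV_mult[OF assms[of j, unfolded has_pd_iff_deriv]] by (simp add: algebra_simps)
  qed
qed

lemma ellop_eq:
  assumes "\<And>i j. M $ i $ j = (if i = j then \<nu> else 0) + (\<Sum>k\<in>UNIV. Mc k x $ i * Mc k x $ j)"
  shows "(\<Sum>i\<in>UNIV. \<Sum>j\<in>UNIV. M $ i $ j * H $ j $ i) = ellop \<nu> Mc H x"
proof -
  have "(\<Sum>i\<in>UNIV. \<Sum>j\<in>UNIV. M $ i $ j * H $ j $ i)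
     = (\<Sum>i\<in>UNIV. \<Sum>j\<in>UNIV. (if i = j then \<nu> * H $ j $ i else 0)) +
       (\<Sum>i\<in>UNIV. \<Sum>j\<in>UNIV. \<Sum>k\<in>UNIV. Mc k x $ i * Mc k x $ j * H $ j $ i)"
    unfolding sum.distrib[symmetric]
    by (intro sum.cong refl) (simp add: assms distrib_right sum_distrib_right)
  also have "(\<Sum>i\<in>UNIV. \<Sum>j\<in>UNIV. (if i = j then \<nu> * H $ j $ i else 0)) = \<nu> * (\<Sum>k\<in>UNIV. H $ k $ k)"
    by (simp add: sum_distrib_left)
  also have "(\<Sum>i\<in>UNIV. \<Sum>j\<in>UNIV. \<Sum>k\<in>UNIV. Mc k x $ i * Mc k x $ j * H $ j $ i)
      = (\<Sum>i\<in>UNIV. \<Sum>k\<in>UNIV. \<Sum>j\<in>UNIV. Mc k x $ i * Mc k x $ j * H $ j $ i)"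
    by (intro sum.cong refl sum.swap)
  also have "\<dots> = (\<Sum>k\<in>UNIV. \<Sum>i\<in>UNIV. \<Sum>j\<in>UNIV. Mc k x $ i * Mc k x $ j * H $ j $ i)"
    by (rule sum.swap)
  also have "\<dots> = (\<Sum>k\<in>UNIV. Mc k x \<bullet> (H *v Mc k x))"
    by (intro sum.cong refl, subst sum.swap)
      (simp add: inner_vec_def matrix_vector_mult_def sum_distrib_left mult_ac)
  finally show ?thesis by (simp add: ellop_def)
qed

text \<open>The coefficients are \<open>\<beta>\<^sub>k = \<Sum>\<^sub>i \<partial>\<^sub>i
  A\<^sub>i\<^sub>k - (A b)\<^sub>k\<close> and \<open>\<gamma> = - div (A b)\<close>. They are
  fixed before the function \<open>s\<close>, so the solution at every time and the barrier obey one
  and the same expanded operator.\<close>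

lemma divergence_form_expand:
  fixes A :: "real^'n::finite \<Rightarrow> real^'n^'n" and b :: "real^'n \<Rightarrow> real^'n"
  assumes A: "\<And>i j. bC1_on U (\<lambda>y. A y $ i $ j)" and b: "\<And>j. bC1_on U (\<lambda>y. b y $ j)"
  obtains \<beta> \<gamma> C where "C \<ge> 0" "\<And>x. x \<in> U \<Longrightarrow> norm (\<beta> x) \<le> C" "\<And>x. x \<in> U \<Longrightarrow> \<bar>\<gamma> x\<bar> \<le> C"
    "\<And>x s G H. x \<in> U \<Longrightarrow> twice_diff_on U s G H \<Longrightarrow>
      (\<Sum>i\<in>UNIV. pd i (\<lambda>y. (A y *v (G y - s y *\<^sub>R b y)) $ i) x)
       = (\<Sum>i\<in>UNIV. \<Sum>j\<in>UNIV. A x $ i $ j * H x $ j $ i) + \<beta> x \<bullet> G x + \<gamma> x * s x"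
proof -
  obtain CA where CA: "CA \<ge> 0" "\<And>i j x. x \<in> U \<Longrightarrow> \<bar>A x $ i $ j\<bar> \<le> CA"
     "\<And>i j k x. x \<in> U \<Longrightarrow> \<bar>pd k (\<lambda>y. A y $ i $ j) x\<bar> \<le> CA"
    using bC1_on_pd_uniform[of U "\<lambda>p y. A y $ fst p $ snd p"] A by (metis fst_conv snd_conv)
  obtain Cb where Cb: "Cb \<ge> 0" "\<And>j x. x \<in> U \<Longrightarrow> \<bar>b x $ j\<bar> \<le> Cb"
     "\<And>j k x. x \<in> U \<Longrightarrow> \<bar>pd k (\<lambda>y. b y $ j) x\<bar> \<le> Cb"
    using bC1_on_pd_uniform[of U "\<lambda>j y. b y $ j"] b by metis
  define n where "n = real CARD('n)"
  define \<beta> where "\<beta> x = (\<chi> k. (\<Sum>i\<in>UNIV. pd i (\<lambda>y. A y $ i $ k) x) - (\<Sum>j\<in>UNIV. A x $ k $ j * b x $ j))" for x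
  define \<gamma> where "\<gamma> x = - (\<Sum>i\<in>UNIV. \<Sum>j\<in>UNIV. pd i (\<lambda>y. A y $ i $ j) x * b x $ j + A x $ i $ j * pd i (\<lambda>y. b y $ j) x)" for x
  have bs: "\<bar>sum f UNIV\<bar> \<le> n * K" if "\<And>j. \<bar>f j\<bar> \<le> K" for f :: "'n \<Rightarrow> real" and K
    unfolding n_def by (rule order_trans[OF sum_abs]) (rule sum_bounded_above, rule that)
  have prod: "\<bar>u * v\<bar> \<le> CA * Cb" if "\<bar>u\<bar> \<le> CA" "\<bar>v\<bar> \<le> Cb" for u v :: real
    unfolding abs_mult using that CA(1) by (intro mult_mono) auto
  show thesis
  proof (rule that)
    show "0 \<le> n * (n * CA + n * (CA * Cb)) + n * (n * (CA * Cb + CA * Cb))"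
      using CA(1) Cb(1) by (simp add: n_def)
    fix x assume x: "x \<in> U"
    have "\<bar>\<beta> x $ k\<bar> \<le> n * CA + n * (CA * Cb)" for k
    proof -
      have "\<bar>\<Sum>i\<in>UNIV. pd i (\<lambda>y. A y $ i $ k) x\<bar> \<le> n * CA" by (rule bs) (rule CA(3)[OF x])
      moreover have "\<bar>\<Sum>j\<in>UNIV. A x $ k $ j * b x $ j\<bar> \<le> n * (CA * Cb)"
        by (rule bs) (intro prod CA(2)[OF x] Cb(2)[OF x])
      ultimately show ?thesis by (simp add: \<beta>_def)
    qed
    then have "(\<Sum>k\<in>UNIV. \<bar>\<beta> x $ k\<bar>) \<le> n * (n * CA + n * (CA * Cb))"
      unfolding n_def by (intro sum_bounded_above)
    then have "norm (\<beta> x) \<le> n * (n * CA + n * (CA * Cb))"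
      using norm_le_l1_cart[of "\<beta> x"] by linarith
    moreover have g: "\<bar>\<gamma> x\<bar> \<le> n * (n * (CA * Cb + CA * Cb))"
      unfolding \<gamma>_def abs_minus_cancel
      by (intro bs order_trans[OF abs_triangle_ineq] add_mono prod CA(2,3)[OF x] Cb(2,3)[OF x])
    moreover have "0 \<le> n * (n * CA + n * (CA * Cb))" "0 \<le> n * (n * (CA * Cb + CA * Cb))"
      using CA(1) Cb(1) by (auto simp: n_def)
    ultimately show "norm (\<beta> x) \<le> n * (n * CA + n * (CA * Cb)) + n * (n * (CA * Cb + CA * Cb))"
      "\<bar>\<gamma> x\<bar> \<le> n * (n * CA + n * (CA * Cb)) + n * (n * (CA * Cb + CA * Cb))" by linarith+
    fix s G H assume tw: "twice_diff_on U s G H"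
    note d = twice_diff_onD[OF tw x]
    have hA: "has_pd k (\<lambda>y. A y $ i $ j) x" for i j k by (rule bC1_on_pd(1)[OF A x])
    have hb: "has_pd k (\<lambda>y. b y $ j) x" for j k by (rule bC1_on_pd(1)[OF b x])
    have hs: "((\<lambda>h. s (x + h *\<^sub>R axis i 1)) has_real_derivative G x $ i) (at 0)" for i
      by (rule has_derivative_axis[OF d(1)])
    have "((\<lambda>y. G y $ j) has_derivative (\<lambda>h. (H x *v h) $ j)) (at x)" for j
      by (rule bounded_linear.has_derivative[OF bounded_linear_vec_nth d(2)])
    then have "((\<lambda>y. G y $ j) has_derivative (\<lambda>h. H x $ j \<bullet> h)) (at x)" for j
      by (simp add: matrix_vector_mul_component)
    then have hG: "((\<lambda>h. G (x + h *\<^sub>R axis i 1) $ j) has_real_derivative H x $ j $ i) (at 0)" for i j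
      by (rule has_derivative_axis)
    have hF: "((\<lambda>h. G (x + h *\<^sub>R axis i 1) $ j - s (x + h *\<^sub>R axis i 1) * b (x + h *\<^sub>R axis i 1) $ j) has_real_derivative
        H x $ j $ i - (G x $ i * b x $ j + s x * pd i (\<lambda>y. b y $ j) x)) (at 0)" for i j
      using DERIV_diff[OF hG DERIV_mult[OF hs hb[unfolded has_pd_iff_deriv]]] by (simp add: algebra_simps)
    then have pF: "has_pd i (\<lambda>y. G y $ j - s y * b y $ j) x"
      "pd i (\<lambda>y. G y $ j - s y * b y $ j) x = H x $ j $ i - (G x $ i * b x $ j + s x * pd i (\<lambda>y. b y $ j) x)" for i j
      unfolding has_pd_def real_differentiable_def pd_def[of _ "\<lambda>y. G y $ j - s y * b y $ j"]
      by (blast, intro DERIV_imp_deriv)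
    have "(\<Sum>i\<in>UNIV. pd i (\<lambda>y. (A y *v (G y - s y *\<^sub>R b y)) $ i) x)
      = (\<Sum>i\<in>UNIV. \<Sum>j\<in>UNIV. pd i (\<lambda>y. A y $ i $ j) x * (G x $ j - s x * b x $ j) +
           A x $ i $ j * (H x $ j $ i - (G x $ i * b x $ j + s x * pd i (\<lambda>y. b y $ j) x)))"
    proof (rule sum.cong[OF refl])
      fix i
      have "(\<lambda>y. (A y *v (G y - s y *\<^sub>R b y)) $ i) = (\<lambda>y. \<Sum>j\<in>UNIV. A y $ i $ j * (G y $ j - s y * b y $ j))"
        by (simp add: matrix_vector_mult_def)
      then show "pd i (\<lambda>y. (A y *v (G y - s y *\<^sub>R b y)) $ i) x = (\<Sum>j\<in>UNIV. pd i (\<lambda>y. A y $ i $ j) x * (G x $ j - s x * b x $ j) +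
           A x $ i $ j * (H x $ j $ i - (G x $ i * b x $ j + s x * pd i (\<lambda>y. b y $ j) x)))"
        by (simp add: pd_sum_mult hA pF)
    qed
    also have "\<dots> = (\<Sum>i\<in>UNIV. \<Sum>j\<in>UNIV. A x $ i $ j * H x $ j $ i)
       + ((\<Sum>i\<in>UNIV. \<Sum>j\<in>UNIV. pd i (\<lambda>y. A y $ i $ j) x * G x $ j) - (\<Sum>i\<in>UNIV. \<Sum>j\<in>UNIV. A x $ i $ j * b x $ j * G x $ i))
       + - (\<Sum>i\<in>UNIV. \<Sum>j\<in>UNIV. pd i (\<lambda>y. A y $ i $ j) x * b x $ j + A x $ i $ j * pd i (\<lambda>y. b y $ j) x) * s x"
      by (simp add: sum.distrib sum_subtractf sum_distrib_right sum_distrib_left algebra_simps)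
    also have "(\<Sum>i\<in>UNIV. \<Sum>j\<in>UNIV. pd i (\<lambda>y. A y $ i $ j) x * G x $ j) = (\<Sum>j\<in>UNIV. (\<Sum>i\<in>UNIV. pd i (\<lambda>y. A y $ i $ j) x) * G x $ j)"
      by (subst sum.swap) (simp add: sum_distrib_right)
    also have "\<dots> - (\<Sum>i\<in>UNIV. \<Sum>j\<in>UNIV. A x $ i $ j * b x $ j * G x $ i) = \<beta> x \<bullet> G x"
      by (simp add: \<beta>_def inner_vec_def left_diff_distrib sum_subtractf sum_distrib_right)
    finally show "(\<Sum>i\<in>UNIV. pd i (\<lambda>y. (A y *v (G y - s y *\<^sub>R b y)) $ i) x)
       = (\<Sum>i\<in>UNIV. \<Sum>j\<in>UNIV. A x $ i $ j * H x $ j $ i) + \<beta> x \<bullet> G x + \<gamma> x * s x"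
      by (simp add: \<gamma>_def)
  qed
qed

section \<open>Radial functions and matrices\<close>

text \<open>Derivatives are taken within the closed segment, one-sided at its ends, because the
  profile \<open>Shat\<close> is differentiable only in this sense there. Compactness then bounds
  the function and its derivative.\<close>

definition C1_seg :: "real \<Rightarrow> real \<Rightarrow> (real \<Rightarrow> real) \<Rightarrow> bool" where
  "C1_seg a b p \<longleftrightarrow> (\<exists>p'. continuous_on {a..b} p' \<and> (\<forall>r\<in>{a..b}. (p has_real_derivative p' r) (at r within {a..b})))"

lemma C1_segI:
  assumes "continuous_on {a..b} p'" "\<And>r. r \<in> {a..b} \<Longrightarrow> (p has_real_derivative p' r) (at r within {a..b})"
  shows "C1_seg a b p"
  using assms unfolding C1_seg_def by blast

lemma C1_segE:
  assumes "C1_seg a b p"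
  obtains p' where "continuous_on {a..b} p'" "\<And>r. r \<in> {a..b} \<Longrightarrow> (p has_real_derivative p' r) (at r within {a..b})"
  using assms unfolding C1_seg_def by blast

lemma C1_seg_continuous: "C1_seg a b p \<Longrightarrow> continuous_on {a..b} p"
  by (meson C1_segE DERIV_continuous_on)

lemma C1_seg_const: "C1_seg a b (\<lambda>r. k)"
  by (rule C1_segI[where p' = "\<lambda>_. 0"]) auto

lemma C1_seg_id: "C1_seg a b (\<lambda>r. r)"
  by (rule C1_segI[where p' = "\<lambda>_. 1"]) auto

lemma C1_seg_add:
  assumes "C1_seg a b p" "C1_seg a b q"
  shows "C1_seg a b (\<lambda>r. p r + q r)"
proof -
  obtain p' where p: "continuous_on {a..b} p'" "\<And>r. r \<in> {a..b} \<Longrightarrow> (p has_real_derivative p' r) (at r within {a..b})"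
    using assms(1) by (rule C1_segE) blast
  obtain q' where q: "continuous_on {a..b} q'" "\<And>r. r \<in> {a..b} \<Longrightarrow> (q has_real_derivative q' r) (at r within {a..b})"
    using assms(2) by (rule C1_segE) blast
  show ?thesis
    by (rule C1_segI[where p' = "\<lambda>r. p' r + q' r"]) (auto intro!: continuous_intros DERIV_add p q)
qed

lemma C1_seg_mult:
  assumes "C1_seg a b p" "C1_seg a b q"
  shows "C1_seg a b (\<lambda>r. p r * q r)"
proof -
  obtain p' where p: "continuous_on {a..b} p'" "\<And>r. r \<in> {a..b} \<Longrightarrow> (p has_real_derivative p' r) (at r within {a..b})"
    using assms(1) by (rule C1_segE) blast
  obtain q' where q: "continuous_on {a..b} q'" "\<And>r. r \<in> {a..b} \<Longrightarrow> (q has_real_derivative q' r) (at r within {a..b})"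
    using assms(2) by (rule C1_segE) blast
  have "continuous_on {a..b} (\<lambda>r. p' r * q r + q' r * p r)"
    by (intro continuous_intros p q C1_seg_continuous assms)
  then show ?thesis by (rule C1_segI) (intro DERIV_mult p q)
qed

lemma C1_seg_compose:
  assumes p: "C1_seg a b p" and S: "\<And>r. r \<in> {a..b} \<Longrightarrow> p r \<in> S"
    and f: "\<And>y. y \<in> S \<Longrightarrow> (f has_real_derivative f' y) (at y)" "continuous_on S f'"
  shows "C1_seg a b (\<lambda>r. f (p r))"
proof -
  obtain p' where p': "continuous_on {a..b} p'" "\<And>r. r \<in> {a..b} \<Longrightarrow> (p has_real_derivative p' r) (at r within {a..b})"
    using p by (rule C1_segE) blast
  have "continuous_on {a..b} (\<lambda>r. f' (p r))"
    by (rule continuous_on_compose2[OF f(2) C1_seg_continuous[OF p]]) (use S in auto)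
  then show ?thesis
    by (intro C1_segI[where p' = "\<lambda>r. f' (p r) * p' r"])
      (auto intro!: continuous_intros p' DERIV_chain2[OF f(1)[OF S] p'(2)])
qed

lemma C1_seg_inverse:
  assumes "C1_seg a b p" "\<And>r. r \<in> {a..b} \<Longrightarrow> p r > 0"
  shows "C1_seg a b (\<lambda>r. 1 / p r)"
  by (rule C1_seg_compose[OF assms(1), where S = "{0<..}" and f' = "\<lambda>y. - 1 / y\<^sup>2"])
    (auto simp: assms(2) power2_eq_square intro!: derivative_eq_intros continuous_intros)

lemma C1_seg_divide:
  assumes "C1_seg a b p" "C1_seg a b q" "\<And>r. r \<in> {a..b} \<Longrightarrow> q r > 0"
  shows "C1_seg a b (\<lambda>r. p r / q r)"
  using C1_seg_mult[OF assms(1) C1_seg_inverse[OF assms(2,3)]] by simp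

lemma C1_seg_diff:
  assumes "C1_seg a b p" "C1_seg a b q"
  shows "C1_seg a b (\<lambda>r. p r - q r)"
  using C1_seg_add[OF assms(1) C1_seg_mult[OF C1_seg_const[of a b "-1"] assms(2)]] by simp

lemma C1_seg_sqrt:
  assumes "C1_seg a b p" "\<And>r. r \<in> {a..b} \<Longrightarrow> p r > 0"
  shows "C1_seg a b (\<lambda>r. sqrt (p r))"
  by (rule C1_seg_compose[OF assms(1), where S = "{0<..}" and f' = "\<lambda>y. inverse (sqrt y) / 2"])
    (auto simp: assms(2) intro!: DERIV_real_sqrt continuous_intros)

lemma C1_seg_exp:
  assumes "C1_seg a b p"
  shows "C1_seg a b (\<lambda>r. exp (p r))"
  by (rule C1_seg_compose[OF assms, where S = UNIV and f' = exp]) (auto intro!: continuous_intros)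

lemma C1_seg_powr:
  assumes "C1_seg a b p" "\<And>r. r \<in> {a..b} \<Longrightarrow> p r > 0"
  shows "C1_seg a b (\<lambda>r. p r powr k)"
  by (rule C1_seg_compose[OF assms(1), where S = "{0<..}" and f' = "\<lambda>y. k * y powr (k - 1)"])
    (auto simp: assms(2) intro!: has_real_derivative_powr continuous_intros)

lemma C1_seg_integral:
  assumes "continuous_on {a..b} g"
  shows "C1_seg a b (\<lambda>r. integral {a..r} g)"
  by (rule C1_segI[OF assms]) (rule integral_has_real_derivative[OF assms])

lemma radial_has_derivative:
  fixes x :: "'a::real_inner"
  assumes p: "(p has_real_derivative p') (at (norm x))" and x: "x \<noteq> 0"
  shows "((\<lambda>y. p (norm y)) has_derivative (\<lambda>h. ((p' / norm x) *\<^sub>R x) \<bullet> h)) (at x)"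
proof -
  have "(norm has_derivative (\<lambda>h. h \<bullet> sgn x)) (at x)" by (rule has_derivative_norm[OF x])
  from has_derivative_compose[OF this, of p "\<lambda>h. p' * h"]
  have "((\<lambda>y. p (norm y)) has_derivative (\<lambda>h. p' * (h \<bullet> sgn x))) (at x)"
    using p by (simp add: has_field_derivative_def)
  moreover have "p' * (h \<bullet> sgn x) = ((p' / norm x) *\<^sub>R x) \<bullet> h" for h
    by (simp add: sgn_div_norm inner_commute divide_inverse)
  ultimately show ?thesis by simp
qed

lemma C1_seg_at_interior:
  assumes "(p has_real_derivative d) (at r within {a..b})" "a < r" "r < b"
  shows "(p has_real_derivative d) (at r)"
  using assms at_within_Icc_at[of a r b] by simp

lemma C1_seg_bC1_on:
  assumes p: "C1_seg a b p" and U: "U \<subseteq> ball 0 b - cball 0 a" and a: "a > 0"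
  shows "bC1_on U (\<lambda>x. p (norm x))"
proof -
  obtain p' where p': "continuous_on {a..b} p'" "\<And>r. r \<in> {a..b} \<Longrightarrow> (p has_real_derivative p' r) (at r within {a..b})"
    using p by (rule C1_segE) blast
  have bdd: "\<exists>C. \<forall>r\<in>{a..b}. \<bar>f r\<bar> \<le> C" if "continuous_on {a..b} f" for f :: "real \<Rightarrow> real"
    using compact_continuous_image[OF that compact_Icc] compact_imp_bounded bounded_iff
    by (metis image_eqI real_norm_def)
  obtain C where C: "\<forall>r\<in>{a..b}. \<bar>p r\<bar> \<le> C" using bdd[OF C1_seg_continuous[OF p]] by blast
  obtain C' where C': "\<forall>r\<in>{a..b}. \<bar>p' r\<bar> \<le> C'" using bdd[OF p'(1)] by blast
  show ?thesis
  proof (rule bC1_onI)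
    fix x assume "x \<in> U"
    then have x: "a < norm x" "norm x < b" using U by auto
    show "\<bar>p (norm x)\<bar> \<le> C" using C x by simp
    have "x \<noteq> 0" using x a by auto
    then show "((\<lambda>x. p (norm x)) has_derivative (\<lambda>h. ((p' (norm x) / norm x) *\<^sub>R x) \<bullet> h)) (at x)"
      using x by (intro radial_has_derivative C1_seg_at_interior[OF p'(2)]) auto
    show "norm ((p' (norm x) / norm x) *\<^sub>R x) \<le> C'" using C' x \<open>x \<noteq> 0\<close> by simp
  qed
qed

text \<open>The Hessian of the barrier is never computed. Its existence suffices, since the
  supersolution inequality is verified on the flux in divergence form.\<close>

lemma twice_diff_on_of_bC1_on:
  assumes "\<And>x. x \<in> U \<Longrightarrow> (s has_derivative (\<lambda>h. G x \<bullet> h)) (at x)" "\<And>j. bC1_on U (\<lambda>x. G x $ j)"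
  obtains H where "twice_diff_on U s G H"
proof -
  have "\<forall>j. \<exists>v. \<forall>x\<in>U. ((\<lambda>x. G x $ j) has_derivative (\<lambda>h. v x \<bullet> h)) (at x)"
    using assms(2) by (meson bC1_onE C1_boundsD(3))
  then obtain v where v: "\<And>j x. x \<in> U \<Longrightarrow> ((\<lambda>x. G x $ j) has_derivative (\<lambda>h. v j x \<bullet> h)) (at x)"
    by metis
  show thesis
  proof (rule that[of "\<lambda>x. \<chi> j. v j x"], unfold twice_diff_on_def, intro ballI conjI)
    fix x assume x: "x \<in> U"
    show "(s has_derivative (\<lambda>h. G x \<bullet> h)) (at x)" by (rule assms(1)[OF x])
    have "(G has_derivative (\<lambda>h. \<chi> j. v j x \<bullet> h)) (at x)"
      by (subst has_derivative_componentwise_within)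
         (use v[OF x] in \<open>auto simp: Basis_vec_def inner_axis\<close>)
    then show "(G has_derivative (\<lambda>h. (\<chi> j. v j x) *v h)) (at x)"
      by (simp add: matrix_vector_mult_def inner_vec_def)
  qed
qed

section \<open>Matrices of the form identity plus rank one\<close>

text \<open>The eigenvalue along \<open>x\<close> is \<open>p + m * (norm x)\<^sup>2\<close>,
  orthogonal to \<open>x\<close> it is \<open>p\<close>. For fixed \<open>x\<close> these matrices
  form a commutative algebra, so sums, products, inverses and square roots reduce to the two
  eigenvalues.\<close>

definition radmat :: "real \<Rightarrow> real \<Rightarrow> real^'n::finite \<Rightarrow> real^'n^'n" where
  "radmat p m x = p *\<^sub>R mat 1 + m *\<^sub>R (\<chi> i j. x $ i * x $ j)"

lemma radmat_nth: "radmat p m x $ i $ j = (if i = j then p else 0) + m * (x $ i * x $ j)"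
  by (simp add: radmat_def mat_def)

lemma radmat_vec: "radmat p m x *v y = p *\<^sub>R y + (m * (x \<bullet> y)) *\<^sub>R x"
proof -
  have "(\<chi> i j. x $ i * x $ j) *v y = (x \<bullet> y) *\<^sub>R x"
    by (simp add: vec_eq_iff matrix_vector_mult_def inner_vec_def sum_distrib_left mult_ac)
  then show ?thesis
    by (simp add: radmat_def matrix_vector_mult_add_rdistrib scaleR_matrix_vector_assoc[symmetric])
qed

lemma radmat_self: "radmat p m x *v x = (p + m * (norm x)\<^sup>2) *\<^sub>R x"
  by (simp add: radmat_vec power2_norm_eq_inner algebra_simps)

lemma radmat_mult:
  "radmat p m x ** radmat p' m' x = radmat (p * p') (p * m' + m * p' + m * m' * (norm x)\<^sup>2) x"
proof (subst matrix_eq, intro allI)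
  fix y
  show "(radmat p m x ** radmat p' m' x) *v y = radmat (p * p') (p * m' + m * p' + m * m' * (norm x)\<^sup>2) x *v y"
    unfolding matrix_vector_mul_assoc[symmetric] radmat_vec
    by (simp add: inner_add_right power2_norm_eq_inner algebra_simps)
qed

lemma matrix_inv_eqI:
  fixes M N :: "real^'n::finite^'n"
  assumes "M ** N = mat 1" "N ** M = mat 1"
  shows "matrix_inv M = N"
proof -
  have "M ** matrix_inv M = mat 1"
    unfolding matrix_inv_def using assms by (metis (mono_tags, lifting) someI_ex)
  then show ?thesis by (metis assms(2) matrix_mul_assoc matrix_mul_lid matrix_mul_rid)
qed

text \<open>Both eigenvalues are inverted; the new rank-one coefficient is their difference divided
  by \<open>(norm x)\<^sup>2\<close>.\<close>

lemma radmat_inverse: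
  assumes "x \<noteq> 0" "p \<noteq> 0" "p + m * (norm x)\<^sup>2 \<noteq> 0"
  shows "matrix_inv (radmat p m x) = radmat (1 / p) ((1 / (p + m * (norm x)\<^sup>2) - 1 / p) / (norm x)\<^sup>2) x"
proof (rule matrix_inv_eqI)
  define N where "N = (norm x)\<^sup>2"
  have N: "N \<noteq> 0" "p + m * N \<noteq> 0" using assms by (auto simp: N_def)
  let ?m' = "(1 / (p + m * N) - 1 / p) / N"
  have z: "p * ?m' + m * (1 / p) + m * ?m' * N = 0"
  proof -
    have "?m' * (p + m * N) = (1 - (p + m * N) / p) / N" using N by (simp add: left_diff_distrib)
    also have "1 - (p + m * N) / p = - (m / p) * N" using assms(2) by (simp add: field_simps)
    finally have "?m' * (p + m * N) = - (m / p)" using N by simp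
    then have "?m' * (p + m * N) + m / p = 0" by linarith
    moreover have "p * X + m * (1 / p) + m * X * N = X * (p + m * N) + m / p" for X
      by (simp add: algebra_simps)
    ultimately show ?thesis by metis
  qed
  then have z': "(1 / p) * m + ?m' * p + ?m' * m * N = 0" by (simp add: mult_ac add_ac)
  have I: "radmat 1 0 x = mat 1" by (simp add: radmat_def)
  show "radmat p m x ** radmat (1 / p) ((1 / (p + m * (norm x)\<^sup>2) - 1 / p) / (norm x)\<^sup>2) x = mat 1"
    unfolding radmat_mult N_def[symmetric] z using assms(2) I by simp
  show "radmat (1 / p) ((1 / (p + m * (norm x)\<^sup>2) - 1 / p) / (norm x)\<^sup>2) x ** radmat p m x = mat 1"
    unfolding radmat_mult N_def[symmetric] z' using assms(2) I by simp
qed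

lemma radmat_bC1_on:
  fixes U :: "(real^'n::finite) set"
  assumes "C1_seg a b p" "C1_seg a b m" "U \<subseteq> ball 0 b - cball 0 a" "a > 0"
  shows "bC1_on U (\<lambda>x. radmat (p (norm x)) (m (norm x)) x $ i $ j)"
proof -
  have "bounded U" using assms(3) bounded_ball bounded_subset by blast
  then show ?thesis
    unfolding radmat_nth
    by (cases "i = j") (simp_all add: bC1_on_add bC1_on_mult bC1_on_const bC1_on_nth
        C1_seg_bC1_on[OF assms(1,3,4)] C1_seg_bC1_on[OF assms(2-4)])
qed

section \<open>The functions g along the radius\<close>

lemma gcoef_exponent_pos:
  assumes "gcoef a \<alpha> N" "j \<in> {1..N}"
  shows "\<alpha> j > 0"
proof -
  have "1 \<le> j \<Longrightarrow> j \<le> N \<Longrightarrow> \<alpha> j > 0" for j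
  proof (induction j rule: dec_induct)
    case base
    then show ?case using assms(1) by (simp add: gcoef_def)
  next
    case (step k)
    then have "\<alpha> k < \<alpha> (Suc k)" using assms(1) by (simp add: gcoef_def)
    then show ?case using step by simp
  qed
  then show ?thesis using assms(2) by simp
qed

lemma gfun_mono:
  assumes "\<And>j. j \<in> {1..N} \<Longrightarrow> a j \<ge> 0" "\<And>j. j \<in> {1..N} \<Longrightarrow> \<alpha> j > 0" "0 \<le> s" "s \<le> s'"
  shows "gfun a \<alpha> N s \<le> gfun a \<alpha> N s'"
  unfolding gfun_def using assms by (intro add_left_mono sum_mono mult_left_mono powr_mono2) (auto intro: less_imp_le)

text \<open>The product \<open>s * g'(s)\<close> is again a generalised polynomial, with constant
  term 0, so monotonicity and smoothness of \<open>gfun\<close> apply to it as well. At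
  \<open>s = 0\<close> both sides vanish, since \<open>0 powr x = 0\<close>.\<close>

lemma gder_mult_self:
  assumes "s \<ge> 0"
  shows "gder a \<alpha> N s * s = gfun (\<lambda>j. if j = 0 then 0 else a j * \<alpha> j) \<alpha> N s"
proof -
  have "s powr (x - 1) * s = s powr x" for x
    using assms by (cases "s = 0") (auto simp: powr_diff)
  then show ?thesis by (simp add: gder_def gfun_def sum_distrib_right mult.assoc)
qed

text \<open>Powers with exponent below 1 are not differentiable at 0. For
  \<open>c \<noteq> 0\<close> the argument stays positive on the segment, and for
  \<open>c = 0\<close> the function is constant.\<close>

lemma gfun_C1_seg:
  assumes "a0 > 0"
  shows "C1_seg a0 b (\<lambda>r. gfun a \<alpha> N (\<bar>c\<bar> * r powr k))"
proof (cases "c = 0")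
  case True
  then show ?thesis by (simp add: C1_seg_const)
next
  case False
  have d: "(gfun a \<alpha> N has_real_derivative gder a \<alpha> N y) (at y)" if "y > 0" for y
    unfolding gfun_def gder_def using that
    by (auto intro!: derivative_eq_intros sum.cong)
  show ?thesis
  proof (rule C1_seg_compose[where p = "\<lambda>r. \<bar>c\<bar> * r powr k" and f = "gfun a \<alpha> N" and S = "{0<..}" and f' = "gder a \<alpha> N"])
    show "C1_seg a0 b (\<lambda>r. \<bar>c\<bar> * r powr k)"
      using assms by (intro C1_seg_mult C1_seg_const C1_seg_powr C1_seg_id) auto
    show "continuous_on {0<..} (gder a \<alpha> N)"
      unfolding gder_def by (intro continuous_intros) auto
  qed (use d False assms in auto)
qed

section \<open>The linear parabolic problem\<close>

lemma norm_matrix_vector_le: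
  fixes M :: "real^'n::finite^'n"
  assumes "\<And>i j. \<bar>M $ i $ j\<bar> \<le> C"
  shows "norm (M *v y) \<le> (real CARD('n))\<^sup>2 * C * norm y"
proof -
  have "C \<ge> 0" using assms[of undefined undefined] by linarith
  have "\<bar>(M *v y) $ i\<bar> \<le> real CARD('n) * (C * norm y)" for i
  proof -
    have "\<bar>(M *v y) $ i\<bar> \<le> (\<Sum>j\<in>UNIV. \<bar>M $ i $ j * y $ j\<bar>)"
      unfolding matrix_vector_mult_def by simp
    also have "\<dots> \<le> real CARD('n) * (C * norm y)"
    proof (rule sum_bounded_above)
      show "\<bar>M $ i $ j * y $ j\<bar> \<le> C * norm y" for j
        unfolding abs_mult using assms \<open>C \<ge> 0\<close> by (intro mult_mono component_le_norm_cart) auto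
    qed
    finally show ?thesis .
  qed
  then have "(\<Sum>i\<in>UNIV. \<bar>(M *v y) $ i\<bar>) \<le> real CARD('n) * (real CARD('n) * (C * norm y))"
    by (intro sum_bounded_above)
  then show ?thesis using norm_le_l1_cart[of "M *v y"] by (simp add: power2_eq_square mult_ac)
qed

lemma bC1_vector_bounded:
  fixes v :: "'a::finite \<Rightarrow> real^'n::finite \<Rightarrow> real^'m::finite"
  assumes "\<And>a j. bC1_on U (\<lambda>y. v a y $ j)"
  obtains C where "C \<ge> 0" "\<And>a x. x \<in> U \<Longrightarrow> norm (v a x) \<le> C"
proof -
  obtain C where C: "C \<ge> 0" "\<And>a j x. x \<in> U \<Longrightarrow> \<bar>v a x $ j\<bar> \<le> C"
    using bC1_on_pd_uniform[of U "\<lambda>p y. v (fst p) y $ snd p"] assms by (metis fst_conv snd_conv)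
  have "norm (v a x) \<le> real CARD('m) * C" if "x \<in> U" for a x
    by (rule order_trans[OF norm_le_l1_cart]) (rule sum_bounded_above, simp add: C(2)[OF that])
  then show thesis using C(1) by (intro that[of "real CARD('m) * C"]) auto
qed

lemma bC1_matrix_bounded:
  fixes M :: "real^'n::finite \<Rightarrow> real^'n^'n"
  assumes "\<And>i j. bC1_on U (\<lambda>y. M y $ i $ j)"
  obtains C where "C \<ge> 0" "\<And>x y. x \<in> U \<Longrightarrow> norm (M x *v y) \<le> C * norm y"
proof -
  obtain C where C: "C \<ge> 0" "\<And>i j x. x \<in> U \<Longrightarrow> \<bar>M x $ i $ j\<bar> \<le> C"
    using bC1_on_pd_uniform[of U "\<lambda>p y. M y $ fst p $ snd p"] assms by (metis fst_conv snd_conv)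
  show thesis
    by (rule that[of "(real CARD('n))\<^sup>2 * C"]) (use C(1) norm_matrix_vector_le[OF C(2)] in auto)
qed

lemma Vsize_bounds:
  "norm (V x t) \<le> Vsize V x t" "\<bar>V x t $ k\<bar> \<le> Vsize V x t" "\<bar>pd i (\<lambda>y. V y t $ k) x\<bar> \<le> Vsize V x t"
  "0 \<le> Vsize V x t"
proof -
  have g: "gradnorm V x t \<ge> 0" and h: "hessnorm V x t \<ge> 0"
    by (auto simp: gradnorm_def hessnorm_def intro!: sum_nonneg)
  show n: "norm (V x t) \<le> Vsize V x t" using g h by (simp add: Vsize_def)
  show "\<bar>V x t $ k\<bar> \<le> Vsize V x t" using component_le_norm_cart n by (rule order_trans)
  show "0 \<le> Vsize V x t" using g h by (simp add: Vsize_def)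
  have "(pd i (\<lambda>y. V y t $ k) x)\<^sup>2 \<le> (\<Sum>i\<in>UNIV. (pd i (\<lambda>y. V y t $ k) x)\<^sup>2)"
    by (rule member_le_sum) auto
  also have "\<dots> \<le> (\<Sum>k\<in>UNIV. \<Sum>i\<in>UNIV. (pd i (\<lambda>y. V y t $ k) x)\<^sup>2)"
    by (rule member_le_sum[of k UNIV "\<lambda>k. \<Sum>i\<in>UNIV. (pd i (\<lambda>y. V y t $ k) x)\<^sup>2"]) (auto intro: sum_nonneg)
  finally have "\<bar>pd i (\<lambda>y. V y t $ k) x\<bar> \<le> gradnorm V x t"
    unfolding gradnorm_def using real_sqrt_le_mono real_sqrt_abs by metis
  then show "\<bar>pd i (\<lambda>y. V y t $ k) x\<bar> \<le> Vsize V x t" using h norm_ge_zero[of "V x t"] unfolding Vsize_def by linarith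
qed

text \<open>This isolates what the two-phase problem has to supply: regular coefficients, a
  splitting of \<open>A\<close> by regular fields, and a barrier for the operator in divergence
  form. The vector \<open>T x *v V x t\<close> is the part \<open>A c\<close> of the flux.\<close>

locale linear_parabolic_problem =
  fixes U :: "(real^'n::finite) set" and A T :: "real^'n \<Rightarrow> real^'n^'n" and b :: "real^'n \<Rightarrow> real^'n"
    and \<nu> :: real and Mc :: "'n \<Rightarrow> real^'n \<Rightarrow> real^'n"
    and \<Psi> :: "real^'n \<Rightarrow> real" and GP HP and \<psi>0 \<psi>1 \<eta> :: real
    and V :: "real^'n \<Rightarrow> real \<Rightarrow> real^'n" and u :: "real^'n \<Rightarrow> real \<Rightarrow> real"
  assumes U: "open U" "bounded U"
    and A: "\<And>i j. bC1_on U (\<lambda>y. A y $ i $ j)" and b: "\<And>j. bC1_on U (\<lambda>y. b y $ j)"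
    and T: "\<And>i j. bC1_on U (\<lambda>y. T y $ i $ j)" and Mc: "\<And>k j. bC1_on U (\<lambda>y. Mc k y $ j)"
    and \<nu>: "\<nu> > 0"
    and A_eq: "\<And>x i j. x \<in> U \<Longrightarrow> A x $ i $ j = (if i = j then \<nu> else 0) + (\<Sum>k\<in>UNIV. Mc k x $ i * Mc k x $ j)"
    and twP: "twice_diff_on U \<Psi> GP HP" and Pcont: "continuous_on (closure U) \<Psi>"
    and Pbnd: "\<And>x. x \<in> closure U \<Longrightarrow> \<psi>0 \<le> \<Psi> x" "\<And>x. x \<in> closure U \<Longrightarrow> \<Psi> x \<le> \<psi>1" and \<psi>0: "\<psi>0 > 0"
    and Psup: "\<And>x. x \<in> U \<Longrightarrow> (\<Sum>i\<in>UNIV. pd i (\<lambda>y. (A y *v (GP y - \<Psi> y *\<^sub>R b y)) $ i) x) \<le> - \<eta> * \<Psi> x" and \<eta>: "\<eta> > 0"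
    and V: "\<And>x t i k. x \<in> U \<Longrightarrow> t > 0 \<Longrightarrow> has_pd i (\<lambda>y. V y t $ k) x"
    and uc: "continuous_on (closure U \<times> {0..}) (\<lambda>(x,t). u x t)"
    and uC21: "C21 U u"
    and pde: "\<And>x t. x \<in> U \<Longrightarrow> t > 0 \<Longrightarrow> deriv (\<lambda>s. u x s) t =
          (\<Sum>i\<in>UNIV. pd i (\<lambda>y. (A y *v ((\<chi> i. pd i (\<lambda>y. u y t) y) - u y t *\<^sub>R b y)) $ i) x)
        + (\<Sum>i\<in>UNIV. pd i (\<lambda>y. (T y *v V y t) $ i) x)"
begin

definition "src x t = (\<Sum>i\<in>UNIV. pd i (\<lambda>y. (T y *v V y t) $ i) x)"
definition "grad x t = (\<chi> i. pd i (\<lambda>y. u y t) x)"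
definition "hess x t = (\<chi> j i. pd i (pd j (\<lambda>y. u y t)) x)"

text \<open>The starting time is a parameter: the quantitative estimate starts at 0, the limit
  statement at a late time.\<close>

definition "data_le T0 \<epsilon> \<longleftrightarrow> 0 \<le> \<epsilon> \<and> (\<forall>x\<in>U. \<forall>t>T0. Vsize V x t \<le> \<epsilon>) \<and> (\<forall>x\<in>frontier U. \<forall>t>T0. \<bar>u x t\<bar> \<le> \<epsilon>)"
definition "init_le T0 \<mu> \<longleftrightarrow> 0 \<le> \<mu> \<and> (\<forall>x\<in>closure U. \<bar>u x T0\<bar> \<le> \<mu>)"
definition "size_le a t S \<longleftrightarrow> 0 \<le> S \<and> (\<forall>y\<in>U. \<forall>s. a \<le> s \<longrightarrow> s \<le> t \<longrightarrow> \<bar>u y s\<bar> \<le> S \<and> Vsize V y s \<le> S)"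

lemma twice_u: "t > 0 \<Longrightarrow> twice_diff_on U (\<lambda>y. u y t) (\<lambda>y. grad y t) (\<lambda>y. hess y t)"
  unfolding grad_def hess_def by (rule C21_twice_diff_on[OF U(1) uC21])

lemma deriv_u: "x \<in> U \<Longrightarrow> t > 0 \<Longrightarrow> ((\<lambda>s. u x s) has_real_derivative deriv (\<lambda>s. u x s) t) (at t)"
  using uC21 unfolding C21_def by (simp add: DERIV_deriv_iff_real_differentiable)

lemma src_bound: "\<exists>C>0. \<forall>x\<in>U. \<forall>t>0. \<bar>src x t\<bar> \<le> C * Vsize V x t"
proof -
  obtain CT where CT: "CT \<ge> 0" "\<And>i j x. x \<in> U \<Longrightarrow> \<bar>T x $ i $ j\<bar> \<le> CT"
     "\<And>i j k x. x \<in> U \<Longrightarrow> \<bar>pd k (\<lambda>y. T y $ i $ j) x\<bar> \<le> CT"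
    using bC1_on_pd_uniform[of U "\<lambda>p y. T y $ fst p $ snd p"] T by (metis fst_conv snd_conv)
  define n where "n = real CARD('n)"
  have bs: "\<bar>sum f UNIV\<bar> \<le> n * K" if "\<And>j. \<bar>f j\<bar> \<le> K" for f :: "'n \<Rightarrow> real" and K
    unfolding n_def by (rule order_trans[OF sum_abs]) (rule sum_bounded_above, rule that)
  have "\<bar>src x t\<bar> \<le> (n * (n * (CT + CT)) + 1) * Vsize V x t" if x: "x \<in> U" and t: "t > 0" for x t
  proof -
    have e: "pd i (\<lambda>y. (T y *v V y t) $ i) x = (\<Sum>j\<in>UNIV. pd i (\<lambda>y. T y $ i $ j) x * V x t $ j + T x $ i $ j * pd i (\<lambda>y. V y t $ j) x)" for i
    proof -
      have "(\<lambda>y. (T y *v V y t) $ i) = (\<lambda>y. \<Sum>j\<in>UNIV. T y $ i $ j * V y t $ j)"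
        by (simp add: matrix_vector_mult_def)
      then show ?thesis by (simp add: pd_sum_mult bC1_on_pd(1)[OF T x] V[OF x t])
    qed
    have prod: "\<bar>p * q\<bar> \<le> CT * Vsize V x t" if "\<bar>p\<bar> \<le> CT" "\<bar>q\<bar> \<le> Vsize V x t" for p q :: real
      unfolding abs_mult using that CT(1) by (intro mult_mono) auto
    have "\<bar>src x t\<bar> \<le> n * (n * (CT * Vsize V x t + CT * Vsize V x t))"
      unfolding src_def e
      by (intro bs order_trans[OF abs_triangle_ineq] add_mono prod CT(2,3)[OF x] Vsize_bounds)
    also have "\<dots> \<le> (n * (n * (CT + CT)) + 1) * Vsize V x t"
      using Vsize_bounds(4)[of V x t] by (simp add: algebra_simps)
    finally show ?thesis .
  qed
  moreover have "n * (n * (CT + CT)) + 1 > 0" using CT(1) by (simp add: n_def add_nonneg_pos)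
  ultimately show ?thesis by blast
qed

lemma operator_coefficients:
  obtains \<beta> \<gamma> C where "C \<ge> 0" "\<And>x. x \<in> U \<Longrightarrow> norm (\<beta> x) \<le> C" "\<And>x. x \<in> U \<Longrightarrow> \<bar>\<gamma> x\<bar> \<le> C"
    "\<And>x t. x \<in> U \<Longrightarrow> t > 0 \<Longrightarrow> deriv (\<lambda>s. u x s) t = ellop \<nu> Mc (hess x t) x + \<beta> x \<bullet> grad x t + \<gamma> x * u x t + src x t"
    "\<And>x. x \<in> U \<Longrightarrow> ellop \<nu> Mc (HP x) x + \<beta> x \<bullet> GP x + \<gamma> x * \<Psi> x \<le> - \<eta> * \<Psi> x"
proof -
  obtain \<beta> \<gamma> C where C: "C \<ge> 0" "\<And>x. x \<in> U \<Longrightarrow> norm (\<beta> x) \<le> C" "\<And>x. x \<in> U \<Longrightarrow> \<bar>\<gamma> x\<bar> \<le> C"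
    "\<And>x s G H. x \<in> U \<Longrightarrow> twice_diff_on U s G H \<Longrightarrow>
      (\<Sum>i\<in>UNIV. pd i (\<lambda>y. (A y *v (G y - s y *\<^sub>R b y)) $ i) x)
       = (\<Sum>i\<in>UNIV. \<Sum>j\<in>UNIV. A x $ i $ j * H x $ j $ i) + \<beta> x \<bullet> G x + \<gamma> x * s x"
    by (rule divergence_form_expand[OF A b]) (rule that; assumption)
  show thesis
  proof (rule that[OF C(1-3)])
    fix x assume x: "x \<in> U"
    show "ellop \<nu> Mc (HP x) x + \<beta> x \<bullet> GP x + \<gamma> x * \<Psi> x \<le> - \<eta> * \<Psi> x"
      using Psup[OF x] unfolding C(4)[OF x twP] ellop_eq[where M = "A x" and \<nu> = \<nu> and Mc = Mc and x = x, OF A_eq[OF x]] .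
    fix t :: real assume t: "t > 0"
    show "deriv (\<lambda>s. u x s) t = ellop \<nu> Mc (hess x t) x + \<beta> x \<bullet> grad x t + \<gamma> x * u x t + src x t"
      using pde[OF x t] C(4)[OF x twice_u[OF t]] unfolding ellop_eq[where M = "A x" and \<nu> = \<nu> and Mc = Mc and x = x, OF A_eq[OF x]]
      by (simp add: src_def grad_def)
  qed
qed

text \<open>The constant is chosen before the starting time, the data and the initial bound, which
  permits a restart at any time.\<close>

lemma sup_bound:
  "\<exists>C>0. \<forall>T0 \<epsilon> \<mu> x t. 0 \<le> T0 \<longrightarrow> data_le T0 \<epsilon> \<longrightarrow> init_le T0 \<mu> \<longrightarrow> x \<in> closure U \<longrightarrow> T0 \<le> t \<longrightarrow>
     \<bar>u x t\<bar> \<le> C * (\<mu> * exp (- \<eta> * (t - T0)) + \<epsilon>)"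
proof -
  obtain \<beta> \<gamma> K where K: "K \<ge> 0" "\<And>x. x \<in> U \<Longrightarrow> norm (\<beta> x) \<le> K" "\<And>x. x \<in> U \<Longrightarrow> \<bar>\<gamma> x\<bar> \<le> K"
    "\<And>x t. x \<in> U \<Longrightarrow> t > 0 \<Longrightarrow> deriv (\<lambda>s. u x s) t = ellop \<nu> Mc (hess x t) x + \<beta> x \<bullet> grad x t + \<gamma> x * u x t + src x t"
    "\<And>x. x \<in> U \<Longrightarrow> ellop \<nu> Mc (HP x) x + \<beta> x \<bullet> GP x + \<gamma> x * \<Psi> x \<le> - \<eta> * \<Psi> x"
    using operator_coefficients by metis
  obtain Cs where Cs: "Cs > 0" "\<And>x t. x \<in> U \<Longrightarrow> t > 0 \<Longrightarrow> \<bar>src x t\<bar> \<le> Cs * Vsize V x t"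
    using src_bound by blast
  \<comment> \<open>The quotient has a definite sign only if \<open>closure U\<close> is nonempty,
    which the locale does not assert; the maximum avoids that case distinction.\<close>
  define P where "P = max 0 (\<psi>1 / \<psi>0)"
  define C where "C = (P + 1) * (1 + (Cs + 1) * (1 + 1/\<eta>))"
  have P: "P \<ge> 0" by (simp add: P_def)
  have q: "(Cs + 1) * (1 + 1/\<eta>) > 0" using Cs(1) \<eta> by (simp add: add_pos_pos)
  have C: "C > 0" unfolding C_def using P q by (intro mult_pos_pos) auto
  show ?thesis
  proof (intro exI[of _ C] conjI C allI impI ballI)
    fix T0 \<epsilon> \<mu> :: real and x t
    assume T0: "0 \<le> T0" and data: "data_le T0 \<epsilon>" and init: "init_le T0 \<mu>" and x: "x \<in> closure U" and t: "T0 \<le> t"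
    have \<epsilon>: "0 \<le> \<epsilon>" and Ve: "\<forall>x\<in>U. \<forall>t>T0. Vsize V x t \<le> \<epsilon>" and be: "\<forall>x\<in>frontier U. \<forall>t>T0. \<bar>u x t\<bar> \<le> \<epsilon>"
      and \<mu>: "0 \<le> \<mu>" and i: "\<forall>x\<in>closure U. \<bar>u x T0\<bar> \<le> \<mu>"
      using data init by (auto simp: data_le_def init_le_def)
    have e2: "\<epsilon> \<le> (Cs + 1) * \<epsilon>" using Cs(1) \<epsilon> by (simp add: distrib_right)
    interpret barrier U \<nu> Mc \<beta> \<gamma> \<Psi> GP HP \<psi>0 \<psi>1 \<eta>
      by unfold_locales (rule U \<nu> twP Pcont Pbnd \<psi>0 K(5) \<eta> | assumption)+
    have "\<bar>u x t\<bar> \<le> \<psi>1 / \<psi>0 * (\<mu> * exp (- \<eta> * (t - T0)) + (Cs + 1) * \<epsilon> * (1 + 1/\<eta>))"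
    proof (rule decay_bound[where G = grad and H = hess and st = "\<lambda>x t. deriv (\<lambda>s. u x s) t" and f = src])
      show "twice_diff_on U (\<lambda>y. u y t) (\<lambda>y. grad y t) (\<lambda>y. hess y t)" if "T0 < t" for t
        using twice_u that T0 by simp
      show "((\<lambda>s. u x s) has_real_derivative deriv (\<lambda>s. u x s) t) (at t)" if "x \<in> U" "T0 < t" for x t
        using deriv_u that T0 by simp
      show "deriv (\<lambda>s. u x s) t = ellop \<nu> Mc (hess x t) x + \<beta> x \<bullet> grad x t + \<gamma> x * u x t + src x t" if "x \<in> U" "T0 < t" for x t
        using K(4) that T0 by simp
      show "continuous_on (closure U \<times> {T0..}) (\<lambda>(x,t). u x t)"
        by (rule continuous_on_subset[OF uc]) (use T0 in auto)
      show "\<bar>src x t\<bar> \<le> (Cs + 1) * \<epsilon>" if "x \<in> U" "T0 < t" for x t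
      proof -
        have "\<bar>src x t\<bar> \<le> Cs * Vsize V x t" using Cs(2) that T0 by simp
        also have "\<dots> \<le> (Cs + 1) * \<epsilon>" using Cs(1) Ve that Vsize_bounds(4)[of V x t] by (intro mult_mono) auto
        finally show ?thesis .
      qed
      show "\<bar>u x t\<bar> \<le> (Cs + 1) * \<epsilon>" if "x \<in> frontier U" "T0 < t" for x t
        using be that e2 by force
      show "\<bar>u x T0\<bar> \<le> \<mu>" if "x \<in> closure U" for x using i that by blast
      show "0 \<le> (Cs + 1) * \<epsilon>" using e2 \<epsilon> by simp
    qed (fact \<mu> x t)+
    also have "\<dots> \<le> (P + 1) * (\<mu> * exp (- \<eta> * (t - T0)) + (Cs + 1) * \<epsilon> * (1 + 1/\<eta>))"
      using \<mu> \<epsilon> Cs(1) \<eta> by (intro mult_right_mono) (auto simp: P_def)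
    also have "\<dots> \<le> (P + 1) * ((1 + (Cs + 1) * (1 + 1/\<eta>)) * (\<mu> * exp (- \<eta> * (t - T0)) + \<epsilon>))"
    proof (rule mult_left_mono)
      define m where "m = \<mu> * exp (- \<eta> * (t - T0))"
      define Q where "Q = (Cs + 1) * (1 + 1/\<eta>)"
      have "0 \<le> Q * m" unfolding Q_def m_def by (rule mult_nonneg_nonneg[OF less_imp_le[OF q]]) (simp add: \<mu>)
      then have "m + \<epsilon> * Q \<le> (1 + Q) * (m + \<epsilon>)" using \<epsilon> by (simp add: algebra_simps)
      then show "\<mu> * exp (- \<eta> * (t - T0)) + (Cs + 1) * \<epsilon> * (1 + 1/\<eta>) \<le> (1 + (Cs + 1) * (1 + 1/\<eta>)) * (\<mu> * exp (- \<eta> * (t - T0)) + \<epsilon>)"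
        unfolding m_def[symmetric] Q_def[symmetric] by (simp add: Q_def mult_ac)
    qed (use P in simp)
    finally show "\<bar>u x t\<bar> \<le> C * (\<mu> * exp (- \<eta> * (t - T0)) + \<epsilon>)" by (simp add: C_def mult.assoc)
  qed
qed

text \<open>Compactness of \<open>K\<close> gives one \<open>\<delta>\<close> for all its points. In
  each cylinder the zeroth-order term and the source are bounded by \<open>(K1 + Cs) * S\<close>,
  which serves as the error \<open>\<Phi>\<close> of the doubling argument.\<close>

lemma grad_bound:
  assumes K: "compact K" "K \<subseteq> U"
  shows "\<exists>C>0. \<forall>x\<in>K. \<forall>t \<tau> S. 0 < \<tau> \<longrightarrow> \<tau> \<le> 1 \<longrightarrow> \<tau> < t \<longrightarrow> size_le (t - \<tau>) t S \<longrightarrow>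
      norm (grad x t) \<le> C * S / sqrt \<tau>"
proof -
  obtain \<beta> \<gamma> K1 where K1: "K1 \<ge> 0" "\<And>x. x \<in> U \<Longrightarrow> norm (\<beta> x) \<le> K1" "\<And>x. x \<in> U \<Longrightarrow> \<bar>\<gamma> x\<bar> \<le> K1"
    "\<And>x t. x \<in> U \<Longrightarrow> t > 0 \<Longrightarrow> deriv (\<lambda>s. u x s) t = ellop \<nu> Mc (hess x t) x + \<beta> x \<bullet> grad x t + \<gamma> x * u x t + src x t"
    using operator_coefficients by metis
  obtain Cs where Cs: "Cs > 0" "\<And>x t. x \<in> U \<Longrightarrow> t > 0 \<Longrightarrow> \<bar>src x t\<bar> \<le> Cs * Vsize V x t"
    using src_bound by blast
  obtain \<delta>' where \<delta>': "\<delta>' > 0" "(\<Union>x\<in>K. cball x \<delta>') \<subseteq> U"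
    using compact_subset_open_imp_cball_epsilon_subset[OF K(1) U(1) K(2)] by blast
  define \<delta> where "\<delta> = \<delta>' / 2"
  have \<delta>: "\<delta> > 0" "\<And>x. x \<in> K \<Longrightarrow> cball x (2 * \<delta>) \<subseteq> U" using \<delta>' by (auto simp: \<delta>_def)
  have "\<forall>k j. \<exists>L. L \<ge> 0 \<and> (\<forall>K x y. convex K \<longrightarrow> K \<subseteq> U \<longrightarrow> x \<in> K \<longrightarrow> y \<in> K \<longrightarrow> \<bar>Mc k x $ j - Mc k y $ j\<bar> \<le> L * dist x y)"
    using bC1_on_lipschitz[OF Mc] by (metis (no_types, lifting))
  then obtain L where L: "\<And>k j. L k j \<ge> 0"
    "\<And>k j K x y. convex K \<Longrightarrow> K \<subseteq> U \<Longrightarrow> x \<in> K \<Longrightarrow> y \<in> K \<Longrightarrow> \<bar>Mc k x $ j - Mc k y $ j\<bar> \<le> L k j * dist x y"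
    by metis
  define LL where "LL = (\<Sum>k\<in>UNIV. \<Sum>j\<in>UNIV. L k j)"
  have Mlip: "norm (Mc k x - Mc k y) \<le> LL * dist x y" if "convex K" "K \<subseteq> U" "x \<in> K" "y \<in> K" for k K x y
  proof -
    have "norm (Mc k x - Mc k y) \<le> (\<Sum>j\<in>UNIV. L k j * dist x y)"
      by (rule order_trans[OF norm_le_l1_cart]) (simp add: sum_mono L(2)[OF that])
    also have "\<dots> \<le> LL * dist x y"
      unfolding sum_distrib_right[symmetric] LL_def
      by (intro mult_right_mono member_le_sum[of k UNIV "\<lambda>k. \<Sum>j\<in>UNIV. L k j"]) (auto intro: sum_nonneg L)
    finally show ?thesis .
  qed
  obtain Bd where Mb: "\<And>k x. x \<in> U \<Longrightarrow> norm (Mc k x) \<le> Bd"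
    using bC1_vector_bounded[of U Mc, OF Mc] by metis
  define C where "C = 3 / doubling_scale (real CARD('n)) \<nu> \<delta> Bd LL K1 * (K1 + Cs + 1)"
  have C: "C > 0" using doubling_scale_pos[OF \<nu> \<delta>(1) K1(1), of "real CARD('n)" Bd LL] K1 Cs by (simp add: C_def)
  show ?thesis
  proof (intro exI[of _ C] conjI C allI impI ballI)
    fix x t \<tau> S assume x: "x \<in> K" and \<tau>: "0 < \<tau>" "\<tau> \<le> 1" "\<tau> < t" and size: "size_le (t - \<tau>) t S"
    have S: "0 \<le> S" and bnd: "\<forall>y\<in>U. \<forall>s. t - \<tau> \<le> s \<longrightarrow> s \<le> t \<longrightarrow> \<bar>u y s\<bar> \<le> S \<and> Vsize V y s \<le> S"
      using size by (auto simp: size_le_def)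
    note ball = \<delta>(2)[OF x]
    \<comment> \<open>The cylinder estimate asks for a positive bound. A strictly larger
      \<open>S'\<close> covers \<open>S = 0\<close> and then tends to \<open>S\<close>.\<close>
    have *: "norm (grad x t) \<le> C * S' / sqrt \<tau>" if S': "S < S'" for S'
    proof -
      have S'0: "S' > 0" using S S' by simp
      have S'le: "S' \<le> (K1 + Cs + 1) * S'" using S'0 K1 Cs by (simp add: distrib_right)
      interpret cyl: parabolic_cylinder U x \<delta> "t - \<tau>" t u grad hess "\<lambda>x t. deriv (\<lambda>s. u x s) t" \<nu> Mc \<beta>
        "(K1 + Cs + 1) * S'" "(K1 + Cs + 1) * S'" Bd LL K1
      proof
        show "twice_diff_on U (\<lambda>y. u y s) (\<lambda>y. grad y s) (\<lambda>y. hess y s)" if "t - \<tau> \<le> s" for s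
          using twice_u that \<tau> by simp
        show "((\<lambda>s. u y s) has_real_derivative deriv (\<lambda>s. u y s) s) (at s)" if "y \<in> cball x (2 * \<delta>)" "t - \<tau> \<le> s" for y s
          using deriv_u[of y s] that \<tau> ball by auto
        show "\<bar>deriv (\<lambda>s. u y s) s - (ellop \<nu> Mc (hess y s) y + \<beta> y \<bullet> grad y s)\<bar> \<le> (K1 + Cs + 1) * S'"
          if "y \<in> cball x (2 * \<delta>)" "t - \<tau> \<le> s" "s \<le> t" for y s
        proof -
          have y: "y \<in> U" and s: "s > 0" using that ball \<tau> by auto
          have g: "\<bar>\<gamma> y * u y s\<bar> \<le> K1 * S'"
            unfolding abs_mult using K1(3)[OF y] K1(1) bnd y that S' by (intro mult_mono) force+
          have "\<bar>src y s\<bar> \<le> Cs * Vsize V y s" by (rule Cs(2)[OF y s])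
          also have "\<dots> \<le> Cs * S'" using Cs(1) bnd y that S' by (intro mult_left_mono) force+
          finally show ?thesis using g S'0 unfolding K1(4)[OF y s] by (simp add: distrib_right abs_le_iff)
        qed
        show "continuous_on (cball x (2 * \<delta>) \<times> {t - \<tau>..t}) (\<lambda>(x, t). u x t)"
          using ball closure_subset[of U] \<tau> by (intro continuous_on_subset[OF uc]) auto
        show "\<bar>u y s\<bar> \<le> (K1 + Cs + 1) * S'" if "y \<in> cball x (2 * \<delta>)" "t - \<tau> \<le> s" "s \<le> t" for y s
        proof -
          have "\<bar>u y s\<bar> \<le> S" using bnd that ball by blast
          then show ?thesis using S' S'le by linarith
        qed
        show "norm (Mc k y) \<le> Bd" if "y \<in> cball x (2 * \<delta>)" for k y using Mb that ball by blast
        show "norm (Mc k y - Mc k z) \<le> LL * dist y z" if "y \<in> cball x (2 * \<delta>)" "z \<in> cball x (2 * \<delta>)" for k y z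
          by (rule Mlip[OF convex_cball ball that])
        show "norm (\<beta> y) \<le> K1" if "y \<in> cball x (2 * \<delta>)" for y using K1(2) that ball by blast
      qed (use U ball \<nu> \<delta> K1 \<tau> in auto)
      have "0 < (K1 + Cs + 1) * S'" using S'0 S'le by linarith
      from cyl.interior_gradient_bound[OF this order_refl order_refl] \<tau>
      have "norm (grad x t) \<le> 3 / doubling_scale (real CARD('n)) \<nu> \<delta> Bd LL K1 * ((K1 + Cs + 1) * S') / sqrt \<tau>" by simp
      then show ?thesis by (simp only: C_def mult.assoc)
    qed
    show "norm (grad x t) \<le> C * S / sqrt \<tau>"
    proof (rule field_le_epsilon)
      fix e :: real assume e: "e > 0"
      have "norm (grad x t) \<le> C * (S + e * sqrt \<tau> / C) / sqrt \<tau>"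
        using C e \<tau> by (intro *) simp
      also have "\<dots> = C * S / sqrt \<tau> + e" using C \<tau> by (simp add: field_simps)
      finally show "norm (grad x t) \<le> C * S / sqrt \<tau> + e" .
    qed
  qed
qed

lemma flux_bound:
  "\<exists>C>0. \<forall>x\<in>U. \<forall>t. norm (A x *v (grad x t - u x t *\<^sub>R b x) + T x *v V x t) \<le> C * (norm (grad x t) + \<bar>u x t\<bar> + Vsize V x t)"
proof -
  obtain CA where CA: "CA \<ge> 0" "\<And>x y. x \<in> U \<Longrightarrow> norm (A x *v y) \<le> CA * norm y"
    using bC1_matrix_bounded[OF A] by metis
  obtain CT where CT: "CT \<ge> 0" "\<And>x y. x \<in> U \<Longrightarrow> norm (T x *v y) \<le> CT * norm y"
    using bC1_matrix_bounded[OF T] by metis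
  obtain Cb where Cb: "Cb \<ge> 0" "\<And>x. x \<in> U \<Longrightarrow> norm (b x) \<le> Cb"
    using bC1_vector_bounded[of U "\<lambda>_::unit. b"] b by metis
  define C where "C = CA + CA * Cb + CT + 1"
  show ?thesis
  proof (intro exI[of _ C] conjI ballI allI)
    show "C > 0" using CA(1) Cb(1) CT(1) by (simp add: C_def add_nonneg_pos)
    fix x t assume x: "x \<in> U"
    define g s v where "g = norm (grad x t)" and "s = \<bar>u x t\<bar>" and "v = Vsize V x t"
    have nn: "g \<ge> 0" "s \<ge> 0" "v \<ge> 0" by (auto simp: g_def s_def v_def Vsize_bounds)
    have "norm (u x t *\<^sub>R b x) \<le> s * Cb" using Cb(2)[OF x] by (simp add: s_def mult_left_mono)
    then have "norm (grad x t - u x t *\<^sub>R b x) \<le> g + s * Cb"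
      using norm_triangle_ineq4[of "grad x t" "u x t *\<^sub>R b x"] by (simp add: g_def)
    then have "CA * norm (grad x t - u x t *\<^sub>R b x) \<le> CA * (g + s * Cb)" using CA(1) by (rule mult_left_mono)
    moreover have "CT * norm (V x t) \<le> CT * v"
      unfolding v_def using CT(1) by (intro mult_left_mono Vsize_bounds)
    moreover note CA(2)[OF x, of "grad x t - u x t *\<^sub>R b x"] CT(2)[OF x, of "V x t"]
      norm_triangle_ineq[of "A x *v (grad x t - u x t *\<^sub>R b x)" "T x *v V x t"]
    ultimately have "norm (A x *v (grad x t - u x t *\<^sub>R b x) + T x *v V x t) \<le> CA * (g + s * Cb) + CT * v"
      by linarith
    also have "\<dots> \<le> C * (g + s + v)"
      using CA(1) Cb(1) CT(1) nn by (simp add: C_def algebra_simps)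
    finally show "norm (A x *v (grad x t - u x t *\<^sub>R b x) + T x *v V x t) \<le> C * (norm (grad x t) + \<bar>u x t\<bar> + Vsize V x t)"
      by (simp add: g_def s_def v_def)
  qed
qed

definition "flux x t = A x *v (grad x t - u x t *\<^sub>R b x) + T x *v V x t"

lemma velocity_bound:
  assumes K: "compact K" "K \<subseteq> U"
  shows "\<exists>M>0. \<forall>s0 \<Delta>. data_le 0 \<Delta> \<longrightarrow> init_le 0 s0 \<longrightarrow>
     (\<forall>x\<in>K. \<forall>t>0. norm (flux x t) \<le> M * (1 + 1 / sqrt t) * (exp (- \<eta> * t) * s0 + \<Delta>))"
proof -
  obtain C1 where C1: "C1 > 0" "\<And>T0 \<epsilon> \<mu> x t. 0 \<le> T0 \<Longrightarrow> data_le T0 \<epsilon> \<Longrightarrow> init_le T0 \<mu> \<Longrightarrow> x \<in> closure U \<Longrightarrow> T0 \<le> t \<Longrightarrow>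
      \<bar>u x t\<bar> \<le> C1 * (\<mu> * exp (- \<eta> * (t - T0)) + \<epsilon>)"
    using sup_bound by blast
  obtain C2 where C2: "C2 > 0" "\<And>x t \<tau> S. x \<in> K \<Longrightarrow> 0 < \<tau> \<Longrightarrow> \<tau> \<le> 1 \<Longrightarrow> \<tau> < t \<Longrightarrow> size_le (t - \<tau>) t S \<Longrightarrow>
      norm (grad x t) \<le> C2 * S / sqrt \<tau>"
    using grad_bound[OF K] by blast
  obtain C3 where C3: "C3 > 0" "\<And>x t. x \<in> U \<Longrightarrow> norm (flux x t) \<le> C3 * (norm (grad x t) + \<bar>u x t\<bar> + Vsize V x t)"
    using flux_bound unfolding flux_def by blast
  \<comment> \<open>The factor \<open>exp \<eta>\<close> pays for evaluating the decay at times
    \<open>s \<ge> t - 1\<close> instead of \<open>t\<close>; the summand 1 covers the bound of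
    \<open>V\<close>.\<close>
  define c where "c = C1 * exp \<eta> + 1"
  have c: "c \<ge> 1" using C1(1) by (simp add: c_def)
  define M where "M = C3 * (2 * C2 * c + 2 * c)"
  have M: "M > 0" using C3(1) C2(1) c unfolding M_def by (intro mult_pos_pos add_pos_pos) auto
  show ?thesis
  proof (intro exI[of _ M] conjI M allI impI ballI)
    fix s0 \<Delta> x and t :: real
    assume data: "data_le 0 \<Delta>" and init: "init_le 0 s0" and x: "x \<in> K" and t: "0 < t"
    have s0: "0 \<le> s0" and \<Delta>: "0 \<le> \<Delta>" and Vd: "\<forall>x\<in>U. \<forall>t>0. Vsize V x t \<le> \<Delta>"
      using data init by (auto simp: data_le_def init_le_def)
    define E where "E = exp (- \<eta> * t) * s0 + \<Delta>"
    define \<tau> where "\<tau> = min (t/2) 1"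
    have \<tau>: "0 < \<tau>" "\<tau> \<le> 1" "\<tau> < t" using t by (auto simp: \<tau>_def)
    have E: "E \<ge> 0" "\<Delta> \<le> E" using s0 \<Delta> by (auto simp: E_def)
    have xU: "x \<in> U" using x K by blast
    have ub: "\<bar>u y s\<bar> \<le> c * E \<and> Vsize V y s \<le> c * E" if "y \<in> U" "t - \<tau> \<le> s" "s \<le> t" for y s
    proof
      have s: "s > 0" using that \<tau> by simp
      have Ec: "E \<le> c * E" using c E by (simp add: mult_le_cancel_right1)
      have "- \<eta> * s \<le> \<eta> + - \<eta> * t"
      proof -
        have "\<eta> * (t - s) \<le> \<eta> * 1" using that \<tau> \<eta> by (intro mult_left_mono) auto
        then show ?thesis by (simp add: algebra_simps)
      qed
      then have ex: "exp (- \<eta> * s) \<le> exp \<eta> * exp (- \<eta> * t)"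
        unfolding exp_add[symmetric] by simp
      have e1: "exp \<eta> \<ge> 1" using \<eta> by simp
      have "\<bar>u y s\<bar> \<le> C1 * (s0 * exp (- \<eta> * s) + \<Delta>)"
        using C1(2)[OF order_refl data init, of y s] that s closure_subset[of U] by auto
      also have "\<dots> \<le> C1 * (exp \<eta> * E)"
      proof (rule mult_left_mono)
        have "s0 * exp (- \<eta> * s) \<le> s0 * (exp \<eta> * exp (- \<eta> * t))" using ex s0 by (rule mult_left_mono)
        moreover have "1 * \<Delta> \<le> exp \<eta> * \<Delta>" using e1 \<Delta> by (rule mult_right_mono)
        ultimately show "s0 * exp (- \<eta> * s) + \<Delta> \<le> exp \<eta> * E" by (simp add: E_def algebra_simps)
      qed (use C1 in simp)
      also have "\<dots> \<le> c * E" using E by (simp add: c_def algebra_simps)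
      finally show "\<bar>u y s\<bar> \<le> c * E" .
      have "Vsize V y s \<le> \<Delta>" using Vd that(1) s by blast
      then show "Vsize V y s \<le> c * E" using E Ec by linarith
    qed
    have cE: "c * E \<ge> 0" using c E by simp
    define q where "q = 1 + 1 / sqrt t"
    have q: "q \<ge> 1" using t by (simp add: q_def)
    \<comment> \<open>For \<open>t \<le> 2\<close> the time span is \<open>t / 2\<close>, which
      costs the factor \<open>sqrt 2 \<le> 2\<close>; for larger \<open>t\<close> it is 1. This is
      the origin of the factor \<open>1 + 1 / sqrt t\<close>.\<close>
    have "1 / sqrt \<tau> \<le> 2 * q"
    proof (cases "t / 2 \<le> 1")
      case True
      have "sqrt 2 \<le> (2::real)" by (rule real_le_lsqrt) auto
      then have "sqrt t \<le> 2 * sqrt (t/2)"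
        using t by (simp add: real_sqrt_divide field_simps)
      then have "1 / sqrt (t/2) \<le> 2 / sqrt t" using t by (simp add: field_simps)
      also have "\<dots> \<le> 2 * q" by (simp add: q_def)
      finally show ?thesis using True by (simp add: \<tau>_def)
    next
      case False
      then show ?thesis using q by (simp add: \<tau>_def min_def)
    qed
    then have gq: "C2 * (c * E) * (1 / sqrt \<tau>) \<le> C2 * (c * E) * (2 * q)"
      using C2(1) cE by (intro mult_left_mono) auto
    have g: "norm (grad x t) \<le> C2 * (c * E) / sqrt \<tau>"
      using ub cE by (intro C2(2)[OF x \<tau>]) (simp add: size_le_def)
    have "norm (flux x t) \<le> C3 * (norm (grad x t) + \<bar>u x t\<bar> + Vsize V x t)" by (rule C3(2)[OF xU])
    also have "\<dots> \<le> C3 * (C2 * (c * E) * (2 * q) + c * E + c * E)"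
      using g gq ub[OF xU, of t] \<tau> C3(1) by (intro mult_left_mono add_mono) auto
    also have "\<dots> \<le> C3 * ((2 * C2 * c + 2 * c) * q * E)"
    proof (rule mult_left_mono)
      have "c * E * 1 \<le> c * E * q" by (rule mult_left_mono[OF q cE])
      then show "C2 * (c * E) * (2 * q) + c * E + c * E \<le> (2 * C2 * c + 2 * c) * q * E" by (simp add: algebra_simps)
    qed (use C3 in simp)
    finally show "norm (flux x t) \<le> M * (1 + 1 / sqrt t) * (exp (- \<eta> * t) * s0 + \<Delta>)"
      by (simp only: M_def E_def q_def mult.assoc)
  qed
qed

text \<open>From a time \<open>T0\<close> on the data are at most \<open>d\<close>. The values at
  \<open>T0\<close> are bounded by compactness, their influence decays exponentially, and the
  gradient bound is applied with time span 1.\<close>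

lemma velocity_tendsto:
  assumes x: "x \<in> U"
    and lim: "\<And>e. e > 0 \<Longrightarrow> \<exists>T0\<ge>0. data_le T0 e"
  shows "((\<lambda>t. flux x t) \<longlongrightarrow> 0) at_top"
proof -
  obtain C1 where C1: "C1 > 0" "\<And>T0 \<epsilon> \<mu> x t. 0 \<le> T0 \<Longrightarrow> data_le T0 \<epsilon> \<Longrightarrow> init_le T0 \<mu> \<Longrightarrow> x \<in> closure U \<Longrightarrow> T0 \<le> t \<Longrightarrow>
      \<bar>u x t\<bar> \<le> C1 * (\<mu> * exp (- \<eta> * (t - T0)) + \<epsilon>)"
    using sup_bound by blast
  have "compact {x}" "{x} \<subseteq> U" using x by auto
  from grad_bound[OF this] obtain C2 where C2: "C2 > 0" "\<And>t \<tau> S. 0 < \<tau> \<Longrightarrow> \<tau> \<le> 1 \<Longrightarrow> \<tau> < t \<Longrightarrow>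
      size_le (t - \<tau>) t S \<Longrightarrow> norm (grad x t) \<le> C2 * S / sqrt \<tau>"
    by (metis singletonI)
  obtain C3 where C3: "C3 > 0" "\<And>x t. x \<in> U \<Longrightarrow> norm (flux x t) \<le> C3 * (norm (grad x t) + \<bar>u x t\<bar> + Vsize V x t)"
    using flux_bound unfolding flux_def by blast
  define c where "c = 2 * C1 + 1"
  have c: "c \<ge> 1" using C1(1) by (simp add: c_def)
  show ?thesis
    unfolding tendsto_iff dist_norm diff_zero
  proof (intro allI impI)
    fix e :: real assume e: "e > 0"
    \<comment> \<open>With both the data and the decayed initial part below \<open>d\<close>, the
      velocity is at most \<open>C3 * (C2 * c + 2 * c) * d\<close>, which is
      \<open>e / 2\<close>.\<close>
    define d where "d = e / (2 * (C3 * (C2 * c + 2 * c)))"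
    have den: "C3 * (C2 * c + 2 * c) > 0" using C3(1) C2(1) c by (intro mult_pos_pos add_pos_pos) auto
    have d: "d > 0" using e den by (simp add: d_def)
    obtain T0 where T0: "T0 \<ge> 0" "data_le T0 d" using lim[OF d] by blast
    have "compact ((\<lambda>(x,t). u x t) ` (closure U \<times> {T0}))"
      by (rule compact_continuous_image[OF continuous_on_subset[OF uc]])
        (use U T0(1) in \<open>auto intro!: compact_Times simp: compact_closure\<close>)
    then obtain \<mu> where "\<forall>z\<in>(\<lambda>(x,t). u x t) ` (closure U \<times> {T0}). norm z \<le> \<mu>"
      using compact_imp_bounded bounded_iff by blast
    then have \<mu>: "\<forall>y\<in>closure U. \<bar>u y T0\<bar> \<le> \<mu>" by auto
    then have init: "init_le T0 \<mu>" using x closure_subset[of U] by (force simp: init_le_def)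
    have "((\<lambda>t. \<mu> * exp (- \<eta> * (t - T0))) \<longlongrightarrow> 0) at_top"
      using \<eta> by real_asymp
    then have "\<forall>\<^sub>F t in at_top. \<mu> * exp (- \<eta> * (t - T0)) < d"
      using d by (rule order_tendstoD)
    then obtain T1 where T1: "\<And>t. t \<ge> T1 \<Longrightarrow> \<mu> * exp (- \<eta> * (t - T0)) < d"
      unfolding eventually_at_top_linorder by blast
    show "\<forall>\<^sub>F t in at_top. norm (flux x t) < e"
      unfolding eventually_at_top_linorder
    proof (intro exI[of _ "max T0 T1 + 2"] allI impI)
      fix t assume t: "max T0 T1 + 2 \<le> t"
      have cd: "c * d \<ge> 0" using c d by simp
      have ub: "\<bar>u y s\<bar> \<le> c * d \<and> Vsize V y s \<le> c * d" if "y \<in> U" "t - 1 \<le> s" for y s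
      proof
        have s: "s > T0" "s \<ge> T1" using that t by auto
        have "\<bar>u y s\<bar> \<le> C1 * (\<mu> * exp (- \<eta> * (s - T0)) + d)"
          using that s closure_subset[of U] by (intro C1(2)[OF T0 init]) auto
        also have "\<dots> \<le> C1 * (d + d)"
          using T1[OF s(2)] C1(1) by (intro mult_left_mono) auto
        also have "\<dots> \<le> c * d" using d by (simp add: c_def algebra_simps)
        finally show "\<bar>u y s\<bar> \<le> c * d" .
        have "Vsize V y s \<le> 1 * d" using T0(2) that(1) s by (simp add: data_le_def)
        also have "\<dots> \<le> c * d" using c d by (intro mult_right_mono) auto
        finally show "Vsize V y s \<le> c * d" .
      qed
      have "norm (grad x t) \<le> C2 * (c * d) / sqrt 1"
        using t T0(1) ub cd by (intro C2(2)) (auto simp: size_le_def)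
      then have g: "norm (grad x t) \<le> C2 * (c * d)" by simp
      have "norm (flux x t) \<le> C3 * (norm (grad x t) + \<bar>u x t\<bar> + Vsize V x t)" by (rule C3(2)[OF x])
      also have "\<dots> \<le> C3 * (C2 * (c * d) + c * d + c * d)"
        using g ub[OF x, of t] C3(1) by (intro mult_left_mono add_mono) auto
      also have "\<dots> = C3 * (C2 * c + 2 * c) * d" by (simp add: algebra_simps)
      also have "\<dots> = e / 2" using den unfolding d_def by (simp only: times_divide_eq_right) (simp add: field_simps)
      also have "\<dots> < e" using e by simp
      finally show "norm (flux x t) < e" .
    qed
  qed
qed

end

section \<open>The radial barrier\<close>

text \<open>Three losses in \<open>\<eta>1\<close> put it below the rate of the barrier:
  \<open>ln (1 + \<eta>0) \<le> \<eta>0\<close>; \<open>\<eta>0 < (r0 / R) powr k\<close> because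
  \<open>2 * \<kappa>0 \<ge> 1\<close> and \<open>n > 0\<close>; and
  \<open>2 * (n + k) / (k + 2) \<le> n\<close>, which is where \<open>n \<ge> 2\<close>
  enters.\<close>

lemma decay_rate_inequality:
  fixes n C0 C1 k R r0 :: real
  assumes n: "n \<ge> 2" and C: "0 < C1" "C1 \<le> C0" and k: "k \<ge> 0" and R: "0 < r0" "r0 < R"
    and \<kappa>0: "\<kappa>0 = C0 / (2 * C1)" and sR: "sR = \<kappa>0 * (n + k)" and q: "q = \<kappa>0 * C0 / (2 * sR)"
    and \<eta>0: "\<eta>0 = (r0 / R) powr (2 * sR)" and \<eta>1: "\<eta>1 = ln (1 + \<eta>0) / (q * R\<^sup>2)"
  shows "\<eta>1 > 0" "\<eta>1 * (C0 * (R powr (k + 2) / (k + 2))) < n * r0 powr k"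
proof -
  have \<kappa>: "\<kappa>0 > 0" "2 * \<kappa>0 \<ge> 1" using C by (auto simp: \<kappa>0)
  have q': "q = C0 / (2 * (n + k))" unfolding q sR mult.left_commute[of 2 \<kappa>0] using \<kappa>(1) by simp
  have qpos: "q > 0" using C n k by (simp add: q')
  have \<eta>0pos: "\<eta>0 > 0" using R by (simp add: \<eta>0)
  show "\<eta>1 > 0" using \<eta>0pos qpos R by (simp add: \<eta>1 ln_gt_zero)
  define x where "x = r0 / R"
  have x: "0 < x" "x < 1" using R by (auto simp: x_def)
  have "1 * (n + k) \<le> 2 * \<kappa>0 * (n + k)" using \<kappa> n k by (intro mult_right_mono) auto
  then have "\<eta>0 \<le> x powr (n + k)" unfolding \<eta>0 sR x_def[symmetric]
    using x by (intro powr_mono') auto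
  also have "\<dots> < x powr k" using x n by (intro powr_less_mono') auto
  finally have \<eta>0x: "\<eta>0 < x powr k" .
  have Rp: "R powr (k + 2) = R powr k * R\<^sup>2" using R by (simp add: powr_add powr_numeral)
  have rp: "r0 powr k = x powr k * R powr k" using R by (simp add: x_def powr_divide)
  have "\<eta>1 \<le> \<eta>0 / (q * R\<^sup>2)"
    unfolding \<eta>1 using \<eta>0pos qpos R by (intro divide_right_mono ln_add_one_self_le_self) auto
  then have "\<eta>1 * (C0 * (R powr (k + 2) / (k + 2))) \<le> \<eta>0 / (q * R\<^sup>2) * (C0 * (R powr (k + 2) / (k + 2)))"
    using C k by (intro mult_right_mono) auto
  also have "\<dots> = \<eta>0 * R powr k * (2 * (n + k) / (k + 2))"
  proof -
    have "\<eta>0 / (C0 / (2 * a) * S) * (C0 * (X * S / d)) = \<eta>0 * X * (2 * a / d)" if "a > 0" "d > 0" "S > 0" for a d S X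
      using that C by (simp add: field_simps)
    note this[of "n + k" "k + 2" "R\<^sup>2" "R powr k"]
    moreover have "n + k > 0" "k + 2 > 0" "R\<^sup>2 > 0" using n k R by auto
    ultimately show ?thesis unfolding q' Rp by blast
  qed
  also have "\<dots> < x powr k * R powr k * (2 * (n + k) / (k + 2))"
    using \<eta>0x R n k by (intro mult_strict_right_mono) auto
  also have "\<dots> \<le> x powr k * R powr k * n"
  proof (rule mult_left_mono)
    have "2 * k \<le> n * k" using n k by (rule mult_right_mono)
    then show "2 * (n + k) / (k + 2) \<le> n" using k by (simp add: field_simps)
  qed simp
  finally show "\<eta>1 * (C0 * (R powr (k + 2) / (k + 2))) < n * r0 powr k" by (simp add: rp mult.commute)
qed

text \<open>With \<open>\<Lambda>' = bb r * r\<close> and \<open>\<Psi> = exp \<Lambda> * \<psi>\<close> the flux of \<open>\<Psi>\<close> is \<open>exp \<Lambda> * \<psi>' / e\<close> times the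
  radial unit vector. Choosing \<open>\<psi>' = - e * r powr (k + 1)\<close> removes the coefficients from the flux, and the
  exponent makes its divergence dominate the drift.\<close>

lemma radial_barrier:
  fixes U :: "(real^'n::finite) set" and A :: "real^'n \<Rightarrow> real^'n^'n" and b :: "real^'n \<Rightarrow> real^'n"
  assumes r0: "0 < r0" "r0 < R" and U: "open U" "U \<subseteq> ball 0 R - cball 0 r0"
    and bb: "C1_seg r0 R bb" and e: "C1_seg r0 R e" "\<And>r. r \<in> {r0..R} \<Longrightarrow> 0 < e r" "\<And>r. r \<in> {r0..R} \<Longrightarrow> e r \<le> C0"
    and k: "k \<ge> 0" "\<And>r. r \<in> {r0..R} \<Longrightarrow> - k \<le> bb r * r\<^sup>2"
    and A: "\<And>x. x \<in> U \<Longrightarrow> A x *v x = (1 / e (norm x)) *\<^sub>R x" and b: "\<And>x. x \<in> U \<Longrightarrow> b x = bb (norm x) *\<^sub>R x"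
    and \<eta>: "\<eta> > 0" "\<eta> * (C0 * (R powr (k + 2) / (k + 2))) < real CARD('n) * r0 powr k"
  obtains \<Psi> GP HP \<psi>0 \<psi>1 where "twice_diff_on U \<Psi> GP HP" "continuous_on (closure U) \<Psi>"
    "\<And>x. x \<in> closure U \<Longrightarrow> \<psi>0 \<le> \<Psi> x" "\<And>x. x \<in> closure U \<Longrightarrow> \<Psi> x \<le> \<psi>1" "\<psi>0 > 0"
    "\<And>x. x \<in> U \<Longrightarrow> (\<Sum>i\<in>UNIV. pd i (\<lambda>y. (A y *v (GP y - \<Psi> y *\<^sub>R b y)) $ i) x) \<le> - \<eta> * \<Psi> x"
proof -
  define n where "n = real CARD('n)"
  define J where "J = C0 * (R powr (k + 2) / (k + 2))"
  \<comment> \<open>The largest additive constant with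
    \<open>\<eta> * (\<epsilon> + J) \<le> n * r0 powr k\<close>; the strict rate inequality makes
    it positive. \<open>J\<close> bounds the variation of \<open>\<psi>\<close>, replacing
    \<open>e\<close> by \<open>C0\<close> and dropping the lower limit.\<close>
  define \<epsilon> where "\<epsilon> = n * r0 powr k / \<eta> - J"
  have \<epsilon>: "\<epsilon> > 0" "\<eta> * (\<epsilon> + J) = n * r0 powr k" using \<eta> by (auto simp: \<epsilon>_def J_def n_def field_simps)
  define I1 where "I1 r = integral {r0..r} (\<lambda>\<rho>. e \<rho> * \<rho> powr (k + 1))" for r
  define \<psi> where "\<psi> r = \<epsilon> + I1 R - I1 r" for r
  define \<Lambda> where "\<Lambda> r = integral {r0..r} (\<lambda>\<rho>. bb \<rho> * \<rho>)" for r
  define P where "P r = exp (\<Lambda> r) * \<psi> r" for r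
  \<comment> \<open>\<open>W\<close> is the derivative of \<open>P\<close> divided by
    \<open>r\<close>, so the gradient of \<open>\<Psi>\<close> is
    \<open>W (norm x) *\<^sub>R x\<close>; likewise the flux will be
    \<open>Q (norm x) *\<^sub>R x\<close>.\<close>
  define W where "W r = exp (\<Lambda> r) * (bb r * \<psi> r - e r * r powr k)" for r
  define Q where "Q r = - (exp (\<Lambda> r) * r powr k)" for r
  have c1: "continuous_on {r0..R} (\<lambda>\<rho>. e \<rho> * \<rho> powr (k + 1))" "continuous_on {r0..R} (\<lambda>\<rho>. bb \<rho> * \<rho>)"
    using r0 by (auto intro!: C1_seg_continuous C1_seg_mult C1_seg_powr C1_seg_id e(1) bb)
  have int: "(\<lambda>\<rho>. e \<rho> * \<rho> powr (k + 1)) integrable_on {s..r}" if "r0 \<le> s" "r \<le> R" for s r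
    by (rule integrable_continuous_real) (rule continuous_on_subset[OF c1(1)], use that in auto)
  have nn: "0 \<le> integral {s..r} (\<lambda>\<rho>. e \<rho> * \<rho> powr (k + 1))" if "r0 \<le> s" "r \<le> R" for s r
    by (rule integral_nonneg[OF int[OF that]]) (use that in \<open>auto intro!: mult_nonneg_nonneg less_imp_le[OF e(2)]\<close>)
  have I1: "I1 R \<le> J"
  proof -
    have hi: "((\<lambda>\<rho>. \<rho> powr (k + 1)) has_integral (R powr (k + 2) / (k + 2) - r0 powr (k + 2) / (k + 2))) {r0..R}"
    proof (rule fundamental_theorem_of_calculus)
      show "r0 \<le> R" using r0 by simp
      fix x assume "x \<in> {r0..R}"
      then have "x > 0" using r0 by simp
      then have "((\<lambda>\<rho>. \<rho> powr (k + 2) / (k + 2)) has_real_derivative x powr (k + 1)) (at x)"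
        using k(1) by (auto intro!: derivative_eq_intros simp: add.commute)
      then show "((\<lambda>\<rho>. \<rho> powr (k + 2) / (k + 2)) has_vector_derivative x powr (k + 1)) (at x within {r0..R})"
        by (simp add: has_real_derivative_iff_has_vector_derivative has_vector_derivative_at_within)
    qed
    have "I1 R \<le> integral {r0..R} (\<lambda>\<rho>. C0 * \<rho> powr (k + 1))"
      unfolding I1_def
      using has_integral_integrable[OF has_integral_mult_right[OF hi, of C0]]
      by (intro integral_le int) (auto intro!: mult_right_mono e(3))
    also have "\<dots> = C0 * (R powr (k + 2) / (k + 2) - r0 powr (k + 2) / (k + 2))"
      by (rule integral_unique[OF has_integral_mult_right[OF hi]])
    also have "\<dots> \<le> J"
      using e(2,3)[of r0] r0 k(1) unfolding J_def by (intro mult_left_mono) auto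
    finally show ?thesis .
  qed
  have \<psi>b: "\<epsilon> \<le> \<psi> r" "\<psi> r \<le> \<epsilon> + J" if r: "r \<in> {r0..R}" for r
  proof -
    have "I1 r + integral {r..R} (\<lambda>\<rho>. e \<rho> * \<rho> powr (k + 1)) = I1 R"
      unfolding I1_def by (rule Henstock_Kurzweil_Integration.integral_combine) (use r int[of r0 R] in auto)
    then show "\<epsilon> \<le> \<psi> r" using nn[of r R] r by (simp add: \<psi>_def)
    show "\<psi> r \<le> \<epsilon> + J" using nn[of r0 r] r I1 by (simp add: \<psi>_def I1_def)
  qed
  have C: "C1_seg r0 R \<Lambda>" "C1_seg r0 R \<psi>"
    unfolding \<Lambda>_def \<psi>_def I1_def
    by (intro C1_seg_integral c1 C1_seg_diff C1_seg_const)+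
  have CP: "C1_seg r0 R P" unfolding P_def[abs_def] by (intro C1_seg_mult C1_seg_exp C)
  have CW: "C1_seg r0 R W"
    unfolding W_def[abs_def] using r0 by (intro C1_seg_mult C1_seg_exp C C1_seg_diff bb e C1_seg_powr C1_seg_id) auto
  have dL: "(\<Lambda> has_real_derivative bb r * r) (at r)" if "r0 < r" "r < R" for r
    unfolding \<Lambda>_def by (rule C1_seg_at_interior[OF integral_has_real_derivative[OF c1(2)]]) (use that in auto)
  have dI: "(I1 has_real_derivative e r * r powr (k + 1)) (at r)" if "r0 < r" "r < R" for r
    unfolding I1_def by (rule C1_seg_at_interior[OF integral_has_real_derivative[OF c1(1)]]) (use that in auto)
  have dP: "(P has_real_derivative W r * r) (at r)" if r: "r0 < r" "r < R" for r
  proof -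
    have "r powr (k + 1) = r powr k * r" using r r0 by (simp add: powr_add)
    moreover have "(P has_real_derivative exp (\<Lambda> r) * (bb r * r) * \<psi> r + exp (\<Lambda> r) * (- (e r * r powr (k + 1)))) (at r)"
      unfolding P_def \<psi>_def by (rule derivative_eq_intros dL[OF r] dI[OF r] refl | simp)+
    ultimately show ?thesis by (simp add: W_def algebra_simps)
  qed
  have dQ: "(Q has_real_derivative - (exp (\<Lambda> r) * (bb r * r) * r powr k + exp (\<Lambda> r) * (k * r powr (k - 1)))) (at r)"
    if r: "r0 < r" "r < R" for r
  proof -
    have "r > 0" using r r0 by simp
    then show ?thesis unfolding Q_def by (auto intro!: derivative_eq_intros dL[OF r] simp: algebra_simps)
  qed
  have Ur: "r0 < norm x" "norm x < R" if "x \<in> U" for x using U(2) that by auto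
  have clU: "norm x \<in> {r0..R}" if "x \<in> closure U" for x
  proof -
    have "closure U \<subseteq> cball 0 R - ball 0 r0"
      by (rule closure_minimal) (use U(2) in \<open>force, intro closed_Diff closed_cball open_ball\<close>)
    then show ?thesis using that by force
  qed
  have bU: "bounded U" using U(2) bounded_ball bounded_subset by blast
  define \<Psi> where "\<Psi> x = P (norm x)" for x :: "real^'n"
  define GP where "GP x = W (norm x) *\<^sub>R x" for x :: "real^'n"
  have \<Psi>d: "(\<Psi> has_derivative (\<lambda>h. GP x \<bullet> h)) (at x)" if "x \<in> U" for x
  proof -
    have "x \<noteq> 0" using Ur[OF that] r0 by auto
    then have "((\<lambda>y. P (norm y)) has_derivative (\<lambda>h. ((W (norm x) * norm x / norm x) *\<^sub>R x) \<bullet> h)) (at x)"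
      by (intro radial_has_derivative dP Ur that)
    then show ?thesis using \<open>x \<noteq> 0\<close> by (simp add: \<Psi>_def[abs_def] GP_def)
  qed
  have "bC1_on U (\<lambda>x. GP x $ j)" for j
    unfolding GP_def vector_scaleR_component real_scaleR_def
    by (intro bC1_on_mult bC1_on_nth bU C1_seg_bC1_on[OF CW U(2) r0(1)])
  then obtain HP where HP: "twice_diff_on U \<Psi> GP HP"
    using twice_diff_on_of_bC1_on[of U \<Psi> GP] \<Psi>d by blast
  have Pc: "continuous_on {r0..R} P" by (rule C1_seg_continuous[OF CP])
  have ne: "{r0..R} \<noteq> {}" using r0 by simp
  obtain lo where lo: "lo \<in> {r0..R}" "\<And>r. r \<in> {r0..R} \<Longrightarrow> P lo \<le> P r"
    using continuous_attains_inf[OF compact_Icc ne Pc] by blast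
  obtain hi where hi: "\<And>r. r \<in> {r0..R} \<Longrightarrow> P r \<le> P hi"
    using continuous_attains_sup[OF compact_Icc ne Pc] by blast
  show thesis
  proof (rule that[OF HP])
    show "continuous_on (closure U) \<Psi>"
      unfolding \<Psi>_def[abs_def] by (rule continuous_on_compose2[OF Pc]) (use clU in \<open>auto intro!: continuous_intros\<close>)
    show "P lo \<le> \<Psi> x" "\<Psi> x \<le> P hi" if "x \<in> closure U" for x
      using lo(2) hi clU[OF that] by (auto simp: \<Psi>_def)
    have "\<psi> lo > 0" using \<psi>b(1)[OF lo(1)] \<epsilon>(1) by linarith
    then show "P lo > 0" by (simp add: P_def)
    fix x assume x: "x \<in> U"
    define r where "r = norm x"
    have r: "r0 < r" "r < R" using Ur[OF x] by (auto simp: r_def)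
    have x0: "x \<noteq> 0" using r r0 by (auto simp: r_def)
    have flux: "A y *v (GP y - \<Psi> y *\<^sub>R b y) = Q (norm y) *\<^sub>R y" if y: "y \<in> U" for y
    proof -
      have "e (norm y) > 0" using e(2) Ur[OF y] by simp
      moreover have "GP y - \<Psi> y *\<^sub>R b y = (W (norm y) - P (norm y) * bb (norm y)) *\<^sub>R y"
        by (simp add: GP_def \<Psi>_def b[OF y] algebra_simps)
      moreover have "W (norm y) - P (norm y) * bb (norm y) = Q (norm y) * e (norm y)"
        by (simp add: W_def P_def Q_def algebra_simps)
      ultimately show ?thesis by (simp add: matrix_vector_mult_scaleR A[OF y])
    qed
    define Q' where "Q' = - (exp (\<Lambda> r) * (bb r * r) * r powr k + exp (\<Lambda> r) * (k * r powr (k - 1)))"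
    have "pd i (\<lambda>y. (A y *v (GP y - \<Psi> y *\<^sub>R b y)) $ i) x = Q' / r * (x $ i)\<^sup>2 + Q r" for i
    proof -
      have "((\<lambda>y. Q (norm y)) has_derivative (\<lambda>h. ((Q' / norm x) *\<^sub>R x) \<bullet> h)) (at x)"
        unfolding Q'_def r_def by (intro radial_has_derivative dQ Ur x x0)
      from has_derivative_mult[OF this, of "\<lambda>y. y $ i" "\<lambda>h. h $ i"]
      have "((\<lambda>y. Q (norm y) * y $ i) has_derivative (\<lambda>h. Q (norm x) * h $ i + ((Q' / norm x) *\<^sub>R x) \<bullet> h * x $ i)) (at x)"
        by (simp add: bounded_linear_vec_nth bounded_linear_imp_has_derivative)
      moreover have "Q (norm x) * h $ i + ((Q' / norm x) *\<^sub>R x) \<bullet> h * x $ i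
        = (Q (norm x) *\<^sub>R axis i 1 + (Q' / norm x * x $ i) *\<^sub>R x) \<bullet> h" for h
        by (simp add: inner_add_left inner_axis' mult_ac)
      ultimately have "pd i (\<lambda>y. Q (norm y) * y $ i) x = (Q (norm x) *\<^sub>R axis i 1 + (Q' / norm x * x $ i) *\<^sub>R x) $ i"
        by (intro has_derivative_pd) simp
      moreover have "pd i (\<lambda>y. (A y *v (GP y - \<Psi> y *\<^sub>R b y)) $ i) x = pd i (\<lambda>y. Q (norm y) * y $ i) x"
        by (rule pd_cong[OF U(1) x]) (simp add: flux)
      ultimately show ?thesis by (simp add: r_def power2_eq_square axis_def)
    qed
    then have "(\<Sum>i\<in>UNIV. pd i (\<lambda>y. (A y *v (GP y - \<Psi> y *\<^sub>R b y)) $ i) x) = Q' / r * (\<Sum>i\<in>UNIV. (x $ i)\<^sup>2) + n * Q r"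
      by (simp add: sum.distrib sum_distrib_left n_def)
    also have "(\<Sum>i\<in>UNIV. (x $ i)\<^sup>2) = r\<^sup>2"
      unfolding r_def power2_norm_eq_inner inner_vec_def by (simp add: power2_eq_square)
    also have "Q' / r * r\<^sup>2 + n * Q r = - (exp (\<Lambda> r) * r powr k * (bb r * r\<^sup>2 + k + n))"
    proof -
      have "r powr (k - 1) * r = r powr k" using r r0 by (simp add: powr_diff)
      then have "Q' * r = - (exp (\<Lambda> r) * (bb r * r\<^sup>2) * r powr k + exp (\<Lambda> r) * k * r powr k)"
        by (simp add: Q'_def algebra_simps power2_eq_square)
      moreover have "Q' / r * r\<^sup>2 = Q' * r" using r r0 by (simp add: power2_eq_square)
      ultimately show ?thesis by (simp add: Q_def algebra_simps)
    qed
    \<comment> \<open>Since \<open>bb r * r\<^sup>2 \<ge> - k\<close>, the bracket is at least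
      \<open>n\<close>: the exponent \<open>k\<close> has absorbed the drift. The rest is
      \<open>r powr k \<ge> r0 powr k\<close> and the choice of \<open>\<epsilon>\<close>.\<close>
    also have "\<dots> \<le> - (exp (\<Lambda> r) * (\<eta> * \<psi> r))"
    proof -
      have "\<eta> * \<psi> r \<le> \<eta> * (\<epsilon> + J)" using \<psi>b(2)[of r] r \<eta>(1) by (intro mult_left_mono) auto
      also have "\<dots> = r0 powr k * n" using \<epsilon>(2) by simp
      also have "\<dots> \<le> r powr k * (bb r * r\<^sup>2 + k + n)"
        using k(2)[of r] r r0 k(1) by (intro mult_mono powr_mono2) (auto simp: n_def)
      finally show ?thesis by (simp add: mult.assoc)
    qed
    also have "\<dots> = - \<eta> * \<Psi> x" by (simp add: \<Psi>_def P_def r_def)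
    finally show "(\<Sum>i\<in>UNIV. pd i (\<lambda>y. (A y *v (GP y - \<Psi> y *\<^sub>R b y)) $ i) x) \<le> - \<eta> * \<Psi> x" .
  qed
qed

section \<open>Velocity decay for the two-phase flow\<close>

text \<open>\<open>s\<close> is the length of the velocity vector. Writing the rank-one coefficient
  with \<open>g'(s) * s\<close> makes the formula cover \<open>c = 0\<close> too, where it vanishes
  as in the case \<open>u = 0\<close> of \<open>Gjac\<close>.\<close>

lemma Gjac_radial:
  fixes x :: "real^'n::finite"
  assumes x: "x \<noteq> 0" and s: "s = \<bar>c\<bar> * norm x powr (1 - n)"
  shows "Gjac (gfun a \<alpha> N) (gder a \<alpha> N) ((c * norm x powr (- n)) *\<^sub>R x)
    = radmat (gfun a \<alpha> N s) (gder a \<alpha> N s * s / (norm x)\<^sup>2) x"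
proof (cases "c = 0")
  case True
  then show ?thesis by (simp add: Gjac_def s radmat_def)
next
  case False
  define w where "w = c * norm x powr (- n)"
  have r: "norm x > 0" using x by simp
  have nu: "norm (w *\<^sub>R x) = s"
    using r by (simp add: w_def s abs_mult powr_diff powr_minus divide_inverse)
  have s0: "s > 0" using False r by (simp add: s)
  have "w\<^sup>2 = s\<^sup>2 / (norm x)\<^sup>2"
  proof -
    have "s = \<bar>w\<bar> * norm x" using nu by simp
    then show ?thesis using r by (simp add: power_mult_distrib)
  qed
  then have "gder a \<alpha> N s / s * w\<^sup>2 = gder a \<alpha> N s * s / (norm x)\<^sup>2"
    using s0 by (simp add: power2_eq_square)
  moreover have "w *\<^sub>R x \<noteq> 0" using nu s0 by auto
  moreover have "(gder a \<alpha> N s / s) *\<^sub>R (\<chi> i j. (w *\<^sub>R x) $ i * (w *\<^sub>R x) $ j)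
      = (gder a \<alpha> N s / s * w\<^sup>2) *\<^sub>R (\<chi> i j. x $ i * x $ j)"
    by (simp add: vec_eq_iff power2_eq_square)
  ultimately show ?thesis
    by (simp only: w_def[symmetric] Gjac_def nu radmat_def if_False)
qed

lemma Gvec_radial:
  fixes x :: "real^'n::finite"
  assumes x: "x \<noteq> 0" and s: "s = \<bar>c\<bar> * norm x powr (1 - n)"
  shows "Gvec g ((c * norm x powr (- n)) *\<^sub>R x) = (g s * (c * norm x powr (- n))) *\<^sub>R x"
proof -
  have "norm ((c * norm x powr (- n)) *\<^sub>R x) = s"
    using x by (simp add: s abs_mult powr_diff powr_minus divide_inverse)
  then show ?thesis by (simp add: Gvec_def)
qed

lemma C_k_on_derivs:
  assumes "C_k_on 7 S F" "s \<in> S"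
  shows "(F has_real_derivative deriv F s) (at s)"
    "(deriv F has_real_derivative deriv (deriv F) s) (at s)"
proof -
  have "(deriv ^^ 0) F differentiable at s" "(deriv ^^ 1) F differentiable at s"
    using assms unfolding C_k_on_def by (meson zero_less_numeral one_less_numeral_iff semiring_norm(76,77,84))+
  then show "(F has_real_derivative deriv F s) (at s)"
    "(deriv F has_real_derivative deriv (deriv F) s) (at s)"
    by (simp_all add: DERIV_deriv_iff_real_differentiable)
qed

lemma C_k_on_continuous:
  assumes "C_k_on 7 S F"
  shows "continuous_on S F" "continuous_on S (deriv F)" "continuous_on S (deriv (deriv F))"
proof -
  have "continuous_on S ((deriv ^^ j) F)" if "j \<le> 7" for j
    using assms that unfolding C_k_on_def by blast
  from this[of 0] this[of 1] this[of 2]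
  show "continuous_on S F" "continuous_on S (deriv F)" "continuous_on S (deriv (deriv F))"
    by (simp_all add: numeral_2_eq_2)
qed

lemma phase_function_pos:
  assumes f: "continuous_on {0..1} f" "C_k_on 1 {0<..<1} f" and s: "s \<in> {0<..<1}"
  shows "f 0 = 0 \<Longrightarrow> \<forall>s\<in>{0<..<1}. deriv f s > 0 \<Longrightarrow> f s > 0"
    and "f 1 = 0 \<Longrightarrow> \<forall>s\<in>{0<..<1}. deriv f s < 0 \<Longrightarrow> f s > 0"
proof -
  have d: "(f has_real_derivative deriv f y) (at y)" if "y \<in> {0<..<1}" for y
    using f(2) that unfolding C_k_on_def
    by (metis DERIV_deriv_iff_real_differentiable funpow_0 less_one)
  show "f s > 0" if "f 0 = 0" "\<forall>s\<in>{0<..<1}. deriv f s > 0"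
  proof -
    have "f 0 < f s"
    proof (rule DERIV_pos_imp_increasing_open[where f = f and a = 0 and b = s])
      show "0 < s" using s by simp
      show "\<exists>y. (f has_real_derivative y) (at x) \<and> 0 < y" if "0 < x" "x < s" for x
        using d[of x] \<open>\<forall>s\<in>{0<..<1}. deriv f s > 0\<close> that s by auto
      show "continuous_on {0..s} f" by (rule continuous_on_subset[OF f(1)]) (use s in auto)
    qed
    then show ?thesis using that by simp
  qed
  show "f s > 0" if "f 1 = 0" "\<forall>s\<in>{0<..<1}. deriv f s < 0"
  proof -
    have "f s > f 1"
    proof (rule DERIV_neg_imp_decreasing_open[where f = f and a = s and b = 1])
      show "s < 1" using s by simp
      show "\<exists>y. (f has_real_derivative y) (at x) \<and> y < 0" if "s < x" "x < 1" for x
        using d[of x] \<open>\<forall>s\<in>{0<..<1}. deriv f s < 0\<close> that s by auto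
      show "continuous_on {s..1} f" by (rule continuous_on_subset[OF f(1)]) (use s in auto)
    qed
    then show ?thesis using that by simp
  qed
qed

lemma continuous_Icc_Sup_Inf:
  fixes f :: "real \<Rightarrow> real"
  assumes "continuous_on {a..b} f" "s \<in> {a..b}"
  shows "f s \<le> Sup (f ` {a..b})" "Inf (f ` {a..b}) \<le> f s"
    and "(\<And>s. s \<in> {a..b} \<Longrightarrow> f s > 0) \<Longrightarrow> Inf (f ` {a..b}) > 0"
proof -
  have c: "compact (f ` {a..b})" by (rule compact_continuous_image[OF assms(1) compact_Icc])
  then have b: "bdd_above (f ` {a..b})" "bdd_below (f ` {a..b})"
    using compact_imp_bounded[OF c] by (simp_all add: bounded_imp_bdd_above bounded_imp_bdd_below)
  show "f s \<le> Sup (f ` {a..b})" "Inf (f ` {a..b}) \<le> f s"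
    using assms(2) b by (auto intro: cSup_upper cInf_lower)
  have "{a..b} \<noteq> {}" using assms(2) by blast
  then obtain y where y: "y \<in> {a..b}" "\<And>r. r \<in> {a..b} \<Longrightarrow> f y \<le> f r"
    using continuous_attains_inf[OF compact_Icc _ assms(1)] by blast
  show "Inf (f ` {a..b}) > 0" if "\<And>s. s \<in> {a..b} \<Longrightarrow> f s > 0"
  proof -
    have "f y \<le> Inf (f ` {a..b})" by (rule cInf_greatest) (use y in auto)
    then show ?thesis using that[OF y(1)] by simp
  qed
qed

text \<open>The rows of a symmetric square root serve as the fields \<open>Mc\<close>; the second
  hypothesis matches the rank-one coefficients.\<close>

lemma radmat_square_nth:
  assumes "p\<^sup>2 = P" "2 * p * w + w\<^sup>2 * (norm x)\<^sup>2 = m"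
  shows "(\<Sum>k\<in>UNIV. radmat p w x $ k $ i * radmat p w x $ k $ j) = radmat P m x $ i $ j"
proof -
  have "radmat p w x $ k $ i = radmat p w x $ i $ k" for k by (simp add: radmat_nth mult.commute)
  then have "(\<Sum>k\<in>UNIV. radmat p w x $ k $ i * radmat p w x $ k $ j) = (radmat p w x ** radmat p w x) $ i $ j"
    by (simp add: matrix_matrix_mult_def)
  also have "radmat p w x ** radmat p w x = radmat P m x"
    unfolding radmat_mult assms(1)[symmetric] assms(2)[symmetric] by (simp add: power2_eq_square algebra_simps)
  finally show ?thesis .
qed

lemma scaleR_radmat: "k *\<^sub>R radmat p m x = radmat (k * p) (k * m) x"
  by (simp add: vec_eq_iff radmat_nth distrib_left)

lemma radmat_add: "radmat p m x + radmat p' m' x = radmat (p + p') (m + m') x"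
  by (simp add: vec_eq_iff radmat_nth algebra_simps)

theorem theorem4p9:
  fixes a1 a2 \<alpha>1 \<alpha>2 :: "nat \<Rightarrow> real" and N1 N2 :: nat
    and f1 f2 pcd :: "real \<Rightarrow> real"
    and r0 c1 c2 s0 R sl su :: real
    and Shat :: "real \<Rightarrow> real"
    and U :: "(real^'n::finite) set"
    and V Vt :: "real^'n \<Rightarrow> real \<Rightarrow> real^'n"
    and \<sigma>0 :: "real^'n \<Rightarrow> real"
    and gb \<sigma> :: "real^'n \<Rightarrow> real \<Rightarrow> real"
    and n :: nat and g1 g2 g1' g2' F1 F2 :: "real \<Rightarrow> real"
    and Sstar :: "real^'n \<Rightarrow> real" and u1 u2 :: "real^'n \<Rightarrow> real^'n"
    and B A :: "real^'n \<Rightarrow> real^'n^'n" and b :: "real^'n \<Rightarrow> real^'n"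
    and c grad v1 v2 :: "real^'n \<Rightarrow> real \<Rightarrow> real^'n"
    and \<Gamma> :: "(real^'n) set" and D :: "((real^'n) \<times> real) set"
    and \<rho> d0 d1 d2 d3 d4 \<mu>1 \<mu>2 \<mu>3 C0 C1 C2 \<kappa>0 sR q \<eta>0 \<eta>1 \<Delta>6 \<Delta>7 sup\<sigma>0 :: real
  assumes n_def: "n = CARD('n)"
    and "g1 = gfun a1 \<alpha>1 N1" and "g2 = gfun a2 \<alpha>2 N2"
    and "g1' = gder a1 \<alpha>1 N1" and "g2' = gder a2 \<alpha>2 N2"
    and "F1 = (\<lambda>s. 1 / (pcd s * f1 s))" and "F2 = (\<lambda>s. 1 / (pcd s * f2 s))"
    and "Sstar = (\<lambda>x. Shat (norm x))"
    and "u1 = (\<lambda>x::real^'n. (c1 * norm x powr (- real n)) *\<^sub>R x)"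
    and "u2 = (\<lambda>x::real^'n. (c2 * norm x powr (- real n)) *\<^sub>R x)"
    and "B = (\<lambda>x. F1 (Sstar x) *\<^sub>R Gjac g1 g1' (u1 x) + F2 (Sstar x) *\<^sub>R Gjac g2 g2' (u2 x))"
    and "A = (\<lambda>x. matrix_inv (B x))"
    and "b = (\<lambda>x. deriv F2 (Sstar x) *\<^sub>R Gvec g2 (u2 x) - deriv F1 (Sstar x) *\<^sub>R Gvec g1 (u1 x))"
    and "c = (\<lambda>x t. F1 (Sstar x) *\<^sub>R (Gjac g1 g1' (u1 x) *v V x t))"
    and "\<Gamma> = frontier U"
    and "D = U \<times> {0<..}"
    and "\<rho> = r0 powr (1 - real n)"
    and "d0 = min (g1 0) (g2 0)"
    and "d1 = g1 (\<bar>c1\<bar> * \<rho>) + g2 (\<bar>c2\<bar> * \<rho>)"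
    and "d2 = g1 (\<bar>c1\<bar> * \<rho>) * \<bar>c1\<bar> * \<rho> + g2 (\<bar>c2\<bar> * \<rho>) * \<bar>c2\<bar> * \<rho>"
    and "d3 = (if c1 = 0 then 0 else g1' (\<bar>c1\<bar> * \<rho>) * \<bar>c1\<bar> * \<rho>)
            + (if c2 = 0 then 0 else g2' (\<bar>c2\<bar> * \<rho>) * \<bar>c2\<bar> * \<rho>)"
    and "d4 = d1 + d3"
    and "\<mu>1 = Sup (F1 ` {sl..su}) + Sup (F2 ` {sl..su})"
    and "\<mu>2 = Inf (F1 ` {sl..su}) + Inf (F2 ` {sl..su})"
    and "\<mu>3 = Sup ((\<lambda>s. \<bar>deriv F1 s\<bar>) ` {sl..su}) + Sup ((\<lambda>s. \<bar>deriv F2 s\<bar>) ` {sl..su})"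
    and "C0 = d4 * \<mu>1" and "C1 = d0 * \<mu>2" and "C2 = d2 * \<mu>3"
    and "\<kappa>0 = C0 / (2 * C1)"
    and "sR = \<kappa>0 * (real n + C2 * R)"
    and "q = \<kappa>0 * C0 / (2 * sR)"
    and "\<eta>0 = (r0 / R) powr (2 * sR)"
    and "\<eta>1 = ln (1 + \<eta>0) / (q * R\<^sup>2)"
    and "grad = (\<lambda>x t. (\<chi> i. pd i (\<lambda>y. \<sigma> y t) x))"
    and "v2 = (\<lambda>x t. A x *v (grad x t - \<sigma> x t *\<^sub>R b x) + A x *v c x t)"
    and "v1 = (\<lambda>x t. V x t - v2 x t)"
    and "\<Delta>6 = Sup ((\<lambda>(x,t). Vsize V x t) ` D)"
    and "\<Delta>7 = Sup ((\<lambda>(x,t). \<bar>gb x t\<bar>) ` (\<Gamma> \<times> {0..}))"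
    and "sup\<sigma>0 = Sup ((\<lambda>x. \<bar>\<sigma>0 x\<bar>) ` U)"
    and n2: "n \<ge> 2"
    (* the functions g_i *)
    and g1c: "gcoef a1 \<alpha>1 N1" and g2c: "gcoef a2 \<alpha>2 N2"
    (* f_i and p_c' *)
    and f1c: "continuous_on {0..1} f1" and f2c: "continuous_on {0..1} f2"
    and f1C1: "C_k_on 1 {0<..<1} f1" and f2C1: "C_k_on 1 {0<..<1} f2"
    and f10: "f1 0 = 0" and f21: "f2 1 = 0"
    and fmono: "\<forall>s\<in>{0<..<1}. deriv f1 s > 0 \<and> deriv f2 s < 0"
    and pcC1: "C_k_on 1 {0<..<1} pcd" and pcpos: "\<forall>s\<in>{0<..<1}. pcd s > 0"
    (* parameters and the radial profile *)
    and r0pos: "r0 > 0" and cnz: "c1\<^sup>2 + c2\<^sup>2 > 0" and s0: "0 < s0" "s0 < 1"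
    and Shat0: "Shat r0 = s0"
    and Shat_ode: "\<forall>r\<in>{r0..R}. (Shat has_real_derivative
          (Gsc g2 (c2 * r powr (1 - real n)) * F2 (Shat r)
           - Gsc g1 (c1 * r powr (1 - real n)) * F1 (Shat r))) (at r within {r0..R})"
    and R: "r0 < R"
    and sbounds: "0 < sl" "su < 1" "\<forall>r\<in>{r0..R}. sl \<le> Shat r \<and> Shat r \<le> su"
    (* the domain *)
    and Uopen: "open U" and Ubdd: "bounded U"
    and Usub: "U \<subseteq> ball 0 R - cball 0 r0"
    (* condition (E1) *)
    and F1C7: "C_k_on 7 {0<..<1} F1" and F2C7: "C_k_on 7 {0<..<1} F2"
    and VC6: "\<forall>k. Cx_bar 6 U {0..} (\<lambda>x t. V x t $ k)"
    and Vt_deriv: "\<forall>x\<in>closure U. \<forall>t\<ge>0.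
          ((\<lambda>s. V x s) has_vector_derivative Vt x t) (at t within {0..})"
    and VtC3: "\<forall>k. Cx_bar 3 U {0..} (\<lambda>x t. Vt x t $ k)"
    (* finiteness of \<Delta>6 and \<Delta>7 *)
    and Delta6: "bdd_above ((\<lambda>(x,t). Vsize V x t) ` D)"
    and Delta7: "bdd_above ((\<lambda>(x,t). \<bar>gb x t\<bar>) ` (\<Gamma> \<times> {0..}))"
    (* data of (\<Sigma>) *)
    and \<sigma>0c: "continuous_on (closure U) \<sigma>0"
    and gbc: "continuous_on (\<Gamma> \<times> {0..}) (\<lambda>(x,t). gb x t)"
    and compat: "\<forall>x\<in>\<Gamma>. \<sigma>0 x = gb x 0"
    (* \<sigma> is the classical solution of (\<Sigma>) *)
    and \<sigma>c: "continuous_on (closure U \<times> {0..}) (\<lambda>(x,t). \<sigma> x t)"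
    and \<sigma>C21: "C21 U \<sigma>"
    and \<sigma>pde: "\<forall>x\<in>U. \<forall>t>0. deriv (\<lambda>s. \<sigma> x s) t =
          (\<Sum>i\<in>UNIV. pd i (\<lambda>y. (A y *v (grad y t - \<sigma> y t *\<^sub>R b y)) $ i) x)
        + (\<Sum>i\<in>UNIV. pd i (\<lambda>y. (A y *v c y t) $ i) x)"
    and \<sigma>bdry: "\<forall>x\<in>\<Gamma>. \<forall>t>0. \<sigma> x t = gb x t"
    and \<sigma>init: "\<forall>x\<in>U. \<sigma> x 0 = \<sigma>0 x"
  shows "(\<forall>U'. open U' \<and> closure U' \<subseteq> U \<longrightarrow>
           (\<exists>M>0. \<forall>t>0. \<forall>x\<in>U'.
              norm (v1 x t) \<le> M * (1 + 1 / sqrt t) * (exp (- \<eta>1 * t) * sup\<sigma>0 + \<Delta>6 + sqrt \<Delta>6 + \<Delta>7)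
            \<and> norm (v2 x t) \<le> M * (1 + 1 / sqrt t) * (exp (- \<eta>1 * t) * sup\<sigma>0 + \<Delta>6 + sqrt \<Delta>6 + \<Delta>7)))
       \<and> (((\<lambda>t. Sup ((\<lambda>x. Vsize V x t) ` U) + Sup ((\<lambda>x. \<bar>gb x t\<bar>) ` \<Gamma>)) \<longlongrightarrow> 0) at_top
           \<longrightarrow> (\<forall>x\<in>U. ((\<lambda>t. v1 x t) \<longlongrightarrow> 0) at_top \<and> ((\<lambda>t. v2 x t) \<longlongrightarrow> 0) at_top))"
proof (cases "U = {}")
  \<comment> \<open>A supremum over the empty set carries no information, so this case is separated;
    both claims are then vacuous in \<open>x\<close>.\<close>
  case True
  then show ?thesis by (auto intro!: exI[of _ "1::real"])
next
  case False
  note g_def = assms(2-5) and F_def = assms(6,7) and S_def = assms(8) and u_def = assms(9,10)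
    and B_def = assms(11) and A_def = assms(12) and b_def = assms(13) and c_def = assms(14)
    and \<Gamma>_def = assms(15) and D_def = assms(16) and \<rho>_def = assms(17) and d_def = assms(18-22)
    and \<mu>_def = assms(23-25) and C_def = assms(26-28) and rate_def = assms(29-33)
    and grad_def = assms(34) and v2_def = assms(35) and v1_def = assms(36)
    and \<Delta>_def = assms(37,38) and sup_def = assms(39)
  define S01 where "S01 = {0<..<(1::real)}"
  have F_C: "C_k_on 7 S01 F1" "C_k_on 7 S01 F2" using F1C7 F2C7 by (simp_all add: S01_def)
  have S_in: "Shat r \<in> {sl..su}" if "r \<in> {r0..R}" for r using sbounds(3) that by simp
  have seg: "{sl..su} \<subseteq> S01" using sbounds(1,2) by (auto simp: S01_def)
  have S01: "Shat r \<in> S01" if "r \<in> {r0..R}" for r using S_in[OF that] seg by blast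
  have Fpos: "F1 s > 0" "F2 s > 0" if "s \<in> S01" for s
    using phase_function_pos(1)[OF f1c f1C1 _ f10] phase_function_pos(2)[OF f2c f2C1 _ f21] fmono pcpos that
    by (auto simp: F_def S01_def)

  \<comment> \<open>Radial coefficients of \<open>B\<close> and their bounds\<close>
  define \<gamma>1 where "\<gamma>1 r = g1 (\<bar>c1\<bar> * r powr (1 - real n))" for r
  define \<gamma>2 where "\<gamma>2 r = g2 (\<bar>c2\<bar> * r powr (1 - real n))" for r
  define \<kappa>1 where "\<kappa>1 r = g1' (\<bar>c1\<bar> * r powr (1 - real n)) * (\<bar>c1\<bar> * r powr (1 - real n))" for r
  define \<kappa>2 where "\<kappa>2 r = g2' (\<bar>c2\<bar> * r powr (1 - real n)) * (\<bar>c2\<bar> * r powr (1 - real n))" for r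
  have C\<gamma>: "C1_seg r0 R \<gamma>1" "C1_seg r0 R \<gamma>2"
    unfolding \<gamma>1_def \<gamma>2_def g_def by (rule gfun_C1_seg[OF r0pos])+
  have \<kappa>_eq: "\<kappa>1 = (\<lambda>r. gfun (\<lambda>j. if j = 0 then 0 else a1 j * \<alpha>1 j) \<alpha>1 N1 (\<bar>c1\<bar> * r powr (1 - real n)))"
    "\<kappa>2 = (\<lambda>r. gfun (\<lambda>j. if j = 0 then 0 else a2 j * \<alpha>2 j) \<alpha>2 N2 (\<bar>c2\<bar> * r powr (1 - real n)))"
    unfolding \<kappa>1_def \<kappa>2_def g_def by (auto simp: gder_mult_self)
  have C\<kappa>: "C1_seg r0 R \<kappa>1" "C1_seg r0 R \<kappa>2"
    unfolding \<kappa>_eq by (rule gfun_C1_seg[OF r0pos])+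
  have Sc: "continuous_on {r0..R} Shat"
    by (rule DERIV_continuous_on) (use Shat_ode in blast)
  have Fcomp: "continuous_on {r0..R} (\<lambda>r. F1 (Shat r))" "continuous_on {r0..R} (\<lambda>r. F2 (Shat r))"
    using C_k_on_continuous(1)[OF F_C(1)] C_k_on_continuous(1)[OF F_C(2)] Sc S01
    by (auto intro: continuous_on_compose2)
  have CS: "C1_seg r0 R Shat"
  proof (rule C1_segI[OF _ Shat_ode[rule_format]])
    have "Gsc g (c * r powr (1 - real n)) = g (\<bar>c\<bar> * r powr (1 - real n)) * (c * r powr (1 - real n))" for g c r
      by (simp add: Gsc_def abs_mult)
    then show "continuous_on {r0..R} (\<lambda>r. Gsc g2 (c2 * r powr (1 - real n)) * F2 (Shat r)
           - Gsc g1 (c1 * r powr (1 - real n)) * F1 (Shat r))"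
      using C1_seg_continuous[OF C\<gamma>(1)] C1_seg_continuous[OF C\<gamma>(2)] r0pos
      by (auto simp: \<gamma>1_def[abs_def] \<gamma>2_def[abs_def] intro!: continuous_intros Fcomp)
  qed
  define \<phi>1 where "\<phi>1 r = F1 (Shat r)" for r
  define \<phi>2 where "\<phi>2 r = F2 (Shat r)" for r
  have C\<phi>: "C1_seg r0 R \<phi>1" "C1_seg r0 R \<phi>2"
    unfolding \<phi>1_def \<phi>2_def
    by (rule C1_seg_compose[OF CS S01], assumption, erule C_k_on_derivs(1)[OF F_C(1)], rule C_k_on_continuous(2)[OF F_C(1)],
        rule C1_seg_compose[OF CS S01], assumption, erule C_k_on_derivs(1)[OF F_C(2)], rule C_k_on_continuous(2)[OF F_C(2)])
  have C\<phi>': "C1_seg r0 R (\<lambda>r. deriv F1 (Shat r))" "C1_seg r0 R (\<lambda>r. deriv F2 (Shat r))"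
    by (rule C1_seg_compose[OF CS S01], assumption, erule C_k_on_derivs(2)[OF F_C(1)], rule C_k_on_continuous(3)[OF F_C(1)],
        rule C1_seg_compose[OF CS S01], assumption, erule C_k_on_derivs(2)[OF F_C(2)], rule C_k_on_continuous(3)[OF F_C(2)])
  have \<phi>pos: "\<phi>1 r > 0" "\<phi>2 r > 0" if "r \<in> {r0..R}" for r
    using Fpos[OF S01[OF that]] by (simp_all add: \<phi>1_def \<phi>2_def)
  define p where "p r = \<phi>1 r * \<gamma>1 r + \<phi>2 r * \<gamma>2 r" for r
  define m where "m r = \<phi>1 r * (\<kappa>1 r / r\<^sup>2) + \<phi>2 r * (\<kappa>2 r / r\<^sup>2)" for r
  define e where "e r = p r + (\<phi>1 r * \<kappa>1 r + \<phi>2 r * \<kappa>2 r)" for r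
  have e_eq: "p r + m r * r\<^sup>2 = e r" if "r \<in> {r0..R}" for r
    using that r0pos by (simp add: e_def m_def distrib_right)
  have r2: "C1_seg r0 R (\<lambda>r. r\<^sup>2)" unfolding power2_eq_square by (intro C1_seg_mult C1_seg_id)
  have r2pos: "r\<^sup>2 > 0" if "r \<in> {r0..R}" for r using that r0pos by simp
  have Cp: "C1_seg r0 R p" "C1_seg r0 R e"
    unfolding e_def p_def by (intro C1_seg_add C1_seg_mult C\<phi> C\<gamma> C\<kappa>)+

  text \<open>Values at \<open>r \<ge> r0\<close> are controlled by those at \<open>r0\<close>, since \<open>r powr (1 - n)\<close> decreases.\<close>
  have powr_le: "r powr (1 - real n) \<le> \<rho>" if "r \<in> {r0..R}" for r
    unfolding \<rho>_def using that r0pos n2 by (intro powr_mono2') auto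
  have \<alpha>pos: "\<And>j. j \<in> {1..N1} \<Longrightarrow> \<alpha>1 j > 0" "\<And>j. j \<in> {1..N2} \<Longrightarrow> \<alpha>2 j > 0"
    using gcoef_exponent_pos[OF g1c] gcoef_exponent_pos[OF g2c] by auto
  have apos: "\<And>j. j \<in> {1..N1} \<Longrightarrow> a1 j \<ge> 0" "\<And>j. j \<in> {1..N2} \<Longrightarrow> a2 j \<ge> 0"
    using g1c g2c by (auto simp: gcoef_def)
  have g0: "g1 0 = a1 0" "g2 0 = a2 0" using \<alpha>pos by (auto simp: g_def gfun_def)
  have g0pos: "g1 0 > 0" "g2 0 > 0" using g1c g2c by (auto simp: g0 gcoef_def)
  have \<gamma>b: "g1 0 \<le> \<gamma>1 r" "\<gamma>1 r \<le> g1 (\<bar>c1\<bar> * \<rho>)" "g2 0 \<le> \<gamma>2 r" "\<gamma>2 r \<le> g2 (\<bar>c2\<bar> * \<rho>)" if r: "r \<in> {r0..R}" for r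
    unfolding \<gamma>1_def \<gamma>2_def g_def using powr_le[OF r]
    by (auto intro!: gfun_mono apos \<alpha>pos mult_left_mono)
  define \<delta>1 where "\<delta>1 = (if c1 = 0 then 0 else g1' (\<bar>c1\<bar> * \<rho>) * \<bar>c1\<bar> * \<rho>)"
  define \<delta>2 where "\<delta>2 = (if c2 = 0 then 0 else g2' (\<bar>c2\<bar> * \<rho>) * \<bar>c2\<bar> * \<rho>)"
  \<comment> \<open>For \<open>c1 = 0\<close> the second factor of \<open>\<kappa>1\<close> vanishes
    whatever value \<open>g1'\<close> takes at 0, which agrees with the convention in
    \<open>d3\<close>; the same holds for \<open>c2\<close>.\<close>
  have \<kappa>r0: "\<kappa>1 r0 = \<delta>1" "\<kappa>2 r0 = \<delta>2" by (auto simp: \<kappa>1_def \<kappa>2_def \<delta>1_def \<delta>2_def \<rho>_def)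
  have \<kappa>b: "0 \<le> \<kappa>1 r" "\<kappa>1 r \<le> \<delta>1" "0 \<le> \<kappa>2 r" "\<kappa>2 r \<le> \<delta>2" if r: "r \<in> {r0..R}" for r
  proof -
    show "\<kappa>1 r \<le> \<delta>1" "\<kappa>2 r \<le> \<delta>2"
      unfolding \<kappa>r0[symmetric] unfolding \<kappa>_eq using powr_le[OF r] apos \<alpha>pos
      by (auto intro!: gfun_mono mult_left_mono mult_nonneg_nonneg less_imp_le[OF \<alpha>pos(1)] less_imp_le[OF \<alpha>pos(2)] simp: \<rho>_def)
    show "0 \<le> \<kappa>1 r" "0 \<le> \<kappa>2 r"
      unfolding \<kappa>_eq gfun_def using apos \<alpha>pos
      by (auto intro!: sum_nonneg mult_nonneg_nonneg less_imp_le[OF \<alpha>pos(1)] less_imp_le[OF \<alpha>pos(2)])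
  qed
  have Fseg: "continuous_on {sl..su} F1" "continuous_on {sl..su} F2"
    "continuous_on {sl..su} (\<lambda>s. \<bar>deriv F1 s\<bar>)" "continuous_on {sl..su} (\<lambda>s. \<bar>deriv F2 s\<bar>)"
    using C_k_on_continuous(1,2)[OF F_C(1)] C_k_on_continuous(1,2)[OF F_C(2)] seg
    by (auto intro!: continuous_intros intro: continuous_on_subset)
  have \<phi>b: "Inf (F1 ` {sl..su}) \<le> \<phi>1 r" "\<phi>1 r \<le> Sup (F1 ` {sl..su})"
    "Inf (F2 ` {sl..su}) \<le> \<phi>2 r" "\<phi>2 r \<le> Sup (F2 ` {sl..su})" if r: "r \<in> {r0..R}" for r
    using continuous_Icc_Sup_Inf(1,2)[OF Fseg(1) S_in[OF r]] continuous_Icc_Sup_Inf(1,2)[OF Fseg(2) S_in[OF r]]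
    by (simp_all add: \<phi>1_def \<phi>2_def)
  have r0in: "r0 \<in> {r0..R}" using R by simp
  have "Inf (F1 ` {sl..su}) > 0" "Inf (F2 ` {sl..su}) > 0"
    using continuous_Icc_Sup_Inf(3)[OF Fseg(1) S_in[OF r0in]] continuous_Icc_Sup_Inf(3)[OF Fseg(2) S_in[OF r0in]] Fpos seg by blast+
  then have C1pos: "C1 > 0" using g0pos by (simp add: C_def d_def \<mu>_def)
  have pC1: "C1 \<le> p r" if r: "r \<in> {r0..R}" for r
  proof -
    have d0: "d0 > 0" "d0 \<le> \<gamma>1 r" "d0 \<le> \<gamma>2 r" using g0pos \<gamma>b[OF r] by (auto simp: d_def)
    have "C1 = Inf (F1 ` {sl..su}) * d0 + Inf (F2 ` {sl..su}) * d0"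
      by (simp add: C_def \<mu>_def algebra_simps)
    also have "\<dots> \<le> \<phi>1 r * d0 + \<phi>2 r * d0"
      using \<phi>b[OF r] d0(1) by (intro add_mono mult_right_mono) auto
    also have "\<dots> \<le> p r" unfolding p_def
      using \<phi>pos[OF r] d0 by (intro add_mono mult_left_mono) auto
    finally show ?thesis .
  qed
  have pe: "p r \<le> e r" if r: "r \<in> {r0..R}" for r
    using \<phi>pos[OF r] \<kappa>b[OF r] by (simp add: e_def)
  have eC0: "e r \<le> C0" if r: "r \<in> {r0..R}" for r
  proof -
    have nn: "0 \<le> \<gamma>1 r" "0 \<le> \<gamma>2 r" using \<gamma>b[OF r] g0pos by linarith+
    \<comment> \<open>\<open>C0\<close> is a product of two sums, so each phase may be estimated by
      the whole of \<open>d4\<close>.\<close>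
    have "\<gamma>1 r + \<kappa>1 r \<le> d4" "\<gamma>2 r + \<kappa>2 r \<le> d4"
      using \<gamma>b[OF r] \<kappa>b[OF r] nn unfolding d_def \<delta>1_def[symmetric] \<delta>2_def[symmetric] by linarith+
    then have "\<phi>1 r * (\<gamma>1 r + \<kappa>1 r) + \<phi>2 r * (\<gamma>2 r + \<kappa>2 r) \<le> Sup (F1 ` {sl..su}) * d4 + Sup (F2 ` {sl..su}) * d4"
      using \<phi>b[OF r] \<phi>pos[OF r] nn \<kappa>b[OF r] by (intro add_mono mult_mono) auto
    then show ?thesis by (simp add: e_def p_def C_def \<mu>_def algebra_simps)
  qed
  have ppos: "p r > 0" "e r > 0" if r: "r \<in> {r0..R}" for r
    using pC1[OF r] pe[OF r] C1pos by linarith+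
  have C10: "C1 \<le> C0" using pC1[OF r0in] pe[OF r0in] eC0[OF r0in] by linarith

  \<comment> \<open>The drift and the decay rate\<close>
  define bb where "bb r = deriv F2 (Shat r) * (\<gamma>2 r * (c2 * r powr (- real n))) - deriv F1 (Shat r) * (\<gamma>1 r * (c1 * r powr (- real n)))" for r
  have Cbb: "C1_seg r0 R bb"
    unfolding bb_def using r0pos by (intro C1_seg_diff C1_seg_mult C\<phi>' C\<gamma> C1_seg_const C1_seg_powr C1_seg_id) auto
  \<comment> \<open>This is the lower bound for the drift: \<open>bb r * r\<^sup>2\<close> equals
    \<open>r\<close> times a difference that is at least \<open>- C2\<close>, and
    \<open>r \<le> R\<close>. With it \<open>sR\<close> becomes
    \<open>\<kappa>0 * (n + k)\<close>.\<close>
  define k where "k = C2 * R"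
  define M1 where "M1 = Sup ((\<lambda>s. \<bar>deriv F1 s\<bar>) ` {sl..su})"
  define M2 where "M2 = Sup ((\<lambda>s. \<bar>deriv F2 s\<bar>) ` {sl..su})"
  have F'b: "\<bar>deriv F1 (Shat r)\<bar> \<le> M1" "\<bar>deriv F2 (Shat r)\<bar> \<le> M2" if r: "r \<in> {r0..R}" for r
    unfolding M1_def M2_def
    using continuous_Icc_Sup_Inf(1)[OF Fseg(3) S_in[OF r]] continuous_Icc_Sup_Inf(1)[OF Fseg(4) S_in[OF r]] by auto
  have M: "M1 \<ge> 0" "M2 \<ge> 0" using F'b[OF r0in] by linarith+
  have \<rho>0: "\<rho> > 0" using r0pos by (simp add: \<rho>_def)
  define t1 where "t1 = g1 (\<bar>c1\<bar> * \<rho>) * (\<bar>c1\<bar> * \<rho>)"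
  define t2 where "t2 = g2 (\<bar>c2\<bar> * \<rho>) * (\<bar>c2\<bar> * \<rho>)"
  have g\<rho>: "g1 (\<bar>c1\<bar> * \<rho>) \<ge> 0" "g2 (\<bar>c2\<bar> * \<rho>) \<ge> 0" using \<gamma>b[OF r0in] g0pos by linarith+
  then have t: "t1 \<ge> 0" "t2 \<ge> 0" using \<rho>0 by (auto simp: t1_def t2_def)
  have C2: "C2 = (t1 + t2) * (M1 + M2)" by (simp add: C_def d_def \<mu>_def M1_def M2_def t1_def t2_def mult.assoc)
  have k0: "k \<ge> 0" using C2 t M R r0pos by (simp add: k_def)
  have bbk: "- k \<le> bb r * r\<^sup>2" if r: "r \<in> {r0..R}" for r
  proof -
    have r1: "r > 0" "r \<le> R" using r r0pos by auto
    define X1 where "X1 = deriv F1 (Shat r) * (\<gamma>1 r * (c1 * r powr (1 - real n)))"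
    define X2 where "X2 = deriv F2 (Shat r) * (\<gamma>2 r * (c2 * r powr (1 - real n)))"
    have "r powr (- real n) * r\<^sup>2 = r * r powr (1 - real n)"
      using r1 by (simp add: powr_diff powr_minus power2_eq_square divide_inverse)
    then have eq: "bb r * r\<^sup>2 = r * (X2 - X1)"
      by (simp add: bb_def X1_def X2_def algebra_simps)
    have nn: "0 \<le> \<gamma>1 r" "0 \<le> \<gamma>2 r" using \<gamma>b[OF r] g0pos by linarith+
    have s: "\<bar>c1 * r powr (1 - real n)\<bar> \<le> \<bar>c1\<bar> * \<rho>" "\<bar>c2 * r powr (1 - real n)\<bar> \<le> \<bar>c2\<bar> * \<rho>"
      using powr_le[OF r] by (auto simp: abs_mult intro!: mult_left_mono)
    have "\<bar>X1\<bar> \<le> M1 * t1" "\<bar>X2\<bar> \<le> M2 * t2"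
      unfolding X1_def X2_def t1_def t2_def abs_mult[of "deriv _ _"] abs_mult[of "\<gamma>1 r"] abs_mult[of "\<gamma>2 r"]
      using F'b[OF r] s \<gamma>b[OF r] nn M g\<rho> \<rho>0 by (auto intro!: mult_mono)
    moreover have "M1 * t1 + M2 * t2 \<le> C2"
      using mult_nonneg_nonneg[OF M(1) t(2)] mult_nonneg_nonneg[OF M(2) t(1)] by (simp add: C2 algebra_simps)
    ultimately have "- C2 \<le> X2 - X1" by linarith
    then have "r * (- C2) \<le> r * (X2 - X1)" using r1 by (intro mult_left_mono) auto
    moreover have "r * C2 \<le> R * C2" using r1 C2 t M by (intro mult_right_mono) auto
    ultimately show ?thesis by (simp add: eq k_def mult.commute)
  qed
  have nN: "real CARD('n) = real n" using n_def by simp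
  note rate = decay_rate_inequality[of "real n" C1 C0 k r0 R \<kappa>0 sR q \<eta>0 \<eta>1, OF _ C1pos C10 k0 r0pos R]
  have \<eta>: "\<eta>1 > 0" "\<eta>1 * (C0 * (R powr (k + 2) / (k + 2))) < real CARD('n) * r0 powr k"
    unfolding nN by (rule rate; use n2 rate_def in \<open>simp add: k_def\<close>)+

  \<comment> \<open>The matrices, the splitting of \<open>A\<close> and the barrier\<close>
  have Ux: "norm x \<in> {r0..R}" "x \<noteq> 0" if "x \<in> U" for x using Usub that r0pos by auto
  have GJ: "Gjac g1 g1' (u1 x) = radmat (\<gamma>1 (norm x)) (\<kappa>1 (norm x) / (norm x)\<^sup>2) x"
    "Gjac g2 g2' (u2 x) = radmat (\<gamma>2 (norm x)) (\<kappa>2 (norm x) / (norm x)\<^sup>2) x" if "x \<in> U" for x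
    unfolding u_def g_def \<gamma>1_def \<gamma>2_def \<kappa>1_def \<kappa>2_def
    by (rule Gjac_radial[OF Ux(2)[OF that] refl])+
  have Beq: "B x = radmat (p (norm x)) (m (norm x)) x" if "x \<in> U" for x
    by (simp add: B_def S_def GJ[OF that] scaleR_radmat radmat_add p_def m_def \<phi>1_def \<phi>2_def)
  define ma where "ma r = (1 / e r - 1 / p r) / r\<^sup>2" for r
  have Aeq: "A x = radmat (1 / p (norm x)) (ma (norm x)) x" if x: "x \<in> U" for x
    unfolding A_def Beq[OF x] ma_def
    using radmat_inverse[OF Ux(2)[OF x], of "p (norm x)" "m (norm x)"] ppos[OF Ux(1)[OF x]] e_eq[OF Ux(1)[OF x]] by simp
  have Cma: "C1_seg r0 R (\<lambda>r. 1 / p r)" "C1_seg r0 R ma"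
    unfolding ma_def by (intro C1_seg_divide C1_seg_diff C1_seg_inverse Cp r2 r2pos ppos; assumption)+
  have A_bC1: "bC1_on U (\<lambda>y. A y $ i $ j)" for i j
    by (rule bC1_on_cong[OF radmat_bC1_on[OF Cma Usub r0pos] Uopen]) (simp add: Aeq)
  have beq: "b x = bb (norm x) *\<^sub>R x" if "x \<in> U" for x
    unfolding b_def u_def Gvec_radial[OF Ux(2)[OF that] refl]
    by (simp add: bb_def S_def \<gamma>1_def \<gamma>2_def algebra_simps)
  have b_bC1: "bC1_on U (\<lambda>y. b y $ j)" for j
    by (rule bC1_on_cong[OF bC1_on_mult[OF C1_seg_bC1_on[OF Cbb Usub r0pos] bC1_on_nth[OF Ubdd, of j]] Uopen])
      (simp add: beq)
  \<comment> \<open>The flux \<open>A c\<close> is linear in \<open>V\<close>; \<open>T\<close> is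
    its coefficient matrix, regular because \<open>A\<close> and the Jacobian are radial.\<close>
  define T where "T x = A x ** (F1 (Sstar x) *\<^sub>R Gjac g1 g1' (u1 x))" for x
  have Ac: "A x *v c x t = T x *v V x t" for x t
    by (simp add: T_def c_def matrix_vector_mul_assoc[symmetric] scaleR_matrix_vector_assoc)
  have T_bC1: "bC1_on U (\<lambda>y. T y $ i $ j)" for i j
  proof -
    have "bC1_on U (\<lambda>y. \<Sum>l\<in>UNIV. A y $ i $ l * radmat (\<phi>1 (norm y) * \<gamma>1 (norm y)) (\<phi>1 (norm y) * (\<kappa>1 (norm y) / (norm y)\<^sup>2)) y $ l $ j)"
      by (intro bC1_on_sum bC1_on_mult A_bC1 radmat_bC1_on[OF _ _ Usub r0pos] C1_seg_mult C1_seg_divide C\<phi> C\<gamma> C\<kappa> r2 r2pos)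
    then show ?thesis
      by (rule bC1_on_cong[OF _ Uopen]) (simp add: T_def GJ S_def \<phi>1_def scaleR_radmat matrix_matrix_mult_def)
  qed
  \<comment> \<open>Half of the lower bound \<open>1 / C0\<close> for the eigenvalues of
    \<open>A\<close>. The eigenvalues of \<open>A - \<nu> I\<close> stay positive, so their square
    roots are differentiable.\<close>
  define \<nu> where "\<nu> = 1 / (2 * C0)"
  have C0pos: "C0 > 0" using C1pos C10 by linarith
  have \<nu>: "\<nu> > 0" using C0pos by (simp add: \<nu>_def)
  have \<nu>lt: "\<nu> < 1 / e r" "\<nu> < 1 / p r" if r: "r \<in> {r0..R}" for r
  proof -
    have "1 / (2 * C0) < 1 / C0" using C0pos by (simp add: field_simps)
    moreover have "1 / C0 \<le> 1 / e r" "1 / e r \<le> 1 / p r"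
      using ppos[OF r] eC0[OF r] pe[OF r] by (auto intro!: divide_left_mono)
    ultimately show "\<nu> < 1 / e r" "\<nu> < 1 / p r" by (auto simp: \<nu>_def)
  qed
  define qt where "qt r = sqrt (1 / p r - \<nu>)" for r
  define qr where "qr r = sqrt (1 / e r - \<nu>)" for r
  \<comment> \<open>Chosen so that \<open>qt r + ww r * r\<^sup>2 = qr r\<close>: the matrix with
    coefficients \<open>qt\<close> and \<open>ww\<close> has eigenvalues \<open>qt\<close> and
    \<open>qr\<close>, and so is the square root of \<open>A - \<nu> I\<close>.\<close>
  define ww where "ww r = (qr r - qt r) / r\<^sup>2" for r
  have Cq: "C1_seg r0 R qt" "C1_seg r0 R qr"
    unfolding qt_def qr_def using \<nu>lt by (intro C1_seg_sqrt C1_seg_diff C1_seg_inverse C1_seg_const Cp ppos; simp)+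
  have Cw: "C1_seg r0 R ww" unfolding ww_def by (intro C1_seg_divide C1_seg_diff Cq r2 r2pos)
  define Mc where "Mc i x = radmat (qt (norm x)) (ww (norm x)) x $ i" for i and x :: "real^'n"
  have Mc_bC1: "bC1_on U (\<lambda>y. Mc i y $ j)" for i j
    unfolding Mc_def by (rule radmat_bC1_on[OF Cq(1) Cw Usub r0pos])
  have A_split: "A x $ i $ j = (if i = j then \<nu> else 0) + (\<Sum>l\<in>UNIV. Mc l x $ i * Mc l x $ j)" if x: "x \<in> U" for x i j
  proof -
    define r where "r = norm x"
    have r: "r \<in> {r0..R}" using Ux(1)[OF x] by (simp add: r_def)
    have sq: "(qt r)\<^sup>2 = 1 / p r - \<nu>" "(qr r)\<^sup>2 = 1 / e r - \<nu>"
      using \<nu>lt[OF r] by (auto simp: qt_def qr_def)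
    have "2 * qt r * ww r + (ww r)\<^sup>2 * r\<^sup>2 = ww r * (2 * qt r + ww r * r\<^sup>2)"
      by (simp add: power2_eq_square[of "ww r"] algebra_simps)
    also have "ww r * r\<^sup>2 = qr r - qt r" using r2pos[OF r] by (simp add: ww_def)
    also have "2 * qt r + (qr r - qt r) = qr r + qt r" by simp
    also have "ww r * (qr r + qt r) = ((qr r)\<^sup>2 - (qt r)\<^sup>2) / r\<^sup>2"
      by (simp add: ww_def power2_eq_square algebra_simps)
    also have "\<dots> = ma r" by (simp add: sq ma_def)
    finally have "(\<Sum>l\<in>UNIV. Mc l x $ i * Mc l x $ j) = radmat (1 / p r - \<nu>) (ma r) x $ i $ j"
      unfolding Mc_def r_def[symmetric] using radmat_square_nth[OF sq(1), of "ww r" x "ma r"] by (simp add: r_def)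
    then show ?thesis by (simp add: Aeq[OF x] radmat_nth r_def)
  qed
  have Ax: "A x *v x = (1 / e (norm x)) *\<^sub>R x" if x: "x \<in> U" for x
    unfolding Aeq[OF x] radmat_self using r2pos[OF Ux(1)[OF x]] by (simp add: ma_def)
  obtain \<Psi> GP HP \<psi>0 \<psi>1 where \<Psi>: "twice_diff_on U \<Psi> GP HP" "continuous_on (closure U) \<Psi>"
    "\<And>x. x \<in> closure U \<Longrightarrow> \<psi>0 \<le> \<Psi> x" "\<And>x. x \<in> closure U \<Longrightarrow> \<Psi> x \<le> \<psi>1" "\<psi>0 > 0"
    "\<And>x. x \<in> U \<Longrightarrow> (\<Sum>i\<in>UNIV. pd i (\<lambda>y. (A y *v (GP y - \<Psi> y *\<^sub>R b y)) $ i) x) \<le> - \<eta>1 * \<Psi> x"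
    by (rule radial_barrier[OF r0pos R Uopen Usub Cbb Cp(2) ppos(2) eC0 k0 bbk Ax beq \<eta>]) blast+
  interpret P: linear_parabolic_problem U A T b \<nu> Mc \<Psi> GP HP \<psi>0 \<psi>1 \<eta>1 V \<sigma>
  proof
    show "has_pd i (\<lambda>y. V y t $ j) x" if "x \<in> U" "t > 0" for x t i j
    proof -
      have "Cx_bar 6 U {0..} (\<lambda>x t. V x t $ j)" using VC6 by blast
      then have "length ([] :: 'n list) < 6 \<longrightarrow> (\<forall>i. \<forall>x\<in>U. \<forall>t\<in>{0..}. has_pd i (ipd [] (\<lambda>y. V y t $ j)) x)"
        unfolding Cx_bar_def by (metis less_imp_le)
      then show ?thesis using that by simp
    qed
    show "deriv (\<lambda>s. \<sigma> x s) t =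
          (\<Sum>i\<in>UNIV. pd i (\<lambda>y. (A y *v ((\<chi> i. pd i (\<lambda>y. \<sigma> y t) y) - \<sigma> y t *\<^sub>R b y)) $ i) x)
        + (\<Sum>i\<in>UNIV. pd i (\<lambda>y. (T y *v V y t) $ i) x)" if "x \<in> U" "t > 0" for x t
      using \<sigma>pde that unfolding grad_def Ac by simp
  qed (fact Uopen Ubdd \<sigma>c \<sigma>C21 \<nu> \<eta>(1) \<Psi>(1) \<Psi>(2) \<Psi>(5) | rule A_bC1 b_bC1 T_bC1 Mc_bC1 A_split \<Psi>, assumption?)+
  have flux: "P.flux x t = v2 x t" for x t
    by (simp add: P.flux_def P.grad_def v2_def grad_def Ac)

  \<comment> \<open>Bounds for the data\<close>
  have Vle: "Vsize V x t \<le> \<Delta>6" if "x \<in> U" "t > 0" for x t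
    unfolding \<Delta>_def using Delta6 that by (intro cSup_upper) (auto simp: D_def image_iff)
  have gle: "\<bar>gb x t\<bar> \<le> \<Delta>7" if "x \<in> \<Gamma>" "t \<ge> 0" for x t
    unfolding \<Delta>_def using Delta7 that by (intro cSup_upper) (auto simp: image_iff)
  \<comment> \<open>A nonempty bounded open set has a boundary point, so suprema over the boundary
    are taken over a nonempty set.\<close>
  have "U \<noteq> UNIV" using Ubdd not_bounded_UNIV by blast
  then have \<Gamma>ne: "\<Gamma> \<noteq> {}" using False frontier_not_empty \<Gamma>_def by blast
  obtain x0 where x0: "x0 \<in> U" using False by blast
  obtain y0 where y0: "y0 \<in> \<Gamma>" using \<Gamma>ne by blast
  have \<Delta>6: "\<Delta>6 \<ge> 0" using Vle[OF x0, of 1] Vsize_bounds(4)[of V x0 1] by linarith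
  have \<Delta>7: "\<Delta>7 \<ge> 0" using gle[OF y0, of 0] by linarith
  have bdd0: "bdd_above ((\<lambda>x. \<bar>\<sigma>0 x\<bar>) ` U)"
  proof -
    have "compact ((\<lambda>x. \<bar>\<sigma>0 x\<bar>) ` closure U)"
      using Ubdd by (intro compact_continuous_image continuous_intros \<sigma>0c) (simp add: compact_closure)
    then have "bdd_above ((\<lambda>x. \<bar>\<sigma>0 x\<bar>) ` closure U)"
      by (intro bounded_imp_bdd_above compact_imp_bounded)
    then show ?thesis by (rule bdd_above_mono) (use closure_subset in blast)
  qed
  have s0U: "\<bar>\<sigma> x 0\<bar> \<le> sup\<sigma>0" if "x \<in> U" for x
    unfolding sup_def using bdd0 \<sigma>init that by (auto intro!: cSup_upper)
  have sup0: "sup\<sigma>0 \<ge> 0" using s0U[OF x0] by linarith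
  have init: "P.init_le 0 sup\<sigma>0"
  proof -
    \<comment> \<open>The initial condition is given on \<open>U\<close> only; continuity carries
      its bound to the closure, where the comparison needs it.\<close>
    have "continuous_on (closure U) (\<lambda>x. (\<lambda>(x,t). \<sigma> x t) (x, 0))"
      by (rule continuous_on_compose2[OF \<sigma>c]) (auto intro!: continuous_intros)
    then have "continuous_on (closure U) (\<lambda>x. \<sigma> x 0)" by simp
    then have "norm (\<sigma> x 0) \<le> sup\<sigma>0" if "x \<in> closure U" for x
      using continuous_on_closure_norm_le[of U "\<lambda>x. \<sigma> x 0" sup\<sigma>0 x] s0U that by simp
    then show ?thesis using sup0 by (simp add: P.init_le_def)
  qed

  \<comment> \<open>The estimate and the limit\<close>
  show ?thesis
  proof (intro conjI allI impI)
    fix U' assume U': "open U' \<and> closure U' \<subseteq> U"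
    have U'U: "U' \<subseteq> U" using U' closure_subset by blast
    have "compact (closure U')" using U'U Ubdd bounded_subset by (metis compact_closure)
    from P.velocity_bound[OF this conjunct2[OF U']]
    obtain M where M: "M > 0" "\<And>s0 \<Delta> x t. P.data_le 0 \<Delta> \<Longrightarrow> P.init_le 0 s0 \<Longrightarrow> x \<in> closure U' \<Longrightarrow> t > 0 \<Longrightarrow>
       norm (P.flux x t) \<le> M * (1 + 1 / sqrt t) * (exp (- \<eta>1 * t) * s0 + \<Delta>)"
      by blast
    have data: "P.data_le 0 (\<Delta>6 + \<Delta>7)"
      unfolding P.data_le_def using Vle gle \<sigma>bdry \<Delta>6 \<Delta>7 unfolding \<Gamma>_def
      by (auto intro: add_increasing add_increasing2)
    show "\<exists>M>0. \<forall>t>0. \<forall>x\<in>U'.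
          norm (v1 x t) \<le> M * (1 + 1 / sqrt t) * (exp (- \<eta>1 * t) * sup\<sigma>0 + \<Delta>6 + sqrt \<Delta>6 + \<Delta>7)
        \<and> norm (v2 x t) \<le> M * (1 + 1 / sqrt t) * (exp (- \<eta>1 * t) * sup\<sigma>0 + \<Delta>6 + sqrt \<Delta>6 + \<Delta>7)"
    \<comment> \<open>The added 1 pays for \<open>V\<close> in \<open>v1 = V - v2\<close>. The flux
      bound has only \<open>\<Delta>6 + \<Delta>7\<close> in its bracket, and the nonnegative
      \<open>sqrt \<Delta>6\<close> enlarges it.\<close>
    proof (intro exI[of _ "M + 1"] conjI allI impI ballI)
      show "M + 1 > 0" using M(1) by simp
      fix t :: real and x assume t: "0 < t" and x: "x \<in> U'"
      define E where "E = exp (- \<eta>1 * t) * sup\<sigma>0 + (\<Delta>6 + \<Delta>7)"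
      define w where "w = 1 + 1 / sqrt t"
      have w: "w \<ge> 1" using t by (simp add: w_def)
      have E: "E \<ge> 0" "\<Delta>6 \<le> E" using sup0 \<Delta>6 \<Delta>7 by (auto simp: E_def)
      have EE: "exp (- \<eta>1 * t) * sup\<sigma>0 + \<Delta>6 + sqrt \<Delta>6 + \<Delta>7 = E + sqrt \<Delta>6" by (simp add: E_def)
      have "norm (v2 x t) \<le> M * w * E"
        unfolding flux[symmetric] E_def w_def
        using M(2)[OF data init _ t] x closure_subset[of U'] by auto
      moreover have "norm (V x t) \<le> w * E"
      proof -
        have "norm (V x t) \<le> 1 * E"
          using Vsize_bounds(1)[of V x t] Vle[of x t] x U'U t E by force
        also have "\<dots> \<le> w * E" using w E by (intro mult_right_mono)
        finally show ?thesis .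
      qed
      moreover have "norm (v1 x t) \<le> norm (V x t) + norm (v2 x t)"
        unfolding v1_def by (rule norm_triangle_ineq4)
      moreover have "M * w * E + w * E \<le> (M + 1) * w * (E + sqrt \<Delta>6)"
      proof -
        have "(M + 1) * w * E \<le> (M + 1) * w * (E + sqrt \<Delta>6)"
          using M(1) w \<Delta>6 by (intro mult_left_mono) auto
        then show ?thesis by (simp add: algebra_simps)
      qed
      moreover have "0 \<le> w * E" using w E by simp
      ultimately show "norm (v1 x t) \<le> (M + 1) * (1 + 1 / sqrt t) * (exp (- \<eta>1 * t) * sup\<sigma>0 + \<Delta>6 + sqrt \<Delta>6 + \<Delta>7)"
        "norm (v2 x t) \<le> (M + 1) * (1 + 1 / sqrt t) * (exp (- \<eta>1 * t) * sup\<sigma>0 + \<Delta>6 + sqrt \<Delta>6 + \<Delta>7)"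
        unfolding EE w_def[symmetric] by linarith+
    qed
  next
    assume lim: "((\<lambda>t. Sup ((\<lambda>x. Vsize V x t) ` U) + Sup ((\<lambda>x. \<bar>gb x t\<bar>) ` \<Gamma>)) \<longlongrightarrow> 0) at_top"
    have small: "\<exists>T0\<ge>0. P.data_le T0 \<epsilon>" if \<epsilon>: "\<epsilon> > 0" for \<epsilon>
    proof -
      obtain T1 where T1: "\<And>t. t \<ge> T1 \<Longrightarrow> Sup ((\<lambda>x. Vsize V x t) ` U) + Sup ((\<lambda>x. \<bar>gb x t\<bar>) ` \<Gamma>) < \<epsilon>"
        using order_tendstoD(2)[OF lim \<epsilon>] unfolding eventually_at_top_linorder by blast
      \<comment> \<open>Only the sum of the two suprema is known to be small. Each of them is
        nonnegative, being a supremum of nonnegative values over a nonempty set, so each is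
        small.\<close>
      have both: "Vsize V y t \<le> \<epsilon>" "\<bar>gb z t\<bar> \<le> \<epsilon>" if t: "t > max 0 T1" and y: "y \<in> U" and z: "z \<in> \<Gamma>" for y z t
      proof -
        have "bdd_above ((\<lambda>x. Vsize V x t) ` U)" using Vle t by (intro bdd_aboveI2[where M = \<Delta>6]) auto
        then have 1: "Vsize V y t \<le> Sup ((\<lambda>x. Vsize V x t) ` U)" using y by (intro cSup_upper) auto
        have "bdd_above ((\<lambda>x. \<bar>gb x t\<bar>) ` \<Gamma>)" using gle t by (intro bdd_aboveI2[where M = \<Delta>7]) auto
        then have 2: "\<bar>gb z t\<bar> \<le> Sup ((\<lambda>x. \<bar>gb x t\<bar>) ` \<Gamma>)" using z by (intro cSup_upper) auto
        show "Vsize V y t \<le> \<epsilon>" "\<bar>gb z t\<bar> \<le> \<epsilon>"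
          using 1 2 T1[of t] t Vsize_bounds(4)[of V y t] by auto
      qed
      show ?thesis
        using both[OF _ _ y0] both[OF _ x0] \<sigma>bdry \<epsilon> unfolding \<Gamma>_def P.data_le_def by (intro exI[of _ "max 0 T1"]) auto
    qed
    have lims: "(v1 x \<longlongrightarrow> 0) at_top" "(v2 x \<longlongrightarrow> 0) at_top" if x: "x \<in> U" for x
    proof -
      show v2: "(v2 x \<longlongrightarrow> 0) at_top"
        using P.velocity_tendsto[OF x small] unfolding flux .
      have "((\<lambda>t. V x t) \<longlongrightarrow> 0) at_top"
        unfolding tendsto_iff dist_norm diff_zero
      proof (intro allI impI)
        fix \<epsilon> :: real assume "\<epsilon> > 0"
        then obtain T0 where T0: "\<forall>y\<in>U. \<forall>t>T0. Vsize V y t \<le> \<epsilon> / 2" using small[of "\<epsilon> / 2"] by (auto simp: P.data_le_def)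
        have "norm (V x t) < \<epsilon>" if "t > T0" for t
          using T0 x that Vsize_bounds(1)[of V x t] \<open>\<epsilon> > 0\<close> by fastforce
        then show "\<forall>\<^sub>F t in at_top. norm (V x t) < \<epsilon>"
          unfolding eventually_at_top_dense by blast
      qed
      from tendsto_diff[OF this v2] show "(v1 x \<longlongrightarrow> 0) at_top" by (simp add: v1_def)
    qed
    show "\<forall>x\<in>U. ((\<lambda>t. v1 x t) \<longlongrightarrow> 0) at_top \<and> ((\<lambda>t. v2 x t) \<longlongrightarrow> 0) at_top"
      using lims by blast
  qed
qed

end
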